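(* Let $X$, $Y$, $A$ be based spaces satisfying the standing assumptions in the context. Then there is an isomorphism of abelian groups $$\mathcal{G}\big(\Sigma A, \mathrm{map}(X,Y;0)\big) \cong \mathcal{G}(\Sigma A, Y) \oplus \mathcal{G}(\Sigma(A\wedge X), Y).$$ In particular, for each $n\geq 1$, there is an isomorphism of abelian groups $$G_n\big(\mathrm{map}(X,Y;0)\big) \cong G_n(Y)\oplus \mathcal{G}(\Sigma^n X, Y).$$
   Context: Standing assumptions: $X$, $Y$, $A$ are based spaces that are locally compact, Hausdorff and well-pointed; $X$ and $Y$ are connected, while $A$ may be disconnected (no finiteness or simple connectivity is assumed, and the spaces need not be CW complexes). $\Sigma$ is reduced suspension, $\wedge$ is smash product. Mapping spaces consist of unbased maps and carry the compact-open topology. $\mathrm{map}(X,Y;0)$ denotes the path component of the null (constant) map in the space of unbased maps $X\to Y$, based at the constant map at the basepoint of $Y$. For a based space $Z$, $\mathrm{aut}_1 Z$ denotes the path component of the identity map $1_Z$ in the space of unbased self-maps of $Z$, based at $1_Z$, and $\omega\colon \mathrm{aut}_1 Z\to Z$ is evaluation at the basepoint of $Z$. $[\Sigma A,Z]$ is the group of based homotopy classes of based maps. The generalized Gottlieb group $\mathcal{G}(\Sigma A, Z)$ is the image of $\omega_*\colon [\Sigma A,\mathrm{aut}_1 Z]\to[\Sigma A,Z]$; it is an abelian subgroup of $[\Sigma A,Z]$. The $n$th Gottlieb group is $G_n(Z)=\mathcal{G}(\Sigma S^{n-1},Z)$, i.e. the image of $\omega_\#\colon\pi_n(\mathrm{aut}_1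 Z)\to\pi_n(Z)$, for $n\ge1$. *)

theory Defs
  imports "HOL-Analysis.Analysis" "HOL-Algebra.Group"
begin

text \<open>A based space is a topology together with a point, required to lie in the underlying set.\<close>

type_synonym 'a based = "'a topology \<times> 'a"

definition based_space :: "'a based \<Rightarrow> bool" where
  "based_space X \<longleftrightarrow> snd X \<in> topspace (fst X)"

abbreviation unit_interval :: "real topology" where
  "unit_interval \<equiv> top_of_set {0..1}"


section \<open>Well-pointed spaces\<close>

definition point_extension :: "'a based \<Rightarrow> 'z topology \<Rightarrow> bool" where
  "point_extension X Z \<longleftrightarrow>
     (\<forall>f p. continuous_map (fst X) Z f \<and> continuous_map unit_interval Z p \<and> p 0 = f (snd X) \<longrightarrow>
        (\<exists>H. continuous_map (prod_topology (fst X) unit_interval) Z H \<and>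
             (\<forall>x\<in>topspace (fst X). H (x, 0) = f x) \<and> (\<forall>t\<in>{0..1}. H (snd X, t) = p t)))"

text \<open>The inclusion of the base point is a cofibration.  A definition can quantify only over target
  spaces on one type; the type \<open>'a \<times> real\<close> carries the mapping cylinder of the inclusion, which is
  the universal target.  The lemma below gives the homotopy extension property for targets on
  arbitrary types.\<close>

definition well_pointed :: "'a based \<Rightarrow> bool" where
  "well_pointed X \<longleftrightarrow> (\<forall>Z :: ('a \<times> real) topology. point_extension X Z)"

lemma well_pointed_point_extension:
  fixes Z :: "'z topology"
  assumes wp: "well_pointed X" and b: "based_space X" and haus: "Hausdorff_space (fst X)"
  shows "point_extension X Z"
  unfolding point_extension_def
proof (intro allI impI)
  fix f :: "'a \<Rightarrow> 'z" and p :: "real \<Rightarrow> 'z"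
  assume fp: "continuous_map (fst X) Z f \<and> continuous_map unit_interval Z p \<and> p 0 = f (snd X)"
  let ?P = "prod_topology (fst X) unit_interval"
  define x0 where "x0 = snd X"
  have x0: "x0 \<in> topspace (fst X)" using b by (simp add: based_space_def x0_def)
  define S where "S = topspace (fst X) \<times> {0} \<union> {x0} \<times> {0..1::real}"
  define M where "M = subtopology ?P S"
  have SP: "S \<subseteq> topspace ?P" using x0 by (auto simp: S_def)
  have tM: "topspace M = S" using SP by (auto simp: M_def)
  have i: "continuous_map (fst X) M (\<lambda>x. (x, 0))"
    by (auto simp: M_def continuous_map_in_subtopology continuous_map_pairwise o_def S_def)
  have j: "continuous_map unit_interval M (\<lambda>t. (x0, t))"
    using x0 by (auto simp: M_def continuous_map_in_subtopology continuous_map_pairwise o_def S_def)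
  have "point_extension X M" using wp by (simp add: well_pointed_def)
  then obtain r where r: "continuous_map ?P M r"
      and r0: "\<forall>x\<in>topspace (fst X). r (x, 0) = (x, 0)" and r1: "\<forall>t\<in>{0..1}. r (x0, t) = (x0, t)"
    using i j unfolding point_extension_def x0_def by blast
  define g where "g = (\<lambda>z. if snd z = (0::real) then f (fst z) else p (snd z))"
  have cl0: "closedin M {z \<in> topspace M. snd z \<in> {0}}"
  proof (rule closedin_continuous_map_preimage)
    show "continuous_map M unit_interval snd"
      unfolding M_def by (intro continuous_map_from_subtopology continuous_map_snd)
    show "closedin unit_interval {0}"
      by (simp add: closedin_Hausdorff_singleton Hausdorff_space_subtopology)
  qed
  have cl1: "closedin M {z \<in> topspace M. fst z \<in> {x0}}"
  proof (rule closedin_continuous_map_preimage)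
    show "continuous_map M (fst X) fst"
      unfolding M_def by (intro continuous_map_from_subtopology continuous_map_fst)
    show "closedin (fst X) {x0}"
      by (simp add: closedin_Hausdorff_singleton haus x0)
  qed
  have cont: "continuous_map M Z (f \<circ> fst)" "continuous_map M Z (p \<circ> snd)"
  proof -
    have "continuous_map M (fst X) fst" "continuous_map M unit_interval snd"
      unfolding M_def
      by (intro continuous_map_from_subtopology continuous_map_fst continuous_map_snd)+
    then show "continuous_map M Z (f \<circ> fst)" "continuous_map M Z (p \<circ> snd)"
      using fp continuous_map_compose by blast+
  qed
  define T where "T = (\<lambda>b. {z \<in> topspace M. if b then snd z \<in> {0} else fst z \<in> {x0}})"
  define F where "F = (\<lambda>b. if b then f \<circ> fst else p \<circ> (snd :: 'a \<times> real \<Rightarrow> real))"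
  have g: "continuous_map M Z g"
  proof (rule pasting_lemma_closed[where I = UNIV and T = T and f = F])
    show "closedin M (T b)" for b using cl0 cl1 by (cases b) (simp_all add: T_def)
    show "continuous_map (subtopology M (T b)) Z (F b)" for b
      using cont by (cases b) (simp_all add: F_def continuous_map_from_subtopology)
    show "F b z = F c z" if "z \<in> topspace M \<inter> T b \<inter> T c" for b c z
      using that fp by (cases b; cases c) (auto simp: F_def T_def x0_def)
    show "\<exists>b. b \<in> UNIV \<and> z \<in> T b \<and> g z = F b z" if "z \<in> topspace M" for z
    proof (intro exI conjI)
      show "z \<in> T (snd z = 0)" using that by (auto simp: T_def tM S_def)
      show "g z = F (snd z = 0) z" by (simp add: F_def g_def)
    qed simp
  qed simp
  show "\<exists>H. continuous_map ?P Z H \<and> (\<forall>x\<in>topspace (fst X). H (x, 0) = f x) \<and>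
          (\<forall>t\<in>{0..1}. H (snd X, t) = p t)"
  proof (intro exI conjI)
    show "continuous_map ?P Z (g \<circ> r)" using r g by (rule continuous_map_compose)
  qed (use r0 r1 fp in \<open>auto simp: g_def x0_def\<close>)
qed


section \<open>Quotients, reduced suspensions and smash products\<close>

definition quotient_topology :: "'a topology \<Rightarrow> ('a \<Rightarrow> 'b) \<Rightarrow> 'b topology" where
  "quotient_topology X q =
     topology (\<lambda>U. U \<subseteq> q ` topspace X \<and> openin X {x \<in> topspace X. q x \<in> U})"

lemma openin_quotient_topology:
  "openin (quotient_topology X q) U \<longleftrightarrow>
     U \<subseteq> q ` topspace X \<and> openin X {x \<in> topspace X. q x \<in> U}"
proof -
  have "{x \<in> topspace X. q x \<in> S \<inter> T} =
      {x \<in> topspace X. q x \<in> S} \<inter> {x \<in> topspace X. q x \<in> T}" for S T by blast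
  moreover have "{x \<in> topspace X. q x \<in> \<Union>K} = (\<Union>S\<in>K. {x \<in> topspace X. q x \<in> S})" for K by blast
  ultimately have "istopology (\<lambda>U. U \<subseteq> q ` topspace X \<and> openin X {x \<in> topspace X. q x \<in> U})"
    unfolding istopology_def by (auto intro!: openin_Union)
  then show ?thesis by (simp add: quotient_topology_def topology_inverse')
qed

lemma topspace_quotient_topology [simp]: "topspace (quotient_topology X q) = q ` topspace X"
proof (rule subset_antisym)
  show "topspace (quotient_topology X q) \<subseteq> q ` topspace X"
    using openin_quotient_topology[of X q "topspace (quotient_topology X q)"] by simp
  have "{x \<in> topspace X. q x \<in> q ` topspace X} = topspace X" by blast
  then show "q ` topspace X \<subseteq> topspace (quotient_topology X q)"
    by (intro openin_subset) (simp add: openin_quotient_topology)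
qed

lemma quotient_map_quotient_topology: "quotient_map X (quotient_topology X q) q"
  by (auto simp: quotient_map_def openin_quotient_topology)

text \<open>The quotient of \<open>X\<close> by a subset \<open>S\<close> containing \<open>p\<close> is realised on the type of \<open>X\<close> itself: \<open>p\<close>
  stands for the class \<open>S\<close>, and every point outside \<open>S\<close> for its own class.\<close>

definition collapse_map :: "'a set \<Rightarrow> 'a \<Rightarrow> 'a \<Rightarrow> 'a" where
  "collapse_map S p x = (if x \<in> S then p else x)"

definition collapse :: "'a topology \<Rightarrow> 'a set \<Rightarrow> 'a \<Rightarrow> 'a based" where
  "collapse X S p = (quotient_topology X (collapse_map S p), p)"

definition susp_collapsed :: "'a based \<Rightarrow> ('a \<times> real) set" where
  "susp_collapsed A = topspace (fst A) \<times> {0, 1} \<union> {snd A} \<times> {0..1}"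

definition susp_proj :: "'a based \<Rightarrow> 'a \<times> real \<Rightarrow> 'a \<times> real" where
  "susp_proj A = collapse_map (susp_collapsed A) (snd A, 0)"

definition suspension :: "'a based \<Rightarrow> ('a \<times> real) based" where
  "suspension A = collapse (prod_topology (fst A) unit_interval) (susp_collapsed A) (snd A, 0)"

definition smash :: "'a based \<Rightarrow> 'b based \<Rightarrow> ('a \<times> 'b) based" where
  "smash A B =
     collapse (prod_topology (fst A) (fst B))
       (topspace (fst A) \<times> {snd B} \<union> {snd A} \<times> topspace (fst B)) (snd A, snd B)"

text \<open>To iterate the suspension on a single type, the point \<open>((x, ts), t)\<close> of the suspension is renamed
  to \<open>(x, t # ts)\<close>.  For injective \<open>q\<close>, the map \<open>q\<close> is a homeomorphism from \<open>X\<close> onto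
  \<open>quotient_topology X q\<close>.\<close>

definition rename_based :: "('a \<Rightarrow> 'b) \<Rightarrow> 'a based \<Rightarrow> 'b based" where
  "rename_based q X = (quotient_topology (fst X) q, q (snd X))"

lemma homeomorphic_map_quotient_topology:
  assumes "inj q"
  shows "homeomorphic_map X (quotient_topology X q) q"
  using assms quotient_map_quotient_topology[of X q]
  by (auto simp: homeomorphic_map_def intro: inj_on_subset)

fun iterated_suspension :: "nat \<Rightarrow> 'a based \<Rightarrow> ('a \<times> real list) based" where
  "iterated_suspension 0 X = rename_based (\<lambda>x. (x, [])) X"
| "iterated_suspension (Suc n) X =
     rename_based (\<lambda>((x, ts), t). (x, t # ts)) (suspension (iterated_suspension n X))"

definition based_sphere :: "nat \<Rightarrow> (nat \<Rightarrow> real) based" where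
  "based_sphere n = (nsphere n, \<lambda>i. if i = 0 then 1 else 0)"


section \<open>Mapping spaces\<close>

text \<open>Points of a mapping space are the continuous maps, normalised to be \<open>undefined\<close> outside the
  domain so that each map is represented once; the topology is the compact-open topology.\<close>

definition continuous_maps :: "'a topology \<Rightarrow> 'b topology \<Rightarrow> ('a \<Rightarrow> 'b) set" where
  "continuous_maps X Y = {f \<in> extensional (topspace X). continuous_map X Y f}"

definition mapping_space :: "'a topology \<Rightarrow> 'b topology \<Rightarrow> ('a \<Rightarrow> 'b) topology" where
  "mapping_space X Y =
     topology_generated_by {{f \<in> continuous_maps X Y. f ` K \<subseteq> U} | K U. compactin X K \<and> openin Y U}"

lemma topspace_mapping_space [simp]: "topspace (mapping_space X Y) = continuous_maps X Y"
proof -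
  have "continuous_maps X Y = {f \<in> continuous_maps X Y. f ` {} \<subseteq> {}}" by simp
  moreover have "compactin X {}" "openin Y {}" by simp_all
  ultimately have "continuous_maps X Y \<in>
      {{f \<in> continuous_maps X Y. f ` K \<subseteq> U} | K U. compactin X K \<and> openin Y U}" by blast
  then show ?thesis
    unfolding mapping_space_def topology_generated_by_topspace by blast
qed

definition path_component_at :: "'a topology \<Rightarrow> 'a \<Rightarrow> 'a based" where
  "path_component_at X x = (subtopology X (path_component_of_set X x), x)"

definition null_component :: "'a based \<Rightarrow> 'b based \<Rightarrow> ('a \<Rightarrow> 'b) based" where
  "null_component X Y =
     path_component_at (mapping_space (fst X) (fst Y)) (\<lambda>x\<in>topspace (fst X). snd Y)"

definition aut1 :: "'a based \<Rightarrow> ('a \<Rightarrow> 'a) based" where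
  "aut1 Z = path_component_at (mapping_space (fst Z) (fst Z)) (\<lambda>z\<in>topspace (fst Z). z)"


section \<open>Homotopy classes of maps out of a suspension\<close>

definition based_maps :: "'a based \<Rightarrow> 'b based \<Rightarrow> ('a \<Rightarrow> 'b) set" where
  "based_maps B Z = {f. continuous_map (fst B) (fst Z) f \<and> f (snd B) = snd Z}"

definition homotopy_class :: "'a based \<Rightarrow> 'b based \<Rightarrow> ('a \<Rightarrow> 'b) \<Rightarrow> ('a \<Rightarrow> 'b) set" where
  "homotopy_class B Z f = {g. homotopic_with (\<lambda>h. h (snd B) = snd Z) (fst B) (fst Z) f g}"

definition homotopy_classes :: "'a based \<Rightarrow> 'b based \<Rightarrow> ('a \<Rightarrow> 'b) set set" where
  "homotopy_classes B Z = homotopy_class B Z ` based_maps B Z"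

definition susp_add ::
  "'a based \<Rightarrow> ('a \<times> real \<Rightarrow> 'z) \<Rightarrow> ('a \<times> real \<Rightarrow> 'z) \<Rightarrow> 'a \<times> real \<Rightarrow> 'z" where
  "susp_add A f g = (\<lambda>(a, t).
     if t \<le> 1/2 then f (susp_proj A (a, 2 * t)) else g (susp_proj A (a, 2 * t - 1)))"

definition susp_group :: "'a based \<Rightarrow> 'z based \<Rightarrow> ('a \<times> real \<Rightarrow> 'z) set monoid" where
  "susp_group A Z =
     \<lparr>carrier = homotopy_classes (suspension A) Z,
      mult = (\<lambda>C D. \<Union>f\<in>C. \<Union>g\<in>D. homotopy_class (suspension A) Z (susp_add A f g)),
      one = homotopy_class (suspension A) Z (\<lambda>_. snd Z)\<rparr>"

definition induced_map ::
  "'a based \<Rightarrow> 'z based \<Rightarrow> ('w \<Rightarrow> 'z) \<Rightarrow> ('a \<Rightarrow> 'w) set \<Rightarrow> ('a \<Rightarrow> 'z) set" where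
  "induced_map B Z \<phi> C = (\<Union>f\<in>C. homotopy_class B Z (\<phi> \<circ> f))"


section \<open>Gottlieb groups\<close>

definition evaluation :: "'z based \<Rightarrow> ('z \<Rightarrow> 'z) \<Rightarrow> 'z" where
  "evaluation Z f = f (snd Z)"

text \<open>\<open>gottlieb_group A Z\<close> is the generalized Gottlieb group \<open>\<G>(\<Sigma>A, Z)\<close>, with the suspension of the
  first argument built in.\<close>

definition gottlieb_group :: "'a based \<Rightarrow> 'z based \<Rightarrow> ('a \<times> real \<Rightarrow> 'z) set monoid" where
  "gottlieb_group A Z =
     (susp_group A Z)\<lparr>carrier :=
        induced_map (suspension A) Z (evaluation Z) ` carrier (susp_group A (aut1 Z))\<rparr>"

text \<open>Used for \<open>n \<ge> 1\<close> only.\<close>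

definition gottlieb_n :: "nat \<Rightarrow> 'z based \<Rightarrow> ((nat \<Rightarrow> real) \<times> real \<Rightarrow> 'z) set monoid" where
  "gottlieb_n n Z = gottlieb_group (based_sphere (n - 1)) Z"

end

theory Submission
  imports Defs "HOL-Algebra.Coset"
begin

text \<open>
  Write \<open>M\<close> for the null component, the path component of the constant map in the space of maps
  from \<open>X\<close> to \<open>Y\<close>. There are two evident ways to produce maps from the suspension of \<open>A\<close> to \<open>M\<close>:
  composing a map to \<open>Y\<close> with the inclusion of the constant maps, and taking the adjoint of a map
  from the suspension of \<open>A \<and> X\<close> to \<open>Y\<close>. Both respect Gottlieb elements (\<open>const_class_gottlieb\<close>,
  \<open>adjoint_class_gottlieb\<close>), because a family of self-maps \<open>G(z, x, -)\<close> of \<open>Y\<close> parametrised by \<open>z\<close>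
  in the suspension of \<open>A\<close> and by \<open>x\<close> in \<open>X\<close> acts on \<open>M\<close> by \<open>(z, m) \<mapsto> (x \<mapsto> G(z, x, m x))\<close>.
  Conversely every family of self-maps of \<open>M\<close> yields such a \<open>G\<close> when it is restricted to the
  constant maps. So the Gottlieb group of \<open>M\<close> consists of the classes of \<open>z \<mapsto> (x \<mapsto> G(z, x, y0))\<close>,
  with \<open>y0\<close> the base point of \<open>Y\<close>. No family of self-maps of \<open>M\<close> is ever evaluated at all points
  of \<open>M\<close>, which need not be locally compact: evaluation along maps from locally compact spaces
  (\<open>continuous_map_eval_along\<close>) suffices.

  The product of the two constructions is the isomorphism. It is a homomorphism because Gottlieb
  groups are commutative (\<open>gottlieb_commute\<close>). For injectivity and surjectivity one has to replace
  families over \<open>X\<close> by families that are constant over the base point of \<open>X\<close>. Here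
  well-pointedness enters: \<open>straightening\<close> follows a family of paths by the reverse of its
  restriction to the base point and then uses homotopy extension to contract what is left over the
  base point. Applied to a null homotopy of an adjoint it gives injectivity
  (\<open>adjoint_class_injective\<close>). Applied to \<open>G\<close> in the suspension direction it divides \<open>G\<close> by its
  restriction to the base point. The quotient descends to the smash product, and every Gottlieb
  element becomes the product of an adjoint and a class of constant maps
  (\<open>gottlieb_null_component_decompose\<close>).

  The smash product enters only as the quotient of \<open>A \<times> X\<close> by the wedge. The statement about the
  groups indexed by \<open>n\<close> is therefore the case where \<open>A\<close> is a sphere, once the iterated suspension
  of \<open>X\<close> is presented as that quotient (\<open>collapses_iterated_suspension\<close>).
\<close>

section \<open>Continuity of explicitly given maps\<close>

named_theorems cont

lemma cont_id [cont]: "continuous_map X X (\<lambda>x. x)"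
  by simp

lemma cont_fst [cont]:
  "continuous_map W (prod_topology X Y) f \<Longrightarrow> continuous_map W X (\<lambda>w. fst (f w))"
  using continuous_map_fst_of by (fastforce simp: o_def)

lemma cont_snd [cont]:
  "continuous_map W (prod_topology X Y) f \<Longrightarrow> continuous_map W Y (\<lambda>w. snd (f w))"
  using continuous_map_snd_of by (fastforce simp: o_def)

lemmas cont_pair [cont] = continuous_map_pairedI

lemma cont_compose:
  "\<lbrakk>continuous_map W X g; continuous_map X Z h\<rbrakk> \<Longrightarrow> continuous_map W Z (\<lambda>w. h (g w))"
  using continuous_map_compose[of W X g Z h] by (simp add: o_def)

lemma cont_const [cont]:
  "c \<in> topspace Z \<Longrightarrow> continuous_map W Z (\<lambda>_. c)"
  by simp

lemma cont_unit_interval: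
  assumes "continuous_on {0..1} h" and "h \<in> {0..1} \<rightarrow> {0..1}" and "continuous_map W unit_interval p"
  shows "continuous_map W unit_interval (\<lambda>w. h (p w))"
  by (rule cont_compose[OF assms(3)]) (use assms in \<open>auto simp: continuous_map_in_subtopology\<close>)

text \<open>Clamping keeps the two halves of a concatenation inside the interval, so that each half is
  continuous everywhere and not only where it is used.\<close>

lemma cont_first_half [cont]:
  "continuous_map W unit_interval p \<Longrightarrow> continuous_map W unit_interval (\<lambda>w. min 1 (2 * p w))"
  by (rule cont_unit_interval[where h = "\<lambda>t. min 1 (2 * t)"]) (auto intro!: continuous_intros)

lemma cont_second_half [cont]:
  "continuous_map W unit_interval p \<Longrightarrow> continuous_map W unit_interval (\<lambda>w. max 0 (2 * p w - 1))"
  by (rule cont_unit_interval[where h = "\<lambda>t. max 0 (2 * t - 1)"]) (auto intro!: continuous_intros)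

lemma cont_reverse [cont]:
  "continuous_map W unit_interval p \<Longrightarrow> continuous_map W unit_interval (\<lambda>w. 1 - p w)"
  by (rule cont_unit_interval[where h = "\<lambda>t. 1 - t"]) (auto intro!: continuous_intros)

text \<open>The position at time \<open>t\<close> on the unit interval when it is run through once and then
  backwards. It parametrises a path followed by its reverse.\<close>

definition tent :: "real \<Rightarrow> real" where
  "tent t = min (2 * t) (2 - 2 * t)"

lemma cont_tent [cont]:
  "continuous_map W unit_interval p \<Longrightarrow> continuous_map W unit_interval (\<lambda>w. tent (p w))"
  by (rule cont_unit_interval[where h = tent])
     (auto simp: tent_def intro!: continuous_intros)

lemma cont_mult [cont]:
  assumes "continuous_map W unit_interval p" "continuous_map W unit_interval q"
  shows "continuous_map W unit_interval (\<lambda>w. p w * q w)"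
proof -
  have "continuous_map W euclideanreal (\<lambda>w. p w * q w)"
    using assms by (intro continuous_map_real_mult) (auto dest: continuous_map_into_fulltopology)
  moreover have "p w \<in> {0..1}" "q w \<in> {0..1}" if "w \<in> topspace W" for w
    using assms that by (auto simp: continuous_map_in_subtopology)
  ultimately show ?thesis
    by (force simp: continuous_map_in_subtopology intro: mult_le_one)
qed

lemma cont_if [cont]:
  assumes p: "continuous_map W unit_interval p" and f: "continuous_map W Z f" and g: "continuous_map W Z g"
    and eq: "\<And>w. w \<in> topspace W \<Longrightarrow> p w = 1/2 \<Longrightarrow> f w = g w"
  shows "continuous_map W Z (\<lambda>w. if p w \<le> 1/2 then f w else g w)"
proof (rule continuous_map_cases_le)
  show "continuous_map W euclideanreal p"
    using p continuous_map_into_fulltopology by blast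
qed (use f g eq in \<open>auto intro: continuous_map_from_subtopology\<close>)

section \<open>Mapping spaces\<close>

lemma continuous_map_curry:
  assumes h: "continuous_map (prod_topology P X) Y h"
  shows "continuous_map P (mapping_space X Y) (\<lambda>p. \<lambda>x\<in>topspace X. h (p, x))"
proof -
  let ?c = "\<lambda>p. \<lambda>x\<in>topspace X. h (p, x)"
  have mem: "?c p \<in> continuous_maps X Y" if "p \<in> topspace P" for p
  proof -
    have "continuous_map X Y (\<lambda>x. h (p, x))"
      by (rule cont_compose[OF _ h]) (intro cont that)
    then show ?thesis
      unfolding continuous_maps_def by (auto intro: continuous_map_eq)
  qed
  show ?thesis
    unfolding mapping_space_def
  proof (rule continuous_on_generated_topo)
    fix O'
    assume "O' \<in> {{f \<in> continuous_maps X Y. f ` K \<subseteq> U} | K U. compactin X K \<and> openin Y U}"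
    then obtain K U where K: "compactin X K" and U: "openin Y U"
      and O: "O' = {f \<in> continuous_maps X Y. f ` K \<subseteq> U}" by blast
    have KX: "K \<subseteq> topspace X" using K by (simp add: compactin_subset_topspace)
    define V where "V = {z \<in> topspace (prod_topology P X). h z \<in> U}"
    have V: "openin (prod_topology P X) V"
      unfolding V_def using h U by (rule openin_continuous_map_preimage)
    show "openin P (?c -` O' \<inter> topspace P)"
    proof (subst openin_subopen, intro ballI)
      fix p assume p: "p \<in> ?c -` O' \<inter> topspace P"
      then have "{p} \<times> K \<subseteq> V"
        using KX by (auto simp: O V_def image_subset_iff subset_iff split: if_splits)
      then obtain N N' where N: "openin P N" "p \<in> N" "K \<subseteq> N'" "N \<times> N' \<subseteq> V"
        using tube_lemma_right[OF V K, of p] p by auto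
      have "N \<subseteq> ?c -` O' \<inter> topspace P"
      proof
        fix p' assume p': "p' \<in> N"
        then have "p' \<in> topspace P" using N(1) openin_subset by blast
        moreover have "h (p', x) \<in> U" if "x \<in> K" for x
          using N p' that by (auto simp: V_def)
        ultimately show "p' \<in> ?c -` O' \<inter> topspace P"
          using mem KX by (auto simp: O image_subset_iff)
      qed
      then show "\<exists>T. openin P T \<and> p \<in> T \<and> T \<subseteq> ?c -` O' \<inter> topspace P"
        using N by blast
    qed
  next
    have "\<Union> {{f \<in> continuous_maps X Y. f ` K \<subseteq> U} | K U. compactin X K \<and> openin Y U} =
        topspace (mapping_space X Y)"
      by (simp only: mapping_space_def topology_generated_by_topspace)
    then show "?c ` topspace P \<subseteq>
        \<Union> {{f \<in> continuous_maps X Y. f ` K \<subseteq> U} | K U. compactin X K \<and> openin Y U}"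
      using mem by auto
  qed
qed

text \<open>Evaluation on a mapping space is only used along a map from a locally compact space:
  the source \<open>X\<close> of the mapping space itself may fail to be locally compact, as happens for the
  self-maps of a mapping space.\<close>

lemma continuous_map_eval_along:
  assumes \<phi>: "continuous_map P (mapping_space X Y) \<phi>" and g: "continuous_map V X g"
    and lc: "locally_compact_space V" and haus: "Hausdorff_space V"
  shows "continuous_map (prod_topology P V) Y (\<lambda>z. \<phi> (fst z) (g (snd z)))"
proof -
  have nb: "neighbourhood_base_of (\<lambda>C. compactin V C \<and> closedin V C) V"
    using locally_compact_space_neighbourhood_base_closedin lc haus by blast
  have \<phi>c: "continuous_map X Y (\<phi> p)" if "p \<in> topspace P" for p
  proof -
    have "\<phi> p \<in> topspace (mapping_space X Y)"
      using \<phi> that by (auto simp: continuous_map_def)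
    then show ?thesis by (simp add: continuous_maps_def)
  qed
  have sub: "openin (mapping_space X Y) {f \<in> continuous_maps X Y. f ` K \<subseteq> U}"
    if "compactin X K" "openin Y U" for K U
    unfolding mapping_space_def by (rule topology_generated_by_Basis) (use that in blast)
  show ?thesis
    unfolding continuous_map_alt
  proof (intro conjI allI impI)
    fix U assume U: "openin Y U"
    let ?e = "\<lambda>z. \<phi> (fst z) (g (snd z))"
    show "openin (prod_topology P V) (?e -` U \<inter> topspace (prod_topology P V))"
    proof (subst openin_subopen, intro ballI)
      fix z assume z: "z \<in> ?e -` U \<inter> topspace (prod_topology P V)"
      then obtain p v where pv: "z = (p, v)" "p \<in> topspace P" "v \<in> topspace V" by auto
      have "continuous_map V Y (\<lambda>v. \<phi> p (g v))"
        by (rule cont_compose[OF g \<phi>c[OF pv(2)]])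
      then have "openin V {v \<in> topspace V. \<phi> p (g v) \<in> U}"
        using U by (rule openin_continuous_map_preimage)
      moreover have "v \<in> {v \<in> topspace V. \<phi> p (g v) \<in> U}" using z pv by auto
      ultimately obtain N C where N: "openin V N" "compactin V C" "v \<in> N" "N \<subseteq> C"
        "C \<subseteq> {v \<in> topspace V. \<phi> p (g v) \<in> U}"
        using nb[unfolded neighbourhood_base_of, rule_format, of "{v \<in> topspace V. \<phi> p (g v) \<in> U}" v]
        by blast
      define T where "T = {p \<in> topspace P. \<phi> p \<in> {f \<in> continuous_maps X Y. f ` (g ` C) \<subseteq> U}}"
      have "openin P T"
        unfolding T_def
        by (rule openin_continuous_map_preimage[OF \<phi>], rule sub)
           (use image_compactin[OF N(2) g] U in auto)
      moreover have "p \<in> T"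
        using \<phi> pv N(5) by (auto simp: T_def continuous_map_def)
      ultimately have "openin (prod_topology P V) (T \<times> N)" "z \<in> T \<times> N"
        using N pv by (auto simp: openin_prod_Times_iff)
      moreover have "T \<times> N \<subseteq> ?e -` U \<inter> topspace (prod_topology P V)"
        using N(1,4) openin_subset by (fastforce simp: T_def)
      ultimately show "\<exists>T. openin (prod_topology P V) T \<and> z \<in> T \<and>
          T \<subseteq> ?e -` U \<inter> topspace (prod_topology P V)" by blast
    qed
  next
    show "(\<lambda>z. \<phi> (fst z) (g (snd z))) \<in> topspace (prod_topology P V) \<rightarrow> topspace Y"
      using \<phi>c g by (force simp: continuous_map_def)
  qed
qed

lemma continuous_map_uncurry:
  assumes "continuous_map P (mapping_space X Y) \<phi>" "locally_compact_space X" "Hausdorff_space X"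
  shows "continuous_map (prod_topology P X) Y (\<lambda>z. \<phi> (fst z) (snd z))"
  using continuous_map_eval_along[OF assms(1) continuous_map_id assms(2,3)] by (simp add: id_def)

lemma path_component_ofI:
  assumes f: "continuous_map W Z f" and \<gamma>: "continuous_map unit_interval W \<gamma>" 
    and t: "t \<in> {0..1}" and "f (\<gamma> 0) = z"
  shows "f (\<gamma> t) \<in> path_component_of_set Z z"
proof -
  have "continuous_map unit_interval Z (\<lambda>s. f (\<gamma> (t * s)))"
    by (rule cont_compose[OF _ f], rule cont_compose[OF _ \<gamma>]) (use t in \<open>intro cont; simp\<close>)
  then show ?thesis
    unfolding path_component_of_def pathin_def mem_Collect_eq
    by (intro exI[of _ "\<lambda>s. f (\<gamma> (t * s))"]) (use assms in auto)
qed

lemma continuous_map_path_component_at: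
  "continuous_map W (fst (path_component_at Z z)) f \<longleftrightarrow>
     continuous_map W Z f \<and> (\<forall>w\<in>topspace W. f w \<in> path_component_of_set Z z)"
  by (auto simp: path_component_at_def continuous_map_in_subtopology)

lemma based_space_path_component_at:
  "z \<in> topspace Z \<Longrightarrow> based_space (path_component_at Z z)"
  by (auto simp: based_space_def path_component_at_def path_component_of_refl)

section \<open>Collapsing a subspace to the base point\<close>

lemma locally_compact_unit_interval: "locally_compact_space unit_interval"
  by (intro compact_imp_locally_compact_space) (simp add: compact_space_subtopology)

lemma Hausdorff_unit_interval: "Hausdorff_space unit_interval"
  by (simp add: Hausdorff_space_subtopology)

text \<open>A presentation of the based space \<open>B\<close> as \<open>P/S\<close>. Maps and homotopies out of suspensions are
  always studied on the cylinder over such a \<open>P\<close>: for smash products and suspensions of locally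
  compact spaces a presentation by a locally compact \<open>P\<close> exists, while \<open>B\<close> itself need not be
  locally compact.\<close>

definition collapses :: "'p topology \<Rightarrow> 'p set \<Rightarrow> 'b based \<Rightarrow> ('p \<Rightarrow> 'b) \<Rightarrow> bool" where
  "collapses P S B q \<longleftrightarrow> quotient_map P (fst B) q \<and> S \<subseteq> topspace P \<and> S \<noteq> {} \<and>
     (\<forall>x\<in>topspace P. q x = snd B \<longleftrightarrow> x \<in> S) \<and> inj_on q (topspace P - S)"

definition rel_maps :: "'p topology \<Rightarrow> 'p set \<Rightarrow> 'z based \<Rightarrow> ('p \<Rightarrow> 'z) set" where
  "rel_maps P S Z = {f. continuous_map P (fst Z) f \<and> (\<forall>x\<in>S. f x = snd Z)}"

abbreviation rel_homotopic :: "'p topology \<Rightarrow> 'p set \<Rightarrow> 'z based \<Rightarrow> ('p \<Rightarrow> 'z) \<Rightarrow> ('p \<Rightarrow> 'z) \<Rightarrow> bool" where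
  "rel_homotopic P S Z \<equiv> homotopic_with (\<lambda>h. \<forall>x\<in>S. h x = snd Z) P (fst Z)"

lemma rel_homotopicI:
  assumes "continuous_map (prod_topology unit_interval P) (fst Z) H"
    and "\<And>x. x \<in> topspace P \<Longrightarrow> H (0, x) = f x" "\<And>x. x \<in> topspace P \<Longrightarrow> H (1, x) = g x"
    and "\<And>t x. t \<in> {0..1} \<Longrightarrow> x \<in> S \<Longrightarrow> H (t, x) = snd Z" and "S \<subseteq> topspace P"
  shows "rel_homotopic P S Z f g"
  unfolding homotopic_with_def
proof (intro exI conjI allI ballI)
  let ?H = "\<lambda>z. if snd z \<in> topspace P then H z else if fst z = 0 then f (snd z) else g (snd z)"
  show "continuous_map (prod_topology unit_interval P) (fst Z) ?H"
    by (rule continuous_map_eq[OF assms(1)]) auto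
qed (use assms(2-5) in auto)

lemma rel_homotopicE:
  assumes "rel_homotopic P S Z f g"
  obtains H where "continuous_map (prod_topology unit_interval P) (fst Z) H"
    "\<And>x. H (0, x) = f x" "\<And>x. H (1, x) = g x" "\<And>t x. t \<in> {0..1} \<Longrightarrow> x \<in> S \<Longrightarrow> H (t, x) = snd Z"
  using assms unfolding homotopic_with_def by meson

lemma rel_homotopic_cong:
  assumes "rel_homotopic P S Z f g" "S \<subseteq> topspace P"
    and "\<And>x. x \<in> topspace P \<Longrightarrow> f x = f' x" "\<And>x. x \<in> topspace P \<Longrightarrow> g x = g' x"
  shows "rel_homotopic P S Z f' g'"
proof -
  obtain H where H: "continuous_map (prod_topology unit_interval P) (fst Z) H"
    "\<And>x. H (0, x) = f x" "\<And>x. H (1, x) = g x" "\<And>t x. t \<in> {0..1} \<Longrightarrow> x \<in> S \<Longrightarrow> H (t, x) = snd Z"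
    using assms(1) by (rule rel_homotopicE) (rule that)
  show ?thesis
    by (rule rel_homotopicI[OF H(1)]) (simp_all add: assms H)
qed

lemma rel_homotopic_refl: "f \<in> rel_maps P S Z \<Longrightarrow> rel_homotopic P S Z f f"
  by (simp add: rel_maps_def)

lemma rel_mapsI:
  "\<lbrakk>continuous_map P (fst Z) f; \<And>x. x \<in> S \<Longrightarrow> f x = snd Z\<rbrakk> \<Longrightarrow> f \<in> rel_maps P S Z"
  by (simp add: rel_maps_def)

lemma rel_mapsD:
  assumes "f \<in> rel_maps P S Z"
  shows "continuous_map P (fst Z) f" and "x \<in> S \<Longrightarrow> f x = snd Z"
  using assms by (simp_all add: rel_maps_def)

lemma rel_maps_cong:
  "\<lbrakk>f \<in> rel_maps P S Z; S \<subseteq> topspace P; \<And>x. x \<in> topspace P \<Longrightarrow> f x = g x\<rbrakk> \<Longrightarrow> g \<in> rel_maps P S Z"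
  by (auto simp: rel_maps_def subset_iff intro: continuous_map_eq)

lemma collapsesD:
  assumes "collapses P S B q"
  shows "quotient_map P (fst B) q" "continuous_map P (fst B) q" "S \<subseteq> topspace P" "S \<noteq> {}"
    and "q ` topspace P = topspace (fst B)" "based_space B"
    and "x \<in> topspace P \<Longrightarrow> q x = snd B \<longleftrightarrow> x \<in> S"
    and "\<lbrakk>x \<in> topspace P; y \<in> topspace P; q x = q y\<rbrakk> \<Longrightarrow> x = y \<or> x \<in> S \<and> y \<in> S"
    and "x \<in> S \<Longrightarrow> q x = snd B"
proof -
  show q: "quotient_map P (fst B) q" "S \<subseteq> topspace P" "S \<noteq> {}"
    using assms by (auto simp: collapses_def)
  then show "continuous_map P (fst B) q" and im: "q ` topspace P = topspace (fst B)"
    by (auto simp: quotient_imp_continuous_map quotient_imp_surjective_map)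
  obtain s where "s \<in> S" using q by blast
  then have "q s = snd B" "s \<in> topspace P" using assms q by (auto simp: collapses_def)
  then show "based_space B" unfolding based_space_def using im by (metis imageI)
  show "q x = snd B \<longleftrightarrow> x \<in> S" if "x \<in> topspace P"
    using assms that by (auto simp: collapses_def)
  show "x = y \<or> x \<in> S \<and> y \<in> S" if "x \<in> topspace P" "y \<in> topspace P" "q x = q y"
    using assms that unfolding collapses_def inj_on_def by (metis DiffI)
  show "q x = snd B" if "x \<in> S" using assms that by (auto simp: collapses_def)
qed

lemma collapses_based_map:
  assumes "collapses P S B q" "f \<in> based_maps B Z"
  shows "(\<lambda>x. f (q x)) \<in> rel_maps P S Z"
proof (rule rel_mapsI)
  show "continuous_map P (fst Z) (\<lambda>x. f (q x))"
    by (rule cont_compose[OF collapsesD(2)[OF assms(1)]]) (use assms(2) in \<open>simp add: based_maps_def\<close>)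
  show "f (q x) = snd Z" if "x \<in> S" for x
    using collapsesD(9)[OF assms(1)] assms(2) that by (simp add: based_maps_def)
qed

lemma collapses_lift:
  assumes c: "collapses P S B q" and f: "f \<in> rel_maps P S Z"
  obtains g where "g \<in> based_maps B Z" "\<And>x. x \<in> topspace P \<Longrightarrow> g (q x) = f x"
proof -
  note D = collapsesD[OF c]
  obtain g where g: "continuous_map (fst B) (fst Z) g" "\<And>x. x \<in> topspace P \<Longrightarrow> g (q x) = f x"
  proof (rule quotient_map_lift_exists[OF D(1) rel_mapsD(1)[OF f]])
    show "f x = f y" if "x \<in> topspace P" "y \<in> topspace P" "q x = q y" for x y
      using D(8)[OF that] rel_mapsD(2)[OF f] by auto
  qed blast
  obtain s where "s \<in> S" using D(4) by blast
  then have "q s = snd B" "s \<in> topspace P" "f s = snd Z" using D(3,7) rel_mapsD(2)[OF f] by auto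
  then have "g (snd B) = snd Z" using g(2) by metis
  then show ?thesis using that g by (auto simp: based_maps_def)
qed

text \<open>Homotopies descend because a quotient map remains one after taking the product with the
  unit interval.\<close>

lemma collapses_homotopic:
  assumes c: "collapses P S B q"
  shows "homotopic_with (\<lambda>h. h (snd B) = snd Z) (fst B) (fst Z) f g \<longleftrightarrow>
    rel_homotopic P S Z (\<lambda>x. f (q x)) (\<lambda>x. g (q x))"
proof
  note D = collapsesD[OF c]
  assume "homotopic_with (\<lambda>h. h (snd B) = snd Z) (fst B) (fst Z) f g"
  then have "rel_homotopic P S Z (f \<circ> q) (g \<circ> q)"
    by (rule homotopic_with_compose_continuous_map_right[OF _ D(2)]) (use D(9) in simp)
  then show "rel_homotopic P S Z (\<lambda>x. f (q x)) (\<lambda>x. g (q x))"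
    by (simp add: o_def)
next
  note D = collapsesD[OF c]
  assume "rel_homotopic P S Z (\<lambda>x. f (q x)) (\<lambda>x. g (q x))"
  then obtain H where H: "continuous_map (prod_topology unit_interval P) (fst Z) H"
    "\<And>x. H (0, x) = f (q x)" "\<And>x. H (1, x) = g (q x)"
    "\<And>t x. t \<in> {0..1} \<Longrightarrow> x \<in> S \<Longrightarrow> H (t, x) = snd Z"
    by (rule rel_homotopicE) (rule that)
  have qq: "quotient_map (prod_topology unit_interval P) (prod_topology unit_interval (fst B)) (\<lambda>(t, x). (t, q x))"
    by (rule quotient_map_prod_right[OF _ _ D(1)])
       (simp_all add: Hausdorff_unit_interval locally_compact_unit_interval)
  obtain G where G: "continuous_map (prod_topology unit_interval (fst B)) (fst Z) G"
    and G': "\<And>z. z \<in> topspace (prod_topology unit_interval P) \<Longrightarrow> G (case z of (t, x) \<Rightarrow> (t, q x)) = H z"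
  proof (rule quotient_map_lift_exists[OF qq H(1)])
    fix z w assume "z \<in> topspace (prod_topology unit_interval P)" "w \<in> topspace (prod_topology unit_interval P)"
      "(case z of (t, x) \<Rightarrow> (t, q x)) = (case w of (t, x) \<Rightarrow> (t, q x))"
    then have "fst z \<in> {0..1}" "fst z = fst w" "snd z = snd w \<or> snd z \<in> S \<and> snd w \<in> S"
      using D(8)[of "snd z" "snd w"] by (auto simp: case_prod_unfold)
    then show "H z = H w" using H(4)[of "fst z"] by (metis prod.collapse)
  qed blast
  have G'': "G (t, q x) = H (t, x)" if "t \<in> {0..1}" "x \<in> topspace P" for t x
    using G'[of "(t, x)"] that by simp
  obtain s where "s \<in> S" using D(4) by blast
  then have s: "q s = snd B" "s \<in> topspace P" "s \<in> S" using D(3,7) by auto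
  have b: "snd B \<in> topspace (fst B)" using D(6) by (simp add: based_space_def)
  have "G (0, x) = f x \<and> G (1, x) = g x" if x: "x \<in> topspace (fst B)" for x
  proof -
    obtain y where "y \<in> topspace P" "x = q y" using x unfolding D(5)[symmetric] by (rule imageE)
    then show ?thesis using G'' H(2,3) by simp
  qed
  moreover have "G (t, snd B) = snd Z" if "t \<in> {0..1}" for t
    using G''[of t s] H(4)[of t s] s that by simp
  ultimately have "\<exists>h. continuous_map (prod_topology unit_interval (fst B)) (fst Z) h \<and>
      (\<forall>x\<in>topspace (fst B). h (0, x) = f x) \<and> (\<forall>x\<in>topspace (fst B). h (1, x) = g x) \<and>
      (\<forall>t\<in>{0..1}. h (t, snd B) = snd Z)"
    using G by blast
  then show "homotopic_with (\<lambda>h. h (snd B) = snd Z) (fst B) (fst Z) f g"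
    using b by (subst homotopic_with) auto
qed

lemma homotopy_class_eq_iff:
  assumes "f \<in> based_maps B Z" "g \<in> based_maps B Z"
  shows "homotopy_class B Z f = homotopy_class B Z g \<longleftrightarrow>
    homotopic_with (\<lambda>h. h (snd B) = snd Z) (fst B) (fst Z) f g"
proof
  assume "homotopy_class B Z f = homotopy_class B Z g"
  moreover have "g \<in> homotopy_class B Z g"
    using assms(2) by (simp add: homotopy_class_def based_maps_def)
  ultimately have "g \<in> homotopy_class B Z f" by (simp only:)
  then show "homotopic_with (\<lambda>h. h (snd B) = snd Z) (fst B) (fst Z) f g"
    by (simp only: homotopy_class_def mem_Collect_eq)
next
  assume "homotopic_with (\<lambda>h. h (snd B) = snd Z) (fst B) (fst Z) f g"
  then show "homotopy_class B Z f = homotopy_class B Z g"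
    unfolding homotopy_class_def
    by (intro Collect_cong iffI) (meson homotopic_with_trans homotopic_with_symD)+
qed

lemma collapses_collapse:
  assumes "S \<subseteq> topspace P" "p \<in> S"
  shows "collapses P S (collapse P S p) (collapse_map S p)"
  using assms quotient_map_quotient_topology[of P "collapse_map S p"]
  by (auto simp: collapses_def collapse_def collapse_map_def inj_on_def)

lemma collapses_id: "based_space B \<Longrightarrow> collapses (fst B) {snd B} B (\<lambda>x. x)"
  using homeomorphic_map_id[of "fst B" "fst B"] unfolding homeomorphic_map_def
  by (auto simp: collapses_def based_space_def id_def)

text \<open>The part of the cylinder over \<open>P\<close> that becomes the base point in the reduced suspension of
  \<open>P/S\<close>.\<close>

definition cyl_ends :: "'p topology \<Rightarrow> 'p set \<Rightarrow> ('p \<times> real) set" where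
  "cyl_ends P S = topspace P \<times> {0, 1} \<union> S \<times> {0..1}"

lemma cyl_ends_subset: "S \<subseteq> topspace P \<Longrightarrow> cyl_ends P S \<subseteq> topspace (prod_topology P unit_interval)"
  by (auto simp: cyl_ends_def)

lemma susp_collapsed_eq: "susp_collapsed A = cyl_ends (fst A) {snd A}"
  by (simp add: susp_collapsed_def cyl_ends_def)

lemma collapses_susp_proj:
  assumes "based_space A"
  shows "collapses (prod_topology (fst A) unit_interval) (cyl_ends (fst A) {snd A}) (suspension A) (susp_proj A)"
  unfolding suspension_def susp_proj_def susp_collapsed_eq
  by (rule collapses_collapse) (use assms in \<open>auto simp: cyl_ends_def based_space_def\<close>)

text \<open>Since the product of a quotient map with the unit interval is a quotient map, a presentation
  of \<open>B\<close> induces one of its suspension, by the cylinder.\<close>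

lemma collapses_suspension:
  assumes c: "collapses P S B q"
  shows "collapses (prod_topology P unit_interval) (cyl_ends P S) (suspension B)
    (\<lambda>z. susp_proj B (q (fst z), snd z))"
proof -
  note D = collapsesD[OF c]
  note E = collapsesD[OF collapses_susp_proj[OF D(6)]]
  have q: "q x \<in> topspace (fst B)" if "x \<in> topspace P" for x
    using that unfolding D(5)[symmetric] by (rule imageI)
  have mem: "(q (fst z), snd z) \<in> cyl_ends (fst B) {snd B} \<longleftrightarrow> z \<in> cyl_ends P S"
    if "z \<in> topspace (prod_topology P unit_interval)" for z
    using that q D(7) D(3) by (cases z) (auto simp: cyl_ends_def)
  have "quotient_map (prod_topology P unit_interval) (prod_topology (fst B) unit_interval) (\<lambda>(x, t). (q x, t))"
    by (rule quotient_map_prod_left[OF _ _ D(1)])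
       (simp_all add: Hausdorff_unit_interval locally_compact_unit_interval)
  from quotient_map_compose[OF this E(1)]
  have Q: "quotient_map (prod_topology P unit_interval) (fst (suspension B))
      (\<lambda>z. susp_proj B (q (fst z), snd z))"
    by (simp add: o_def case_prod_unfold)
  show ?thesis
    unfolding collapses_def
  proof (intro conjI ballI Q inj_onI)
    show "cyl_ends P S \<subseteq> topspace (prod_topology P unit_interval)"
      by (rule cyl_ends_subset[OF D(3)])
    show "cyl_ends P S \<noteq> {}" using D(3,4) by (auto simp: cyl_ends_def)
    fix z assume z: "z \<in> topspace (prod_topology P unit_interval)"
    then have "(q (fst z), snd z) \<in> topspace (prod_topology (fst B) unit_interval)" using q by auto
    then show "susp_proj B (q (fst z), snd z) = snd (suspension B) \<longleftrightarrow> z \<in> cyl_ends P S"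
      using E(7) mem[OF z] by simp
  next
    fix z w assume z: "z \<in> topspace (prod_topology P unit_interval) - cyl_ends P S"
      and w: "w \<in> topspace (prod_topology P unit_interval) - cyl_ends P S"
      and eq: "susp_proj B (q (fst z), snd z) = susp_proj B (q (fst w), snd w)"
    have "(q (fst z), snd z) \<in> topspace (prod_topology (fst B) unit_interval)"
      "(q (fst w), snd w) \<in> topspace (prod_topology (fst B) unit_interval)"
      using z w q by auto
    then have "(q (fst z), snd z) = (q (fst w), snd w)"
      using E(8)[OF _ _ eq] mem[of z] z by simp
    then have "q (fst z) = q (fst w)" and snd_eq: "snd z = snd w" by simp_all
    moreover have "fst z \<in> topspace P" "fst w \<in> topspace P" using z w by auto
    moreover have "fst z \<notin> S" using z by (auto simp: cyl_ends_def mem_Times_iff)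
    ultimately have "fst z = fst w" using D(8)[of "fst z" "fst w"] by metis
    then show "z = w" using snd_eq by (rule prod_eqI)
  qed
qed

section \<open>The group of homotopy classes of maps out of a suspension\<close>

abbreviation cyl :: "'p topology \<Rightarrow> ('p \<times> real) topology" where
  "cyl P \<equiv> prod_topology P unit_interval"

text \<open>All the homotopies needed for the group axioms, and the one for commutativity, arise in the
  same way: a map \<open>K\<close> on \<open>P \<times> W\<close> with \<open>W\<close> convex turns two paths in \<open>W\<close> with common end points
  into two maps on the cylinder, and the straight-line homotopy between the paths into a homotopy.
  The group axioms use an interval for \<open>W\<close>, commutativity uses a square.\<close>

lemma rel_homotopic_paths:
  fixes \<gamma> \<delta> :: "real \<Rightarrow> 'w::real_normed_vector"
  assumes K: "continuous_map (prod_topology P (top_of_set W)) (fst Z) K" and W: "convex W"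
    and \<gamma>: "continuous_on {0..1} \<gamma>" "\<gamma> \<in> {0..1} \<rightarrow> W" and \<delta>: "continuous_on {0..1} \<delta>" "\<delta> \<in> {0..1} \<rightarrow> W"
    and ends: "\<gamma> 0 = \<delta> 0" "\<gamma> 1 = \<delta> 1"
    and K0: "\<And>p. p \<in> topspace P \<Longrightarrow> K (p, \<gamma> 0) = snd Z" and K1: "\<And>p. p \<in> topspace P \<Longrightarrow> K (p, \<gamma> 1) = snd Z"
    and KS: "\<And>p w. p \<in> S \<Longrightarrow> w \<in> W \<Longrightarrow> K (p, w) = snd Z" and S: "S \<subseteq> topspace P"
  shows "rel_homotopic (cyl P) (cyl_ends P S) Z (\<lambda>z. K (fst z, \<gamma> (snd z))) (\<lambda>z. K (fst z, \<delta> (snd z)))"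
proof (rule rel_homotopicI)
  define L where "L = (\<lambda>(s, u). (1 - s) *\<^sub>R \<gamma> u + s *\<^sub>R \<delta> u)"
  have LW: "L (s, u) \<in> W" if "s \<in> {0..1}" "u \<in> {0..1}" for s u
    using that \<gamma>(2) \<delta>(2) W by (auto simp: L_def intro!: convexD)
  have "continuous_on ({0..1} \<times> {0..1}) L"
    unfolding L_def case_prod_unfold
    by (intro continuous_intros continuous_on_compose2[OF \<gamma>(1)] continuous_on_compose2[OF \<delta>(1)]) auto
  then have L: "continuous_map (prod_topology unit_interval unit_interval) (top_of_set W) L"
    using LW by (auto simp: continuous_map_in_subtopology subtopology_Times[symmetric] Pi_iff
        simp flip: euclidean_product_topology)
  let ?H = "\<lambda>z. K (fst (snd z), L (fst z, snd (snd z)))"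
  show "continuous_map (prod_topology unit_interval (cyl P)) (fst Z) ?H"
    by (rule cont_compose[OF _ K], (rule cont)+, rule cont_compose[OF _ L], (rule cont)+)
  show "?H (0, z) = K (fst z, \<gamma> (snd z))" "?H (1, z) = K (fst z, \<delta> (snd z))" for z
    by (simp_all add: L_def)
  show "?H (t, z) = snd Z" if t: "t \<in> {0..1}" and z: "z \<in> cyl_ends P S" for t z
  proof (cases "fst z \<in> S")
    case True
    then show ?thesis using z t S KS LW by (auto simp: cyl_ends_def)
  next
    case False
    then have "fst z \<in> topspace P" "snd z = 0 \<or> snd z = 1" using z by (auto simp: cyl_ends_def)
    moreover have "L (t, 0) = \<gamma> 0" "L (t, 1) = \<gamma> 1"
      using ends by (simp_all add: L_def algebra_simps flip: scaleR_add_left)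
    ultimately show ?thesis using K0 K1 by auto
  qed
  show "cyl_ends P S \<subseteq> topspace (cyl P)" by (rule cyl_ends_subset[OF S])
qed

lemma rel_homotopic_reparametrize:
  assumes f: "f \<in> rel_maps (cyl P) (cyl_ends P S) Z" and S: "S \<subseteq> topspace P"
    and \<rho>: "continuous_on {0..1} \<rho>" "\<rho> \<in> {0..1} \<rightarrow> {0..1}" and \<sigma>: "continuous_on {0..1} \<sigma>" "\<sigma> \<in> {0..1} \<rightarrow> {0..1}"
    and ends: "\<rho> 0 = \<sigma> 0" "\<rho> 1 = \<sigma> 1" "\<rho> 0 \<in> {0, 1}" "\<rho> 1 \<in> {0, 1}"
  shows "rel_homotopic (cyl P) (cyl_ends P S) Z (\<lambda>z. f (fst z, \<rho> (snd z))) (\<lambda>z. f (fst z, \<sigma> (snd z)))"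
  by (rule rel_homotopic_paths[OF rel_mapsD(1)[OF f] _ \<rho> \<sigma> ends(1,2) _ _ _ S])
     (use ends S in \<open>auto intro!: rel_mapsD(2)[OF f] simp: cyl_ends_def\<close>)

definition concat_maps :: "('p \<times> real \<Rightarrow> 'z) \<Rightarrow> ('p \<times> real \<Rightarrow> 'z) \<Rightarrow> 'p \<times> real \<Rightarrow> 'z" where
  "concat_maps f g = (\<lambda>z. if snd z \<le> 1/2 then f (fst z, min 1 (2 * snd z)) else g (fst z, max 0 (2 * snd z - 1)))"

lemma concat_maps_rel:
  assumes f: "f \<in> rel_maps (cyl P) (cyl_ends P S) Z" and g: "g \<in> rel_maps (cyl P) (cyl_ends P S) Z"
  shows "concat_maps f g \<in> rel_maps (cyl P) (cyl_ends P S) Z"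
proof (rule rel_mapsI)
  show "continuous_map (cyl P) (fst Z) (concat_maps f g)"
    unfolding concat_maps_def
  proof (rule cont_if)
    show "continuous_map (cyl P) unit_interval snd" by (rule continuous_map_snd)
    show "continuous_map (cyl P) (fst Z) (\<lambda>z. f (fst z, min 1 (2 * snd z)))"
      by (rule cont_compose[OF _ rel_mapsD(1)[OF f]]) ((rule cont)+)
    show "continuous_map (cyl P) (fst Z) (\<lambda>z. g (fst z, max 0 (2 * snd z - 1)))"
      by (rule cont_compose[OF _ rel_mapsD(1)[OF g]]) ((rule cont)+)
    show "f (fst z, min 1 (2 * snd z)) = g (fst z, max 0 (2 * snd z - 1))"
      if "z \<in> topspace (cyl P)" "snd z = 1/2" for z
      using that rel_mapsD(2)[OF f, of "(fst z, 1)"] rel_mapsD(2)[OF g, of "(fst z, 0)"]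
      by (auto simp: cyl_ends_def)
  qed
  fix z assume z: "z \<in> cyl_ends P S"
  then have "snd z \<le> 1/2 \<Longrightarrow> (fst z, min 1 (2 * snd z)) \<in> cyl_ends P S"
    "\<not> snd z \<le> 1/2 \<Longrightarrow> (fst z, max 0 (2 * snd z - 1)) \<in> cyl_ends P S"
    by (auto simp: cyl_ends_def)
  then show "concat_maps f g z = snd Z"
    using rel_mapsD(2)[OF f] rel_mapsD(2)[OF g] by (simp add: concat_maps_def)
qed

lemma concat_maps_homotopic:
  assumes "rel_homotopic (cyl P) (cyl_ends P S) Z f f'" "rel_homotopic (cyl P) (cyl_ends P S) Z g g'"
    and S: "S \<subseteq> topspace P"
  shows "rel_homotopic (cyl P) (cyl_ends P S) Z (concat_maps f g) (concat_maps f' g')"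
proof -
  let ?E = "cyl_ends P S"
  obtain F where F: "continuous_map (prod_topology unit_interval (cyl P)) (fst Z) F"
    "\<And>x. F (0, x) = f x" "\<And>x. F (1, x) = f' x" "\<And>t x. t \<in> {0..1} \<Longrightarrow> x \<in> ?E \<Longrightarrow> F (t, x) = snd Z"
    using assms(1) by (rule rel_homotopicE) (rule that)
  obtain G where G: "continuous_map (prod_topology unit_interval (cyl P)) (fst Z) G"
    "\<And>x. G (0, x) = g x" "\<And>x. G (1, x) = g' x" "\<And>t x. t \<in> {0..1} \<Longrightarrow> x \<in> ?E \<Longrightarrow> G (t, x) = snd Z"
    using assms(2) by (rule rel_homotopicE) (rule that)
  let ?H = "\<lambda>w. if snd (snd w) \<le> 1/2 then F (fst w, fst (snd w), min 1 (2 * snd (snd w)))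
    else G (fst w, fst (snd w), max 0 (2 * snd (snd w) - 1))"
  show ?thesis
  proof (rule rel_homotopicI)
    show "continuous_map (prod_topology unit_interval (cyl P)) (fst Z) ?H"
    proof (rule cont_if)
      let ?W = "prod_topology unit_interval (cyl P)"
      show "continuous_map ?W unit_interval (\<lambda>x. snd (snd x))"
        by (rule cont)+
      show "continuous_map ?W (fst Z) (\<lambda>w. F (fst w, fst (snd w), min 1 (2 * snd (snd w))))"
        by (rule cont_compose[OF _ F(1)]) ((rule cont)+)
      show "continuous_map ?W (fst Z) (\<lambda>w. G (fst w, fst (snd w), max 0 (2 * snd (snd w) - 1)))"
        by (rule cont_compose[OF _ G(1)]) ((rule cont)+)
      fix w assume "w \<in> topspace ?W" "snd (snd w) = 1 / 2"
      then show "F (fst w, fst (snd w), min 1 (2 * snd (snd w))) = G (fst w, fst (snd w), max 0 (2 * snd (snd w) - 1))"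
        using F(4)[of "fst w" "(fst (snd w), 1)"] G(4)[of "fst w" "(fst (snd w), 0)"]
        by (auto simp: cyl_ends_def)
    qed
    show "?H (0, x) = concat_maps f g x" "?H (1, x) = concat_maps f' g' x" for x
      by (simp_all add: concat_maps_def F(2,3) G(2,3))
    fix t :: real and z assume t: "t \<in> {0..1}" and z: "z \<in> ?E"
    then have "snd z \<le> 1/2 \<Longrightarrow> (fst z, min 1 (2 * snd z)) \<in> ?E"
      "\<not> snd z \<le> 1/2 \<Longrightarrow> (fst z, max 0 (2 * snd z - 1)) \<in> ?E"
      by (auto simp: cyl_ends_def)
    then show "?H (t, z) = snd Z" using F(4)[OF t] G(4)[OF t] by simp
  qed (rule cyl_ends_subset[OF S])
qed

context
  fixes P :: "'p topology" and S :: "'p set" and Z :: "'z based"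
  assumes S: "S \<subseteq> topspace P"
begin

private abbreviation (input) "rels \<equiv> rel_maps (cyl P) (cyl_ends P S) Z"
private abbreviation (input) "hot \<equiv> rel_homotopic (cyl P) (cyl_ends P S) Z"

lemma concat_maps_assoc:
  assumes f: "f \<in> rels" and g: "g \<in> rels" and h: "h \<in> rels"
  shows "hot (concat_maps (concat_maps f g) h) (concat_maps f (concat_maps g h))"
proof -
  define J where "J = concat_maps (concat_maps f g) h"
  \<comment> \<open>The speeds of the left-bracketed product, read in the time of the right-bracketed one, are
    \<open>1/2\<close>, \<open>1\<close> and \<open>2\<close>; they increase, so the reparametrisation is a maximum of affine functions.\<close>
  define \<rho> where "\<rho> = (\<lambda>t::real. max (t / 2) (max (t - 1/4) (2 * t - 1)))"
  have J: "J \<in> rels" unfolding J_def by (intro concat_maps_rel f g h)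
  have \<rho>: "continuous_on {0..1} \<rho>" "\<rho> \<in> {0..1} \<rightarrow> {0..1}"
    unfolding \<rho>_def by (intro continuous_intros) (auto simp: le_max_iff_disj)
  have "hot (\<lambda>z. J (fst z, snd z)) (\<lambda>z. J (fst z, \<rho> (snd z)))"
    by (rule rel_homotopic_reparametrize[OF J S _ _ \<rho>, where \<rho> = "\<lambda>t. t"]) (auto simp: \<rho>_def)
  moreover have "J (fst z, \<rho> (snd z)) = concat_maps f (concat_maps g h) z" if zP: "z \<in> topspace (cyl P)" for z
  proof -
    obtain p t where z: "z = (p, t)" and p: "p \<in> topspace P" and t: "0 \<le> t" "t \<le> 1" using zP by auto
    have ends: "f (p, 1) = g (p, 0)" "g (p, 1) = h (p, 0)"
      using rel_mapsD(2)[OF f] rel_mapsD(2)[OF g] rel_mapsD(2)[OF h] p by (auto simp: cyl_ends_def)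
    consider "t < 1/2" | "t = 1/2" | "1/2 < t" "t < 3/4" | "t = 3/4" | "3/4 < t" by linarith
    then show ?thesis
    proof cases
      case 1
      then have \<rho>: "\<rho> t = t / 2" using t by (auto simp: \<rho>_def max_def)
      show ?thesis using 1 t by (simp add: \<rho> z J_def concat_maps_def)
    next
      case 2
      then show ?thesis using ends by (simp add: z J_def concat_maps_def \<rho>_def)
    next
      case 3
      then have \<rho>: "\<rho> t = t - 1/4" using t by (auto simp: \<rho>_def max_def)
      show ?thesis using 3 t by (simp add: \<rho> z J_def concat_maps_def algebra_simps)
    next
      case 4
      then show ?thesis using ends by (simp add: z J_def concat_maps_def \<rho>_def)
    next
      case 5
      then have \<rho>: "\<rho> t = 2 * t - 1" using t by (auto simp: \<rho>_def max_def)
      show ?thesis using 5 t by (simp add: \<rho> z J_def concat_maps_def algebra_simps)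
    qed
  qed
  ultimately show ?thesis
    by - (rule rel_homotopic_cong[OF _ cyl_ends_subset[OF S]], assumption, simp_all add: J_def)
qed

lemma concat_maps_const_left:
  assumes f: "f \<in> rels"
  shows "hot (concat_maps (\<lambda>_. snd Z) f) f"
proof -
  have "hot (\<lambda>z. f (fst z, max 0 (2 * snd z - 1))) (\<lambda>z. f (fst z, snd z))"
    by (rule rel_homotopic_reparametrize[OF f S, where \<sigma> = "\<lambda>t. t"]) (auto intro!: continuous_intros)
  moreover have "f (fst z, max 0 (2 * snd z - 1)) = concat_maps (\<lambda>_. snd Z) f z" if "z \<in> topspace (cyl P)" for z
    using that rel_mapsD(2)[OF f, of "(fst z, 0)"] by (auto simp: concat_maps_def cyl_ends_def max_absorb1)
  ultimately show ?thesis
    by - (rule rel_homotopic_cong[OF _ cyl_ends_subset[OF S]], assumption, simp_all)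
qed

lemma concat_maps_reverse:
  assumes f: "f \<in> rels"
  shows "(\<lambda>z. f (fst z, 1 - snd z)) \<in> rels"
    and "hot (concat_maps (\<lambda>z. f (fst z, 1 - snd z)) f) (\<lambda>_. snd Z)"
proof -
  show "(\<lambda>z. f (fst z, 1 - snd z)) \<in> rels"
  proof (rule rel_mapsI)
    show "continuous_map (cyl P) (fst Z) (\<lambda>z. f (fst z, 1 - snd z))"
      by (rule cont_compose[OF _ rel_mapsD(1)[OF f]]) ((rule cont)+)
    show "f (fst z, 1 - snd z) = snd Z" if "z \<in> cyl_ends P S" for z
      using that by (intro rel_mapsD(2)[OF f]) (auto simp: cyl_ends_def)
  qed
  \<comment> \<open>Running backwards and then forwards through \<open>f\<close> contracts onto the end value of \<open>f\<close>.\<close>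
  have "hot (\<lambda>z. f (fst z, 1 - tent (snd z))) (\<lambda>z. f (fst z, 1))"
    by (rule rel_homotopic_reparametrize[OF f S, where \<sigma> = "\<lambda>t. 1"])
       (auto simp: tent_def intro!: continuous_intros)
  moreover have "f (fst z, 1 - tent (snd z)) = concat_maps (\<lambda>z. f (fst z, 1 - snd z)) f z"
    if "z \<in> topspace (cyl P)" for z
    using that by (auto simp: concat_maps_def tent_def min_def max_def algebra_simps)
  moreover have "f (fst z, 1) = snd Z" if "z \<in> topspace (cyl P)" for z
    using that by (auto intro!: rel_mapsD(2)[OF f] simp: cyl_ends_def)
  ultimately show "hot (concat_maps (\<lambda>z. f (fst z, 1 - snd z)) f) (\<lambda>_. snd Z)"
    by - (rule rel_homotopic_cong[OF _ cyl_ends_subset[OF S]], assumption, simp_all)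
qed

end

abbreviation loops :: "'a based \<Rightarrow> 'z based \<Rightarrow> ('a \<times> real \<Rightarrow> 'z) set" where
  "loops A Z \<equiv> rel_maps (cyl (fst A)) (cyl_ends (fst A) {snd A}) Z"

abbreviation loop_homotopic :: "'a based \<Rightarrow> 'z based \<Rightarrow> ('a \<times> real \<Rightarrow> 'z) \<Rightarrow> ('a \<times> real \<Rightarrow> 'z) \<Rightarrow> bool" where
  "loop_homotopic A Z \<equiv> rel_homotopic (cyl (fst A)) (cyl_ends (fst A) {snd A}) Z"

abbreviation loop_class :: "'a based \<Rightarrow> 'z based \<Rightarrow> ('a \<times> real \<Rightarrow> 'z) \<Rightarrow> ('a \<times> real \<Rightarrow> 'z) set" where
  "loop_class A Z \<equiv> homotopy_class (suspension A) Z"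

text \<open>A based map out of a suspension is only determined up to its values at the collapsed points
  of the cylinder, which are not points of the suspension. The representatives that send all of
  them to the base point form the set \<open>loops\<close>: for these, maps on the suspension and maps on the
  cylinder coincide.\<close>

lemma susp_proj_loop:
  assumes "f \<in> loops A Z" "z \<in> topspace (cyl (fst A))"
  shows "f (susp_proj A z) = f z"
proof -
  have "f (snd A, 0) = f z" if "z \<in> cyl_ends (fst A) {snd A}"
    using rel_mapsD(2)[OF assms(1), of "(snd A, 0)"] rel_mapsD(2)[OF assms(1) that] that
    by (auto simp: cyl_ends_def)
  then show ?thesis
    by (simp add: susp_proj_def collapse_map_def susp_collapsed_eq)
qed

lemma based_maps_susp_proj:
  "\<lbrakk>based_space A; f \<in> based_maps (suspension A) Z\<rbrakk> \<Longrightarrow> (\<lambda>z. f (susp_proj A z)) \<in> loops A Z"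
  by (rule collapses_based_map[OF collapses_susp_proj])

lemma loop_based_map:
  assumes A: "based_space A" and f: "f \<in> loops A Z"
  shows "f \<in> based_maps (suspension A) Z"
proof -
  note c = collapses_susp_proj[OF A]
  obtain g where g: "g \<in> based_maps (suspension A) Z"
    "\<And>z. z \<in> topspace (cyl (fst A)) \<Longrightarrow> g (susp_proj A z) = f z"
    by (rule collapses_lift[OF c f]) (rule that)
  have "g y = f y" if y: "y \<in> topspace (fst (suspension A))" for y
  proof -
    obtain z where z: "z \<in> topspace (cyl (fst A))" "y = susp_proj A z"
      using y unfolding collapsesD(5)[OF c, symmetric] by (rule imageE)
    then show ?thesis using g(2) susp_proj_loop[OF f] by simp
  qed
  moreover have "snd (suspension A) \<in> topspace (fst (suspension A))"
    using collapsesD(6)[OF c] by (simp add: based_space_def)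
  ultimately show ?thesis
    using g(1) by (auto simp: based_maps_def intro: continuous_map_eq)
qed

lemma loop_class_eq_iff:
  assumes A: "based_space A" and "f \<in> based_maps (suspension A) Z" "g \<in> based_maps (suspension A) Z"
  shows "loop_class A Z f = loop_class A Z g \<longleftrightarrow>
    loop_homotopic A Z (\<lambda>z. f (susp_proj A z)) (\<lambda>z. g (susp_proj A z))"
  unfolding homotopy_class_eq_iff[OF assms(2,3)] collapses_homotopic[OF collapses_susp_proj[OF A]] ..

lemma loop_class_loops_eq_iff:
  assumes A: "based_space A" and f: "f \<in> loops A Z" and g: "g \<in> loops A Z"
  shows "loop_class A Z f = loop_class A Z g \<longleftrightarrow> loop_homotopic A Z f g"
proof -
  have S: "cyl_ends (fst A) {snd A} \<subseteq> topspace (cyl (fst A))"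
    using A by (intro cyl_ends_subset) (simp add: based_space_def)
  show ?thesis
    unfolding loop_class_eq_iff[OF A loop_based_map[OF A f] loop_based_map[OF A g]]
    by (rule iffI; rule rel_homotopic_cong[OF _ S], assumption)
       (simp_all add: susp_proj_loop[OF f] susp_proj_loop[OF g])
qed

lemma loop_class_eqI:
  "\<lbrakk>based_space A; f \<in> loops A Z; g \<in> loops A Z; loop_homotopic A Z f g\<rbrakk>
    \<Longrightarrow> loop_class A Z f = loop_class A Z g"
  using loop_class_loops_eq_iff by blast

lemma loop_class_cong:
  assumes A: "based_space A" and f: "f \<in> loops A Z" and eq: "\<And>z. z \<in> topspace (cyl (fst A)) \<Longrightarrow> f z = g z"
  shows "loop_class A Z f = loop_class A Z g" and "g \<in> loops A Z"
proof -
  have S: "cyl_ends (fst A) {snd A} \<subseteq> topspace (cyl (fst A))"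
    using A by (intro cyl_ends_subset) (simp add: based_space_def)
  show g: "g \<in> loops A Z" by (rule rel_maps_cong[OF f S eq])
  show "loop_class A Z f = loop_class A Z g"
    by (rule loop_class_eqI[OF A f g], rule rel_homotopic_cong[OF rel_homotopic_refl[OF f] S]) (simp_all add: eq)
qed

lemma loop_class_normalize:
  assumes A: "based_space A" and f: "f \<in> based_maps (suspension A) Z"
  shows "loop_class A Z (\<lambda>z. f (susp_proj A z)) = loop_class A Z f"
proof -
  note L = based_maps_susp_proj[OF A f]
  have S: "cyl_ends (fst A) {snd A} \<subseteq> topspace (cyl (fst A))"
    using A by (intro cyl_ends_subset) (simp add: based_space_def)
  show ?thesis
    unfolding loop_class_eq_iff[OF A loop_based_map[OF A L] f]
    by (rule rel_homotopic_cong[OF rel_homotopic_refl[OF L] S])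
       (simp_all add: susp_proj_loop[OF L, symmetric])
qed

lemma carrier_susp_group:
  assumes A: "based_space A"
  shows "carrier (susp_group A Z) = loop_class A Z ` loops A Z"
proof -
  have "loop_class A Z f \<in> loop_class A Z ` loops A Z" if "f \<in> based_maps (suspension A) Z" for f
    using loop_class_normalize[OF A that] based_maps_susp_proj[OF A that] by (metis imageI)
  then show ?thesis
    using loop_based_map[OF A, of _ Z] by (auto simp: susp_group_def homotopy_classes_def)
qed

lemma loop_class_self:
  assumes f: "f \<in> based_maps (suspension A) Z"
  shows "f \<in> loop_class A Z f"
  using f by (simp add: homotopy_class_def based_maps_def)

lemma loop_class_mem:
  assumes f: "f \<in> based_maps (suspension A) Z" and "g \<in> loop_class A Z f"
  shows "g \<in> based_maps (suspension A) Z" and "loop_class A Z g = loop_class A Z f"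
proof -
  have h: "homotopic_with (\<lambda>h. h (snd (suspension A)) = snd Z) (fst (suspension A)) (fst Z) f g"
    using assms(2) by (simp add: homotopy_class_def)
  show g: "g \<in> based_maps (suspension A) Z"
    using homotopic_with_imp_continuous_maps[OF h] homotopic_with_imp_property[OF h]
    by (simp add: based_maps_def)
  show "loop_class A Z g = loop_class A Z f"
    using h homotopy_class_eq_iff[OF f g] by simp
qed

lemma susp_add_eq:
  assumes "z \<in> topspace (cyl (fst A))"
  shows "susp_add A f g z = concat_maps (\<lambda>z. f (susp_proj A z)) (\<lambda>z. g (susp_proj A z)) z"
  using assms by (auto simp: susp_add_def concat_maps_def)

lemma susp_group_mult:
  assumes A: "based_space A" and f: "f \<in> loops A Z" and g: "g \<in> loops A Z"
  shows "loop_class A Z f \<otimes>\<^bsub>susp_group A Z\<^esub> loop_class A Z g = loop_class A Z (concat_maps f g)"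
proof -
  note fb = loop_based_map[OF A f] and gb = loop_based_map[OF A g]
  have S: "{snd A} \<subseteq> topspace (fst A)" using A by (simp add: based_space_def)
  have *: "loop_class A Z (susp_add A f' g') = loop_class A Z (concat_maps f g)"
    if f': "f' \<in> loop_class A Z f" and g': "g' \<in> loop_class A Z g" for f' g'
  proof -
    let ?f = "\<lambda>z. f' (susp_proj A z)" and ?g = "\<lambda>z. g' (susp_proj A z)"
    note F = based_maps_susp_proj[OF A loop_class_mem(1)[OF fb f']]
    note G = based_maps_susp_proj[OF A loop_class_mem(1)[OF gb g']]
    have "loop_class A Z ?f = loop_class A Z f" "loop_class A Z ?g = loop_class A Z g"
      using loop_class_normalize[OF A] loop_class_mem fb gb f' g' by metis+
    then have "loop_homotopic A Z ?f f" "loop_homotopic A Z ?g g"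
      using loop_class_loops_eq_iff[OF A F f] loop_class_loops_eq_iff[OF A G g] by simp_all
    then have "loop_homotopic A Z (concat_maps ?f ?g) (concat_maps f g)"
      by (rule concat_maps_homotopic[OF _ _ S])
    then have "loop_class A Z (concat_maps ?f ?g) = loop_class A Z (concat_maps f g)"
      by (intro loop_class_eqI A concat_maps_rel f g F G)
    moreover have "loop_class A Z (concat_maps ?f ?g) = loop_class A Z (susp_add A f' g')"
      by (rule loop_class_cong[OF A concat_maps_rel[OF F G]]) (simp add: susp_add_eq)
    ultimately show ?thesis by simp
  qed
  have "f \<in> loop_class A Z f" "g \<in> loop_class A Z g"
    using loop_class_self fb gb by blast+
  then have "(\<Union>f'\<in>loop_class A Z f. \<Union>g'\<in>loop_class A Z g. loop_class A Z (susp_add A f' g')) =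
      loop_class A Z (concat_maps f g)"
    using * by auto
  then show ?thesis by (simp add: susp_group_def)
qed

lemma const_loop: "based_space Z \<Longrightarrow> (\<lambda>_. snd Z) \<in> loops A Z"
  by (rule rel_mapsI) (simp_all add: based_space_def)

lemma group_susp_group:
  assumes A: "based_space A" and Z: "based_space Z"
  shows "group (susp_group A Z)"
proof (rule groupI)
  let ?G = "susp_group A Z" and ?c = "loop_class A Z"
  have S: "{snd A} \<subseteq> topspace (fst A)" using A by (simp add: based_space_def)
  note car = carrier_susp_group[OF A] and mult = susp_group_mult[OF A]
  have one: "\<one>\<^bsub>?G\<^esub> = ?c (\<lambda>_. snd Z)" by (simp add: susp_group_def)
  show "\<one>\<^bsub>?G\<^esub> \<in> carrier ?G" unfolding one car by (rule imageI[OF const_loop[OF Z]])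
  fix x y assume "x \<in> carrier ?G" "y \<in> carrier ?G"
  then obtain f g where f: "f \<in> loops A Z" "x = ?c f" and g: "g \<in> loops A Z" "y = ?c g"
    unfolding car by auto
  show "x \<otimes>\<^bsub>?G\<^esub> y \<in> carrier ?G"
    unfolding f g mult[OF f(1) g(1)] car by (rule imageI[OF concat_maps_rel[OF f(1) g(1)]])
  show "x \<otimes>\<^bsub>?G\<^esub> y \<otimes>\<^bsub>?G\<^esub> z = x \<otimes>\<^bsub>?G\<^esub> (y \<otimes>\<^bsub>?G\<^esub> z)" if "z \<in> carrier ?G" for z
  proof -
    obtain h where h: "h \<in> loops A Z" "z = ?c h" using \<open>z \<in> carrier ?G\<close> unfolding car by auto
    show ?thesis
      unfolding f g h mult[OF f(1) g(1)] mult[OF g(1) h(1)] mult[OF concat_maps_rel[OF f(1) g(1)] h(1)]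
        mult[OF f(1) concat_maps_rel[OF g(1) h(1)]]
      by (intro loop_class_eqI A concat_maps_rel f g h concat_maps_assoc[OF S])
  qed
  show "\<one>\<^bsub>?G\<^esub> \<otimes>\<^bsub>?G\<^esub> x = x"
    unfolding one f mult[OF const_loop[OF Z] f(1)]
    by (intro loop_class_eqI A concat_maps_rel const_loop Z f concat_maps_const_left[OF S])
  show "\<exists>y\<in>carrier ?G. y \<otimes>\<^bsub>?G\<^esub> x = \<one>\<^bsub>?G\<^esub>"
  proof
    let ?r = "\<lambda>z. f (fst z, 1 - snd z)"
    note r = concat_maps_reverse(1)[OF S f(1)]
    show "?c ?r \<in> carrier ?G" unfolding car by (rule imageI[OF r])
    show "?c ?r \<otimes>\<^bsub>?G\<^esub> x = \<one>\<^bsub>?G\<^esub>"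
      unfolding one f mult[OF r f(1)]
      by (intro loop_class_eqI A concat_maps_rel const_loop Z f r concat_maps_reverse(2)[OF S])
  qed
qed

lemma susp_group_one: "\<one>\<^bsub>susp_group A Z\<^esub> = loop_class A Z (\<lambda>_. snd Z)"
  by (simp add: susp_group_def)

lemma susp_group_inv:
  assumes A: "based_space A" and Z: "based_space Z" and f: "f \<in> loops A Z"
  shows "inv\<^bsub>susp_group A Z\<^esub> loop_class A Z f = loop_class A Z (\<lambda>z. f (fst z, 1 - snd z))"
proof (rule group.inv_equality[OF group_susp_group[OF A Z]])
  have S: "{snd A} \<subseteq> topspace (fst A)" using A by (simp add: based_space_def)
  note r = concat_maps_reverse(1)[OF S f]
  show "loop_class A Z (\<lambda>z. f (fst z, 1 - snd z)) \<otimes>\<^bsub>susp_group A Z\<^esub> loop_class A Z f = \<one>\<^bsub>susp_group A Z\<^esub>"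
    unfolding susp_group_one susp_group_mult[OF A r f]
    by (intro loop_class_eqI A concat_maps_rel const_loop Z f r concat_maps_reverse(2)[OF S])
  show "loop_class A Z f \<in> carrier (susp_group A Z)"
    "loop_class A Z (\<lambda>z. f (fst z, 1 - snd z)) \<in> carrier (susp_group A Z)"
    using f r by (auto simp: carrier_susp_group[OF A])
qed

lemma loop_compose:
  assumes \<phi>: "continuous_map (fst W) (fst Z) \<phi>" "\<phi> (snd W) = snd Z" and f: "f \<in> loops A W"
  shows "(\<lambda>z. \<phi> (f z)) \<in> loops A Z"
  by (rule rel_mapsI) (use cont_compose[OF rel_mapsD(1)[OF f] \<phi>(1)] \<phi>(2) rel_mapsD(2)[OF f] in auto)

lemma induced_map_class:
  assumes A: "based_space A" and \<phi>: "continuous_map (fst W) (fst Z) \<phi>" "\<phi> (snd W) = snd Z"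
    and f: "f \<in> loops A W"
  shows "induced_map (suspension A) Z \<phi> (loop_class A W f) = loop_class A Z (\<lambda>z. \<phi> (f z))"
proof -
  have "loop_class A Z (\<phi> \<circ> g) = loop_class A Z (\<lambda>z. \<phi> (f z))" if g: "g \<in> loop_class A W f" for g
  proof -
    have h: "homotopic_with (\<lambda>h. h (snd (suspension A)) = snd W) (fst (suspension A)) (fst W) f g"
      using g by (simp add: homotopy_class_def)
    have "homotopic_with (\<lambda>h. h (snd (suspension A)) = snd Z) (fst (suspension A)) (fst Z) (\<phi> \<circ> f) (\<phi> \<circ> g)"
      by (rule homotopic_with_compose_continuous_map_left[OF h \<phi>(1)]) (simp add: \<phi>(2))
    then have m: "(\<phi> \<circ> g) \<in> loop_class A Z (\<lambda>z. \<phi> (f z))"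
      by (simp add: homotopy_class_def o_def)
    show ?thesis
      by (rule loop_class_mem(2)[OF loop_based_map[OF A loop_compose[where \<phi> = \<phi>, OF \<phi> f]] m])
  qed
  moreover have "f \<in> loop_class A W f"
    by (rule loop_class_self[OF loop_based_map[OF A f]])
  ultimately show ?thesis
    unfolding induced_map_def by auto
qed

lemma induced_map_hom:
  assumes A: "based_space A" and \<phi>: "continuous_map (fst W) (fst Z) \<phi>" "\<phi> (snd W) = snd Z"
  shows "induced_map (suspension A) Z \<phi> \<in> hom (susp_group A W) (susp_group A Z)"
proof (rule homI)
  let ?h = "induced_map (suspension A) Z \<phi>"
  note car = carrier_susp_group[OF A] and ind = induced_map_class[where \<phi> = \<phi>, OF A \<phi>]
    and comp = loop_compose[where \<phi> = \<phi>, OF \<phi>]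
  fix x assume "x \<in> carrier (susp_group A W)"
  then obtain f where f: "f \<in> loops A W" "x = loop_class A W f" unfolding car by auto
  show "?h x \<in> carrier (susp_group A Z)"
    unfolding f ind[OF f(1)] car by (rule imageI[OF comp[OF f(1)]])
  fix y assume "y \<in> carrier (susp_group A W)"
  then obtain g where g: "g \<in> loops A W" "y = loop_class A W g" unfolding car by auto
  have "(\<lambda>z. \<phi> (concat_maps f g z)) = concat_maps (\<lambda>z. \<phi> (f z)) (\<lambda>z. \<phi> (g z))"
    by (auto simp: concat_maps_def)
  then show "?h (x \<otimes>\<^bsub>susp_group A W\<^esub> y) = ?h x \<otimes>\<^bsub>susp_group A Z\<^esub> ?h y"
    unfolding f g susp_group_mult[OF A f(1) g(1)] ind[OF f(1)] ind[OF g(1)]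
      ind[OF concat_maps_rel[OF f(1) g(1)]] susp_group_mult[OF A comp[OF f(1)] comp[OF g(1)]]
    by simp
qed

text \<open>Equality of homotopy classes can be tested on the cylinder over any space that presents \<open>B\<close>.\<close>

lemma loop_class_collapsed_eq_iff:
  assumes c: "collapses P S B q" and f: "f \<in> loops B Z" and g: "g \<in> loops B Z"
  shows "loop_class B Z f = loop_class B Z g \<longleftrightarrow>
    rel_homotopic (cyl P) (cyl_ends P S) Z (\<lambda>z. f (q (fst z), snd z)) (\<lambda>z. g (q (fst z), snd z))"
proof -
  note B = collapsesD(6)[OF c] and S = cyl_ends_subset[OF collapsesD(3)[OF c]]
  have im: "(q (fst z), snd z) \<in> topspace (cyl (fst B))" if "z \<in> topspace (cyl P)" for z
    using that collapsesD(5)[OF c] by auto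
  have "loop_class B Z f = loop_class B Z g \<longleftrightarrow>
      rel_homotopic (cyl P) (cyl_ends P S) Z (\<lambda>z. f (susp_proj B (q (fst z), snd z)))
        (\<lambda>z. g (susp_proj B (q (fst z), snd z)))"
    unfolding homotopy_class_eq_iff[OF loop_based_map[OF B f] loop_based_map[OF B g]]
      collapses_homotopic[OF collapses_suspension[OF c]] ..
  also have "\<dots> \<longleftrightarrow> rel_homotopic (cyl P) (cyl_ends P S) Z (\<lambda>z. f (q (fst z), snd z)) (\<lambda>z. g (q (fst z), snd z))"
    by (rule iffI; rule rel_homotopic_cong[OF _ S], assumption)
       (simp_all only: susp_proj_loop[OF f im] susp_proj_loop[OF g im])
  finally show ?thesis .
qed

lemma loop_collapsed:
  assumes c: "collapses P S B q" and f: "f \<in> loops B Z"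
  shows "(\<lambda>z. f (q (fst z), snd z)) \<in> rel_maps (cyl P) (cyl_ends P S) Z"
proof -
  note B = collapsesD(6)[OF c] and S = cyl_ends_subset[OF collapsesD(3)[OF c]]
  have im: "(q (fst z), snd z) \<in> topspace (cyl (fst B))" if "z \<in> topspace (cyl P)" for z
    using that collapsesD(5)[OF c] by auto
  show ?thesis
    by (rule rel_maps_cong[OF collapses_based_map[OF collapses_suspension[OF c] loop_based_map[OF B f]] S])
       (rule susp_proj_loop[OF f im])
qed

lemma lift_loop:
  assumes c: "collapses P S B q" and f: "f \<in> rel_maps (cyl P) (cyl_ends P S) Z"
  obtains g where "g \<in> loops B Z" "\<And>z. z \<in> topspace (cyl P) \<Longrightarrow> g (q (fst z), snd z) = f z"
proof -
  obtain g where g: "g \<in> based_maps (suspension B) Z"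
    "\<And>z. z \<in> topspace (cyl P) \<Longrightarrow> g (susp_proj B (q (fst z), snd z)) = f z"
    by (rule collapses_lift[OF collapses_suspension[OF c] f]) (rule that)
  show ?thesis
    by (rule that[OF based_maps_susp_proj[OF collapsesD(6)[OF c] g(1)] g(2)])
qed


section \<open>Gottlieb groups\<close>

text \<open>Evaluation at one point is evaluation along a map from a one-point space.\<close>

lemma continuous_map_eval_point:
  assumes "x \<in> topspace X"
  shows "continuous_map (mapping_space X Y) Y (\<lambda>f. f x)"
proof -
  let ?V = "discrete_topology {()}"
  have "continuous_map (prod_topology (mapping_space X Y) ?V) Y (\<lambda>z. id (fst z) ((\<lambda>_. x) (snd z)))"
    by (rule continuous_map_eval_along[OF continuous_map_id])
       (use assms in \<open>auto intro: compact_imp_locally_compact_space simp: compact_space_discrete_topology Hausdorff_space_discrete_topology\<close>)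
  then have "continuous_map (prod_topology (mapping_space X Y) ?V) Y (\<lambda>z. fst z x)" by simp
  from cont_compose[OF _ this, of "mapping_space X Y" "\<lambda>f. (f, ())"] show ?thesis
    by (simp add: continuous_map_paired)
qed

lemma aut1_simps: 
  "fst (aut1 Z) = subtopology (mapping_space (fst Z) (fst Z))
     (path_component_of_set (mapping_space (fst Z) (fst Z)) (\<lambda>z\<in>topspace (fst Z). z))"
  "snd (aut1 Z) = (\<lambda>z\<in>topspace (fst Z). z)"
  by (simp_all add: aut1_def path_component_at_def)

lemma based_space_aut1: "based_space (aut1 Z)"
  unfolding aut1_def
proof (rule based_space_path_component_at)
  have "continuous_map (fst Z) (fst Z) (\<lambda>z\<in>topspace (fst Z). z)"
    by (rule continuous_map_eq[OF continuous_map_id]) simp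
  then show "(\<lambda>z\<in>topspace (fst Z). z) \<in> topspace (mapping_space (fst Z) (fst Z))"
    by (simp add: continuous_maps_def)
qed

lemma evaluation_based_map:
  assumes "based_space Z"
  shows "continuous_map (fst (aut1 Z)) (fst Z) (evaluation Z)" and "evaluation Z (snd (aut1 Z)) = snd Z"
  using assms continuous_map_eval_point[of "snd Z" "fst Z" "fst Z"]
  by (auto simp: aut1_simps evaluation_def[abs_def] based_space_def intro: continuous_map_from_subtopology)

text \<open>A cylinder connects each of its points to an end.  Hence families over a suspension land in
  \<open>aut1\<close> or in the null component as soon as they are continuous into the full mapping space.\<close>

lemma cyl_path_component:
  assumes f: "continuous_map (cyl P) Z f" and "w \<in> topspace (cyl P)" and "f (fst w, 0) = z"
  shows "f w \<in> path_component_of_set Z z"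
proof -
  have "f (fst w, snd w) \<in> path_component_of_set Z z"
    by (rule path_component_ofI[OF f, where \<gamma> = "\<lambda>t. (fst w, t)"])
       (use assms in \<open>auto simp: continuous_map_paired\<close>)
  then show ?thesis by simp
qed

lemma rel_maps_path_component_at:
  "rel_maps (cyl P) (cyl_ends P S) (path_component_at Z z) = rel_maps (cyl P) (cyl_ends P S) (Z, z)"
proof -
  have "f w \<in> path_component_of_set Z z"
    if "continuous_map (cyl P) Z f" "\<forall>x\<in>cyl_ends P S. f x = z" "w \<in> topspace (cyl P)" for f w
    by (rule cyl_path_component[OF that(1,3)]) (use that in \<open>auto simp: cyl_ends_def\<close>)
  then show ?thesis
    unfolding rel_maps_def continuous_map_path_component_at by (auto simp: path_component_at_def)
qed

lemma loops_aut1_eq: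
  "loops B (aut1 Z) = loops B (mapping_space (fst Z) (fst Z), \<lambda>z\<in>topspace (fst Z). z)"
  unfolding aut1_def by (rule rel_maps_path_component_at)

lemma loops_aut1D:
  assumes "F \<in> loops B (aut1 Z)"
  shows "continuous_map (cyl (fst B)) (mapping_space (fst Z) (fst Z)) F"
    and "z \<in> cyl_ends (fst B) {snd B} \<Longrightarrow> y \<in> topspace (fst Z) \<Longrightarrow> F z y = y"
  using assms unfolding loops_aut1_eq by (auto simp: rel_maps_def)

lemma carrier_gottlieb_group:
  assumes A: "based_space A" and Z: "based_space Z"
  shows "carrier (gottlieb_group A Z) = (\<lambda>F. loop_class A Z (\<lambda>z. F z (snd Z))) ` loops A (aut1 Z)"
proof -
  have "induced_map (suspension A) Z (evaluation Z) (loop_class A (aut1 Z) F) = loop_class A Z (\<lambda>z. F z (snd Z))"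
    if "F \<in> loops A (aut1 Z)" for F
    using induced_map_class[where \<phi> = "evaluation Z", OF A evaluation_based_map[OF Z] that]
    by (simp add: evaluation_def)
  then show ?thesis
    by (simp add: gottlieb_group_def carrier_susp_group[OF A] image_image)
qed

lemma eval_loop_aut1:
  "\<lbrakk>based_space Z; F \<in> loops A (aut1 Z)\<rbrakk> \<Longrightarrow> (\<lambda>z. F z (snd Z)) \<in> loops A Z"
  using loop_compose[where \<phi> = "evaluation Z", OF evaluation_based_map] by (simp add: evaluation_def)

lemma subgroup_gottlieb:
  assumes A: "based_space A" and Z: "based_space Z"
  shows "subgroup (carrier (gottlieb_group A Z)) (susp_group A Z)"
proof -
  interpret group_hom "susp_group A (aut1 Z)" "susp_group A Z" "induced_map (suspension A) Z (evaluation Z)"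
    using group_susp_group[OF A based_space_aut1] group_susp_group[OF A Z] induced_map_hom[where \<phi> = "evaluation Z", OF A evaluation_based_map[OF Z]]
    by (simp add: group_hom_def group_hom_axioms_def)
  show ?thesis using img_is_subgroup by (simp add: gottlieb_group_def)
qed

lemma gottlieb_group_simps:
  "mult (gottlieb_group A Z) = mult (susp_group A Z)" "one (gottlieb_group A Z) = one (susp_group A Z)"
  by (simp_all add: gottlieb_group_def)

lemma gottlieb_group_eq:
  "gottlieb_group A Z = (susp_group A Z)\<lparr>carrier := carrier (gottlieb_group A Z)\<rparr>"
  by (simp add: gottlieb_group_def)

lemma group_gottlieb_group:
  assumes A: "based_space A" and Z: "based_space Z"
  shows "group (gottlieb_group A Z)"
  using subgroup.subgroup_is_group[OF subgroup_gottlieb[OF assms] group_susp_group[OF assms]]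
  by (simp flip: gottlieb_group_eq)

lemma continuous_map_collapsed_cyl:
  assumes "collapses P S B q"
  shows "continuous_map (cyl P) (cyl (fst B)) (\<lambda>z. (q (fst z), snd z))"
  by ((rule cont)+, rule cont_compose[OF _ collapsesD(2)[OF assms]], (rule cont)+)

lemma LCH_cyl:
  assumes "locally_compact_space P" "Hausdorff_space P"
  shows "locally_compact_space (cyl P)" "Hausdorff_space (cyl P)"
  using assms locally_compact_unit_interval Hausdorff_unit_interval
  by (simp_all add: locally_compact_space_prod_topology Hausdorff_space_prod_topology)

text \<open>Lift \<open>f\<close> to a family \<open>F\<close> of self-maps of \<open>Z\<close> and consider \<open>F(p, u)(g(p, v))\<close> on the square
  of all \<open>(u, v)\<close>. On the sides of the square it restricts to \<open>f\<close> and \<open>g\<close>, as \<open>F\<close> is the identity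
  for \<open>u\<close> an end point and \<open>g\<close> is the base point for \<open>v\<close> an end point. Hence the two ways around
  the square give the two products. As \<open>F\<close> is evaluated along \<open>g\<close>, local compactness of the
  parameter space makes the map on the square continuous.\<close>

lemma gottlieb_commute:
  assumes c: "collapses P S B q" and P: "locally_compact_space P" "Hausdorff_space P" and Z: "based_space Z"
    and x: "x \<in> carrier (gottlieb_group B Z)" and y: "y \<in> carrier (gottlieb_group B Z)"
  shows "x \<otimes>\<^bsub>gottlieb_group B Z\<^esub> y = y \<otimes>\<^bsub>gottlieb_group B Z\<^esub> x"
proof -
  note B = collapsesD(6)[OF c] and S = collapsesD(3)[OF c]
  obtain F G where F: "F \<in> loops B (aut1 Z)" "x = loop_class B Z (\<lambda>z. F z (snd Z))"
    and G: "G \<in> loops B (aut1 Z)" "y = loop_class B Z (\<lambda>z. G z (snd Z))"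
    using x y unfolding carrier_gottlieb_group[OF B Z] by auto
  define f g where "f = (\<lambda>z. F z (snd Z))" and "g = (\<lambda>z. G z (snd Z))"
  have f: "f \<in> loops B Z" and g: "g \<in> loops B Z"
    unfolding f_def g_def using F G by (auto intro: eval_loop_aut1[OF Z])
  let ?r = "\<lambda>z. (q (fst z), snd z)"
  have im: "q p \<in> topspace (fst B)" if "p \<in> topspace P" for p
    using that collapsesD(5)[OF c] by auto
  have gZ: "g (q p, v) \<in> topspace (fst Z)" if "p \<in> topspace P" "v \<in> {0..1}" for p v
    using rel_mapsD(1)[OF g] im[OF that(1)] that(2) by (auto simp: continuous_map_def)
  have fe: "f (q p, 0) = snd Z" "f (q p, 1) = snd Z" "g (q p, 0) = snd Z" "g (q p, 1) = snd Z"
    if "p \<in> topspace P" for p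
    using im[OF that] by (auto intro!: rel_mapsD(2)[OF f] rel_mapsD(2)[OF g] simp: cyl_ends_def)
  have Fe: "F (q p, 0) w = w" "F (q p, 1) w = w" if "p \<in> topspace P" "w \<in> topspace (fst Z)" for p w
    using im[OF that(1)] that(2) by (auto intro!: loops_aut1D(2)[OF F(1)] simp: cyl_ends_def)
  define K where "K = (\<lambda>w. F (q (fst w), fst (snd w)) (g (q (fst w), snd (snd w))))"
  have sq: "top_of_set ({0..1} \<times> {0..1::real}) = prod_topology unit_interval unit_interval"
    using subtopology_Times[of euclideanreal euclideanreal "{0..1}" "{0..1}"]
    by (simp add: euclidean_product_topology)
  have "continuous_map (prod_topology (cyl P) (cyl P)) (fst Z) (\<lambda>w. F (?r (fst w)) (g (?r (snd w))))"
    by (rule continuous_map_eval_along[OF cont_compose[OF continuous_map_collapsed_cyl[OF c] loops_aut1D(1)[OF F(1)]]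
        cont_compose[OF continuous_map_collapsed_cyl[OF c] rel_mapsD(1)[OF g]]])
       (use LCH_cyl[OF P] in auto)
  moreover have "continuous_map (prod_topology P (prod_topology unit_interval unit_interval))
      (prod_topology (cyl P) (cyl P)) (\<lambda>w. ((fst w, fst (snd w)), (fst w, snd (snd w))))"
    by (rule cont)+
  ultimately have "continuous_map (prod_topology P (prod_topology unit_interval unit_interval)) (fst Z) K"
    unfolding K_def by (auto dest: cont_compose)
  then have K: "continuous_map (prod_topology P (top_of_set ({0..1} \<times> {0..1}))) (fst Z) K"
    by (simp only: sq)
  have KS: "K (p, w) = snd Z" if "p \<in> S" "w \<in> {0..1} \<times> {0..1}" for p w
  proof -
    have "q p = snd B" "p \<in> topspace P" using that collapsesD(9)[OF c] S by auto
    then have "(q p, t) \<in> cyl_ends (fst B) {snd B}" if "t \<in> {0..1}" for t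
      using that by (auto simp: cyl_ends_def)
    then show ?thesis
      using that Z by (auto simp: K_def rel_mapsD(2)[OF g] loops_aut1D(2)[OF F(1)] based_space_def)
  qed
  have H: "rel_homotopic (cyl P) (cyl_ends P S) Z
      (\<lambda>z. K (fst z, (\<lambda>t. (min 1 (2 * t), max 0 (2 * t - 1))) (snd z)))
      (\<lambda>z. K (fst z, (\<lambda>t. (max 0 (2 * t - 1), min 1 (2 * t))) (snd z)))"
    by (rule rel_homotopic_paths[OF K _ _ _ _ _ _ _ _ _ KS S])
       (use fe Fe gZ Z in \<open>auto simp: K_def based_space_def intro!: continuous_intros convex_Times\<close>)
  have "rel_homotopic (cyl P) (cyl_ends P S) Z
      (\<lambda>z. concat_maps f g (?r z)) (\<lambda>z. concat_maps g f (?r z))"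
  proof (rule rel_homotopic_cong[OF H cyl_ends_subset[OF S]])
    fix z assume "z \<in> topspace (cyl P)"
    then obtain p t where z: "z = (p, t)" "p \<in> topspace P" "t \<in> {0..1}" by auto
    note e = fe[OF z(2)] Fe[OF z(2)]
    have "g (q p, max 0 (2 * t - 1)) \<in> topspace (fst Z)" "g (q p, min 1 (2 * t)) \<in> topspace (fst Z)"
      using z by (auto intro!: gZ)
    then show "K (fst z, (\<lambda>t. (min 1 (2 * t), max 0 (2 * t - 1))) (snd z)) = concat_maps f g (?r z)"
      "K (fst z, (\<lambda>t. (max 0 (2 * t - 1), min 1 (2 * t))) (snd z)) = concat_maps g f (?r z)"
      using e z by (cases "t \<le> 1/2"; simp add: K_def concat_maps_def f_def max_absorb1 min_absorb1)+
  qed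
  then have "loop_class B Z (concat_maps f g) = loop_class B Z (concat_maps g f)"
    unfolding loop_class_collapsed_eq_iff[OF c concat_maps_rel[OF f g] concat_maps_rel[OF g f]] .
  then show ?thesis
    unfolding F(2) G(2) gottlieb_group_simps f_def[symmetric] g_def[symmetric]
      susp_group_mult[OF B f g] susp_group_mult[OF B g f] .
qed

lemma comm_group_gottlieb_group:
  assumes c: "collapses P S B q" and P: "locally_compact_space P" "Hausdorff_space P" and Z: "based_space Z"
  shows "comm_group (gottlieb_group B Z)"
  by (rule group.group_comm_groupI[OF group_gottlieb_group[OF collapsesD(6)[OF c] Z]])
     (rule gottlieb_commute[OF assms])

text \<open>Currying always yields continuous maps into a mapping space, so a family of self-maps of \<open>Z\<close>
  given by its adjoint produces elements of the Gottlieb group for any \<open>Z\<close>; the converse direction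
  below evaluates and therefore asks \<open>Z\<close> to be locally compact.\<close>

lemma gottlieb_groupI:
  assumes c: "collapses P S B q" and Z: "based_space Z"
    and G: "continuous_map (prod_topology (cyl P) (fst Z)) (fst Z) G"
    and id: "\<And>z y. z \<in> cyl_ends P S \<Longrightarrow> y \<in> topspace (fst Z) \<Longrightarrow> G (z, y) = y"
    and f: "f \<in> loops B Z" "\<And>z. z \<in> topspace (cyl P) \<Longrightarrow> f (q (fst z), snd z) = G (z, snd Z)"
  shows "loop_class B Z f \<in> carrier (gottlieb_group B Z)"
proof -
  note B = collapsesD(6)[OF c] and S = collapsesD(3)[OF c]
  let ?M = "(mapping_space (fst Z) (fst Z), \<lambda>z\<in>topspace (fst Z). z)"
  have "(\<lambda>z. \<lambda>y\<in>topspace (fst Z). G (z, y)) \<in> rel_maps (cyl P) (cyl_ends P S) ?M"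
    by (rule rel_mapsI) (use continuous_map_curry[OF G] id in auto)
  then obtain F where F: "F \<in> loops B ?M"
    "\<And>z. z \<in> topspace (cyl P) \<Longrightarrow> F (q (fst z), snd z) = (\<lambda>y\<in>topspace (fst Z). G (z, y))"
    by (rule lift_loop[OF c]) (rule that)
  then have F': "F \<in> loops B (aut1 Z)" by (simp add: loops_aut1_eq)
  have "f w = F w (snd Z)" if w: "w \<in> topspace (cyl (fst B))" for w
  proof -
    have "fst w \<in> q ` topspace P" using w by (auto simp: collapsesD(5)[OF c])
    then obtain p where p: "p \<in> topspace P" "fst w = q p" by (auto simp: image_iff)
    have eq: "(q p, snd w) = w" using p(2) by (simp add: prod_eq_iff)
    have "(p, snd w) \<in> topspace (cyl P)" using p(1) w by auto
    from f(2)[OF this] F(2)[OF this] show ?thesis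
      using Z by (simp add: eq based_space_def)
  qed
  then have "loop_class B Z f = loop_class B Z (\<lambda>z. F z (snd Z))"
    by (rule loop_class_cong[OF B f(1)])
  then show ?thesis
    using F' by (auto simp: carrier_gottlieb_group[OF B Z])
qed

lemma gottlieb_groupE:
  assumes B: "based_space B" and Z: "based_space Z" "locally_compact_space (fst Z)" "Hausdorff_space (fst Z)"
    and x: "x \<in> carrier (gottlieb_group B Z)"
  obtains G where "continuous_map (prod_topology (cyl (fst B)) (fst Z)) (fst Z) G"
    "\<And>z y. z \<in> cyl_ends (fst B) {snd B} \<Longrightarrow> y \<in> topspace (fst Z) \<Longrightarrow> G (z, y) = y"
    "(\<lambda>z. G (z, snd Z)) \<in> loops B Z" "x = loop_class B Z (\<lambda>z. G (z, snd Z))"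
proof -
  obtain F where F: "F \<in> loops B (aut1 Z)" "x = loop_class B Z (\<lambda>z. F z (snd Z))"
    using x unfolding carrier_gottlieb_group[OF B Z(1)] by auto
  show ?thesis
  proof (rule that[where G = "\<lambda>w. F (fst w) (snd w)"])
    show "continuous_map (prod_topology (cyl (fst B)) (fst Z)) (fst Z) (\<lambda>w. F (fst w) (snd w))"
      by (rule continuous_map_uncurry[OF loops_aut1D(1)[OF F(1)] Z(2,3)])
  qed (use F loops_aut1D(2)[OF F(1)] eval_loop_aut1[OF Z(1) F(1)] in auto)
qed

section \<open>Homotopy extension with parameters\<close>

text \<open>The homotopy extension property of the base point of \<open>X\<close>, applied to a mapping space of
  functions of a parameter \<open>w\<close>. The last conclusion says that the extension does nothing at the
  parameters where the data are constant; it keeps the homotopies constructed below relative to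
  the collapsed points.\<close>

lemma homotopy_extension:
  assumes X: "well_pointed X" "based_space X" "Hausdorff_space (fst X)"
    and W: "locally_compact_space W" "Hausdorff_space W"
    and K: "continuous_map (prod_topology W (fst X)) Y K" and k: "continuous_map (cyl W) Y k"
    and Kk: "\<And>w. w \<in> topspace W \<Longrightarrow> k (w, 0) = K (w, snd X)"
  obtains E where "continuous_map (cyl (prod_topology W (fst X))) Y E"
    "\<And>w x. w \<in> topspace W \<Longrightarrow> x \<in> topspace (fst X) \<Longrightarrow> E ((w, x), 0) = K (w, x)"
    "\<And>w t. w \<in> topspace W \<Longrightarrow> t \<in> {0..1} \<Longrightarrow> E ((w, snd X), t) = k (w, t)"
    "\<And>w x t c. w \<in> topspace W \<Longrightarrow> x \<in> topspace (fst X) \<Longrightarrow> t \<in> {0..1} \<Longrightarrow>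
      \<forall>x'\<in>topspace (fst X). K (w, x') = c \<Longrightarrow> \<forall>t'\<in>{0..1}. k (w, t') = c \<Longrightarrow>
      E ((w, x), t) = c"
proof -
  define S where "S = {w \<in> topspace W. \<exists>c. (\<forall>x\<in>topspace (fst X). K (w, x) = c) \<and> (\<forall>t\<in>{0..1}. k (w, t) = c)}"
  \<comment> \<open>The prescribed values on \<open>S\<close> are built into the target of the extension problem.\<close>
  define T where "T = {\<phi>. \<forall>w\<in>S. \<phi> w = k (w, 0)}"
  let ?Z = "subtopology (mapping_space W Y) T"
  let ?f = "\<lambda>x. \<lambda>w\<in>topspace W. K (w, x)" and ?p = "\<lambda>t. \<lambda>w\<in>topspace W. k (w, t)"
  have SK: "K (w, x) = k (w, 0)" if "w \<in> S" "x \<in> topspace (fst X)" for w x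
  proof -
    from that(1) obtain c where "\<forall>x\<in>topspace (fst X). K (w, x) = c" "\<forall>t\<in>{0..1}. k (w, t) = c"
      unfolding S_def by fast
    then show ?thesis using that(2) by simp
  qed
  have Sk: "k (w, t) = k (w, 0)" if "w \<in> S" "t \<in> {0..1}" for w t
  proof -
    from that(1) obtain c where "\<forall>t\<in>{0..1}. k (w, t) = c"
      unfolding S_def by fast
    then show ?thesis using that(2) by simp
  qed
  have SW: "w \<in> topspace W" if "w \<in> S" for w using that by (simp add: S_def)
  have "continuous_map (prod_topology (fst X) W) Y (\<lambda>z. K (snd z, fst z))"
    by (rule cont_compose[OF _ K]) (rule cont)+
  from continuous_map_curry[OF this] have f: "continuous_map (fst X) ?Z ?f"
    by (intro continuous_map_into_subtopology) (simp_all add: T_def SK SW Pi_iff)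
  have "continuous_map (prod_topology unit_interval W) Y (\<lambda>z. k (snd z, fst z))"
    by (rule cont_compose[OF _ k]) (rule cont)+
  from continuous_map_curry[OF this] have p': "continuous_map unit_interval (mapping_space W Y) ?p"
    by simp
  have "?p t \<in> T" if "t \<in> {0..1}" for t
    using Sk[OF _ that] SW by (simp add: T_def)
  then have p: "continuous_map unit_interval ?Z ?p"
    using p' by (simp add: continuous_map_in_subtopology Pi_iff)
  have p0: "?p 0 = ?f (snd X)" using Kk by auto
  have "point_extension X ?Z" by (rule well_pointed_point_extension[OF X])
  from this[unfolded point_extension_def, rule_format, OF conjI[OF f conjI[OF p p0]]]
  obtain H where H: "continuous_map (cyl (fst X)) ?Z H"
    and H0: "\<forall>x\<in>topspace (fst X). H (x, 0) = ?f x" and H1: "\<forall>t\<in>{0..1}. H (snd X, t) = ?p t"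
    by (elim exE conjE) (rule that)
  have H': "continuous_map (cyl (fst X)) (mapping_space W Y) H"
    and HT: "\<And>x t w. x \<in> topspace (fst X) \<Longrightarrow> t \<in> {0..1} \<Longrightarrow> w \<in> S \<Longrightarrow> H (x, t) w = k (w, 0)"
    using H by (simp_all add: continuous_map_in_subtopology T_def Pi_iff)
  let ?E = "\<lambda>z. H (snd (fst z), snd z) (fst (fst z))"
  show ?thesis
  proof (rule that[where E = ?E])
    show "continuous_map (cyl (prod_topology W (fst X))) Y ?E"
    proof -
      have "continuous_map (cyl (prod_topology W (fst X))) (prod_topology (cyl (fst X)) W)
          (\<lambda>z. ((snd (fst z), snd z), fst (fst z)))"
        by (rule cont)+
      from cont_compose[OF this continuous_map_uncurry[OF H' W]] show ?thesis by simp
    qed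
    show "?E ((w, x), 0) = K (w, x)" if "w \<in> topspace W" "x \<in> topspace (fst X)" for w x
      using that H0 by simp
    show "?E ((w, snd X), t) = k (w, t)" if "w \<in> topspace W" "t \<in> {0..1}" for w t
      using that H1 by simp
    fix w x and t :: real and c assume w: "w \<in> topspace W" "x \<in> topspace (fst X)" "t \<in> {0..1}"
      and c: "\<forall>x'\<in>topspace (fst X). K (w, x') = c" "\<forall>t'\<in>{0..1}. k (w, t') = c"
    then have "w \<in> S" by (auto simp: S_def)
    then show "?E ((w, x), t) = c"
      using HT[OF w(2,3)] c(2) by simp
  qed
qed

text \<open>A family \<open>L\<close> of paths indexed by \<open>X\<close>, with a common end point, is made constant over the
  base point of \<open>X\<close>: \<open>L\<close> is followed by the reverse of its restriction to the base point. At the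
  base point the result is a path followed by its reverse, and contracting this (the factor
  \<open>1 - \<tau>\<close>) extends over \<open>X\<close>. At \<open>\<tau> = 1\<close> the family is constant over the base point. This is used
  once with the time of a null homotopy and once with the suspension coordinate as path parameter.\<close>

lemma straightening:
  assumes X: "well_pointed X" "based_space X" "Hausdorff_space (fst X)"
    and V: "locally_compact_space V" "Hausdorff_space V"
    and L: "continuous_map (prod_topology (cyl V) (fst X)) Y L"
    and L1: "\<And>v x. v \<in> topspace V \<Longrightarrow> x \<in> topspace (fst X) \<Longrightarrow> L ((v, 1), x) = L ((v, 1), snd X)"
  obtains E where "continuous_map (cyl (prod_topology (cyl V) (fst X))) Y E"
    "\<And>v t x. v \<in> topspace V \<Longrightarrow> t \<in> {0..1} \<Longrightarrow> x \<in> topspace (fst X) \<Longrightarrow> E (((v, t), x), 0) =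
      (if t \<le> 1/2 then L ((v, min 1 (2 * t)), x) else L ((v, 1 - max 0 (2 * t - 1)), snd X))"
    "\<And>v t \<tau>. v \<in> topspace V \<Longrightarrow> t \<in> {0..1} \<Longrightarrow> \<tau> \<in> {0..1} \<Longrightarrow>
      E (((v, t), snd X), \<tau>) = L ((v, (1 - \<tau>) * tent t), snd X)"
    "\<And>v x \<tau>. v \<in> topspace V \<Longrightarrow> x \<in> topspace (fst X) \<Longrightarrow> \<tau> \<in> {0..1} \<Longrightarrow> E (((v, 1), x), \<tau>) = L ((v, 0), snd X)"
    "\<And>v x \<tau> c. v \<in> topspace V \<Longrightarrow> x \<in> topspace (fst X) \<Longrightarrow> \<tau> \<in> {0..1} \<Longrightarrow>
      \<forall>x'\<in>topspace (fst X). L ((v, 0), x') = c \<Longrightarrow> E (((v, 0), x), \<tau>) = c"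
    "\<And>v t x \<tau> c. v \<in> topspace V \<Longrightarrow> t \<in> {0..1} \<Longrightarrow> x \<in> topspace (fst X) \<Longrightarrow> \<tau> \<in> {0..1} \<Longrightarrow>
      \<forall>s\<in>{0..1}. \<forall>x'\<in>topspace (fst X). L ((v, s), x') = c \<Longrightarrow> E (((v, t), x), \<tau>) = c"
proof -
  let ?W = "cyl V"
  have x0: "snd X \<in> topspace (fst X)" using X(2) by (simp add: based_space_def)
  define K where "K = (\<lambda>z. if snd (fst z) \<le> 1/2 then L ((fst (fst z), min 1 (2 * snd (fst z))), snd z)
      else L ((fst (fst z), 1 - max 0 (2 * snd (fst z) - 1)), snd X))"
  define k where "k = (\<lambda>z. L ((fst (fst z), (1 - snd z) * tent (snd (fst z))), snd X))"
  have K: "continuous_map (prod_topology ?W (fst X)) Y K"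
    unfolding K_def
  proof (rule cont_if)
    show "continuous_map (prod_topology ?W (fst X)) unit_interval (\<lambda>z. snd (fst z))" by (rule cont)+
    show "continuous_map (prod_topology ?W (fst X)) Y (\<lambda>z. L ((fst (fst z), min 1 (2 * snd (fst z))), snd z))"
      by (rule cont_compose[OF _ L]) (rule cont)+
    show "continuous_map (prod_topology ?W (fst X)) Y (\<lambda>z. L ((fst (fst z), 1 - max 0 (2 * snd (fst z) - 1)), snd X))"
      by (rule cont_compose[OF _ L]) ((rule cont)+, rule x0)
  qed (use L1 in auto)
  have k: "continuous_map (cyl ?W) Y k"
    unfolding k_def by (rule cont_compose[OF _ L]) ((rule cont)+, rule x0)
  have Kk: "k (w, 0) = K (w, snd X)" if "w \<in> topspace ?W" for w
    using that by (auto simp: K_def k_def tent_def min_def max_def algebra_simps)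
  obtain E where E: "continuous_map (cyl (prod_topology ?W (fst X))) Y E"
    "\<And>w x. w \<in> topspace ?W \<Longrightarrow> x \<in> topspace (fst X) \<Longrightarrow> E ((w, x), 0) = K (w, x)"
    "\<And>w t. w \<in> topspace ?W \<Longrightarrow> t \<in> {0..1} \<Longrightarrow> E ((w, snd X), t) = k (w, t)"
    "\<And>w x t c. w \<in> topspace ?W \<Longrightarrow> x \<in> topspace (fst X) \<Longrightarrow> t \<in> {0..1} \<Longrightarrow>
      \<forall>x'\<in>topspace (fst X). K (w, x') = c \<Longrightarrow> \<forall>t'\<in>{0..1}. k (w, t') = c \<Longrightarrow>
      E ((w, x), t) = c"
    by (rule homotopy_extension[OF X LCH_cyl[OF V] K k Kk]) (assumption, rule that)
  have tent: "tent t \<in> {0..1}" if "t \<in> {0..1}" for t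
    using that by (auto simp: tent_def)
  have scaled: "(1 - \<tau>) * tent t \<in> {0..1}" if "t \<in> {0..1}" "\<tau> \<in> {0..1}" for t \<tau> :: real
    using that tent[OF that(1)] by (auto intro: mult_le_one)
  show ?thesis
  proof (rule that[OF E(1)])
    fix v assume v: "v \<in> topspace V"
    fix x assume x: "x \<in> topspace (fst X)"
    show "E (((v, t), x), 0) = (if t \<le> 1/2 then L ((v, min 1 (2 * t)), x) else L ((v, 1 - max 0 (2 * t - 1)), snd X))"
      if "t \<in> {0..1}" for t
      using E(2)[of "(v, t)" x] v x that by (simp add: K_def)
    fix \<tau> :: real assume \<tau>: "\<tau> \<in> {0..1}"
    show "E (((v, 1), x), \<tau>) = L ((v, 0), snd X)"
      by (rule E(4)) (use v x \<tau> in \<open>auto simp: K_def k_def tent_def\<close>)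
    show "E (((v, 0), x), \<tau>) = c" if "\<forall>x'\<in>topspace (fst X). L ((v, 0), x') = c" for c
      by (rule E(4)) (use v x \<tau> x0 that in \<open>auto simp: K_def k_def tent_def\<close>)
    show "E (((v, t), x), \<tau>) = c" if t: "t \<in> {0..1}"
      and c: "\<forall>s\<in>{0..1}. \<forall>x'\<in>topspace (fst X). L ((v, s), x') = c" for t c
    proof (rule E(4))
      show "\<forall>x'\<in>topspace (fst X). K ((v, t), x') = c"
        using t c x0 by (auto simp: K_def)
      show "\<forall>t'\<in>{0..1}. k ((v, t), t') = c"
        using c scaled[OF t] x0 by (simp add: k_def)
    qed (use v t x \<tau> in auto)
  next
    show "E (((v, t), snd X), \<tau>) = L ((v, (1 - \<tau>) * tent t), snd X)"
      if "v \<in> topspace V" "t \<in> {0..1}" "\<tau> \<in> {0..1}" for v t \<tau>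
      using E(3)[of "(v, t)" \<tau>] that by (simp add: k_def)
  qed
qed


section \<open>Maps into the component of the constant map\<close>

lemma null_component_simps:
  "fst (null_component X Y) = subtopology (mapping_space (fst X) (fst Y))
     (path_component_of_set (mapping_space (fst X) (fst Y)) (\<lambda>x\<in>topspace (fst X). snd Y))"
  "snd (null_component X Y) = (\<lambda>x\<in>topspace (fst X). snd Y)"
  by (simp_all add: null_component_def path_component_at_def)

lemma null_component_element:
  assumes "m \<in> topspace (fst (null_component X Y))"
  shows "continuous_map (fst X) (fst Y) m" and "(\<lambda>x\<in>topspace (fst X). m x) = m"
  using assms by (auto simp: null_component_simps continuous_maps_def extensional_restrict)

lemma continuous_map_null_component_uncurry:
  assumes f: "continuous_map W (fst (null_component X Y)) f"
    and X: "locally_compact_space (fst X)" "Hausdorff_space (fst X)"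
  shows "continuous_map (prod_topology W (fst X)) (fst Y) (\<lambda>z. f (fst z) (snd z))"
  by (rule continuous_map_uncurry[OF _ X]) (use f in \<open>simp add: null_component_simps continuous_map_in_subtopology\<close>)

lemma based_space_null_component:
  assumes "based_space Y"
  shows "based_space (null_component X Y)"
  unfolding null_component_def
proof (rule based_space_path_component_at)
  have "continuous_map (fst X) (fst Y) (\<lambda>x\<in>topspace (fst X). snd Y)"
    by (rule continuous_map_eq[of _ _ "\<lambda>_. snd Y"]) (use assms in \<open>auto simp: based_space_def\<close>)
  then show "(\<lambda>x\<in>topspace (fst X). snd Y) \<in> topspace (mapping_space (fst X) (fst Y))"
    by (simp add: continuous_maps_def)
qed

lemma continuous_map_const_maps:
  assumes Y: "based_space Y" "path_connected_space (fst Y)"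
  shows "continuous_map (fst Y) (fst (null_component X Y)) (\<lambda>y. \<lambda>x\<in>topspace (fst X). y)"
proof -
  let ?M = "mapping_space (fst X) (fst Y)" and ?c = "\<lambda>y. \<lambda>x\<in>topspace (fst X). y"
  have c: "continuous_map (fst Y) ?M ?c"
    using continuous_map_curry[OF continuous_map_fst[of "fst Y" "fst X"]] by simp
  have "?c y \<in> path_component_of_set ?M (?c (snd Y))" if y: "y \<in> topspace (fst Y)" for y
  proof -
    obtain \<gamma> where \<gamma>: "pathin (fst Y) \<gamma>" "\<gamma> 0 = snd Y" "\<gamma> 1 = y"
      using Y y unfolding path_connected_space_def based_space_def by meson
    have "?c (\<gamma> 1) \<in> path_component_of_set ?M (?c (snd Y))"
      by (rule path_component_ofI[OF c]) (use \<gamma> in \<open>auto simp: pathin_def\<close>)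
    then show ?thesis by (simp only: \<gamma>)
  qed
  then show ?thesis
    unfolding null_component_def continuous_map_path_component_at using c by blast
qed

lemma rel_homotopic_path_component_at:
  assumes h: "rel_homotopic (cyl P) (cyl_ends P S) (Z, z) f g" and S: "S \<subseteq> topspace P"
  shows "rel_homotopic (cyl P) (cyl_ends P S) (path_component_at Z z) f g"
proof -
  obtain H where H: "continuous_map (prod_topology unit_interval (cyl P)) (fst (Z, z)) H"
    "\<And>x. H (0, x) = f x" "\<And>x. H (1, x) = g x" "\<And>t x. t \<in> {0..1} \<Longrightarrow> x \<in> cyl_ends P S \<Longrightarrow> H (t, x) = snd (Z, z)"
    using h by (rule rel_homotopicE) (rule that)
  have "H w \<in> path_component_of_set Z z" if w: "w \<in> topspace (prod_topology unit_interval (cyl P))" for w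
  proof -
    obtain t p u where e: "w = (t, (p, u))" "t \<in> {0..1}" "p \<in> topspace P" "u \<in> {0..1}" using w by auto
    have "H (t, (p, u)) \<in> path_component_of_set Z z"
      by (rule path_component_ofI[where \<gamma> = "\<lambda>u. (t, (p, u))" and W = "prod_topology unit_interval (cyl P)"])
         (use H e in \<open>auto simp: continuous_map_paired cyl_ends_def\<close>)
    then show ?thesis by (simp add: e(1))
  qed
  then have "continuous_map (prod_topology unit_interval (cyl P)) (fst (path_component_at Z z)) H"
    using H(1) unfolding continuous_map_path_component_at by simp
  then show ?thesis
    by (rule rel_homotopicI) (use H cyl_ends_subset[OF S] in \<open>simp_all add: path_component_at_def\<close>)
qed

lemma null_component_relI:
  assumes h: "continuous_map (prod_topology (cyl P) (fst X)) (fst Y) h"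
    and ends: "\<And>z x. z \<in> cyl_ends P S \<Longrightarrow> x \<in> topspace (fst X) \<Longrightarrow> h (z, x) = snd Y"
  shows "(\<lambda>z. \<lambda>x\<in>topspace (fst X). h (z, x)) \<in> rel_maps (cyl P) (cyl_ends P S) (null_component X Y)"
  unfolding null_component_def rel_maps_path_component_at
  by (rule rel_mapsI) (use continuous_map_curry[OF h] ends in auto)

lemma null_component_homotopicI:
  assumes h: "continuous_map (prod_topology (prod_topology unit_interval (cyl P)) (fst X)) (fst Y) h"
    and ends: "\<And>t z x. t \<in> {0..1} \<Longrightarrow> z \<in> cyl_ends P S \<Longrightarrow> x \<in> topspace (fst X) \<Longrightarrow> h ((t, z), x) = snd Y"
    and f: "\<And>z. z \<in> topspace (cyl P) \<Longrightarrow> f z = (\<lambda>x\<in>topspace (fst X). h ((0, z), x))"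
    and g: "\<And>z. z \<in> topspace (cyl P) \<Longrightarrow> g z = (\<lambda>x\<in>topspace (fst X). h ((1, z), x))"
    and S: "S \<subseteq> topspace P"
  shows "rel_homotopic (cyl P) (cyl_ends P S) (null_component X Y) f g"
  unfolding null_component_def
proof (rule rel_homotopic_path_component_at[OF _ S], rule rel_homotopicI)
  show "continuous_map (prod_topology unit_interval (cyl P))
      (fst (mapping_space (fst X) (fst Y), \<lambda>x\<in>topspace (fst X). snd Y)) (\<lambda>w. \<lambda>x\<in>topspace (fst X). h (w, x))"
    using continuous_map_curry[OF h] by simp
qed (use f g ends cyl_ends_subset[OF S] in auto)

text \<open>Given self-maps \<open>G(z, x, -)\<close> of \<open>Y\<close>, the point \<open>z\<close> acts on a map \<open>m\<close> from \<open>X\<close> to \<open>Y\<close> by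
  \<open>x \<mapsto> G(z, x, m x)\<close>. This is continuous because evaluation of \<open>m\<close> at \<open>x\<close> is, \<open>X\<close> being locally
  compact.\<close>

lemma gottlieb_null_componentI:
  assumes A: "based_space A" and X: "locally_compact_space (fst X)" "Hausdorff_space (fst X)" and Y: "based_space Y"
    and G: "continuous_map (prod_topology (prod_topology (cyl (fst A)) (fst X)) (fst Y)) (fst Y) G"
    and id: "\<And>z x y. z \<in> cyl_ends (fst A) {snd A} \<Longrightarrow> x \<in> topspace (fst X) \<Longrightarrow> y \<in> topspace (fst Y) \<Longrightarrow> G ((z, x), y) = y"
  shows "loop_class A (null_component X Y) (\<lambda>z. \<lambda>x\<in>topspace (fst X). G ((z, x), snd Y))
    \<in> carrier (gottlieb_group A (null_component X Y))"
proof (rule gottlieb_groupI[OF collapses_id[OF A] based_space_null_component[OF Y]])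
  let ?M = "null_component X Y" and ?map = "mapping_space (fst X) (fst Y)"
  let ?P = "prod_topology (cyl (fst A)) (fst ?M)"
  define G' where "G' = (\<lambda>w. \<lambda>x\<in>topspace (fst X). G ((fst w, x), snd w x))"
  have y0: "snd Y \<in> topspace (fst Y)" using Y by (simp add: based_space_def)
  have "continuous_map (prod_topology ?P (fst X)) (fst Y) (\<lambda>z. snd (fst z) (snd z))"
    using continuous_map_null_component_uncurry[OF continuous_map_snd[of "cyl (fst A)" "fst ?M"] X] .
  then have "continuous_map (prod_topology ?P (fst X)) (fst Y) (\<lambda>z. G ((fst (fst z), snd z), snd (fst z) (snd z)))"
    by - (rule cont_compose[OF _ G], intro cont_pair, (rule cont)+)
  from continuous_map_curry[OF this] have G': "continuous_map ?P ?map G'"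
    by (simp add: G'_def)
  have G'_id: "G' (z, m) = m" if "z \<in> cyl_ends (fst A) {snd A}" "m \<in> topspace (fst ?M)" for z m
  proof -
    have "G' (z, m) = (\<lambda>x\<in>topspace (fst X). m x)"
      unfolding G'_def fst_conv snd_conv
    proof (rule restrict_ext)
      fix x assume x: "x \<in> topspace (fst X)"
      then have "m x \<in> topspace (fst Y)"
        using null_component_element(1)[OF that(2)] by (auto simp: continuous_map_def)
      then show "G ((z, x), m x) = m x" by (rule id[OF that(1) x])
    qed
    then show ?thesis using null_component_element(2)[OF that(2)] by simp
  qed
  have "G' w \<in> path_component_of_set ?map (snd ?M)" if w: "w \<in> topspace ?P" for w
  proof -
    obtain a u m where e: "w = ((a, u), m)" "a \<in> topspace (fst A)" "u \<in> {0..1}" "m \<in> topspace (fst ?M)"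
      using w by auto
    have "G' ((a, 0), m) = m"
      by (rule G'_id[OF _ e(4)]) (use e(2) in \<open>simp add: cyl_ends_def\<close>)
    then have "G' ((a, u), m) \<in> path_component_of_set ?map m"
      by (intro path_component_ofI[OF G', where \<gamma> = "\<lambda>u. ((a, u), m)"])
         (use e in \<open>auto simp: continuous_map_paired\<close>)
    moreover have "path_component_of ?map (snd ?M) m"
      using e(4) by (simp add: null_component_simps)
    ultimately show ?thesis
      unfolding e(1) mem_Collect_eq by (metis path_component_of_trans)
  qed
  then show "continuous_map ?P (fst ?M) G'"
    using G' unfolding null_component_def continuous_map_path_component_at
    by (simp add: path_component_at_def)
  show "G' (z, m) = m" if "z \<in> cyl_ends (fst A) {snd A}" "m \<in> topspace (fst ?M)" for z m
    by (rule G'_id[OF that])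
  show "(\<lambda>z. \<lambda>x\<in>topspace (fst X). G ((z, x), snd Y)) \<in> loops A ?M"
  proof -
    have "continuous_map (prod_topology (cyl (fst A)) (fst X)) (fst Y) (\<lambda>w. G (w, snd Y))"
      by (rule cont_compose[OF _ G]) ((rule cont)+, rule y0)
    then show ?thesis by (rule null_component_relI) (use id y0 in auto)
  qed
  show "(\<lambda>x\<in>topspace (fst X). G (((fst z, snd z), x), snd Y)) = G' (z, snd ?M)" for z
    by (auto simp: G'_def null_component_simps)
qed

text \<open>Conversely a family of self-maps of the null component is restricted to the constant maps.
  The null component need not be locally compact, but \<open>Y\<close> is, and the family is only evaluated
  along \<open>Y\<close>.\<close>

lemma gottlieb_null_componentE:
  assumes A: "based_space A" and X: "locally_compact_space (fst X)" "Hausdorff_space (fst X)"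
    and Y: "based_space Y" "locally_compact_space (fst Y)" "Hausdorff_space (fst Y)" "path_connected_space (fst Y)"
    and x: "x \<in> carrier (gottlieb_group A (null_component X Y))"
  obtains G where "continuous_map (prod_topology (prod_topology (cyl (fst A)) (fst X)) (fst Y)) (fst Y) G"
    "\<And>z x y. z \<in> cyl_ends (fst A) {snd A} \<Longrightarrow> x \<in> topspace (fst X) \<Longrightarrow> y \<in> topspace (fst Y) \<Longrightarrow> G ((z, x), y) = y"
    "x = loop_class A (null_component X Y) (\<lambda>z. \<lambda>x\<in>topspace (fst X). G ((z, x), snd Y))"
proof -
  let ?M = "null_component X Y" and ?c = "\<lambda>y. \<lambda>x\<in>topspace (fst X). y"
  note M = based_space_null_component[OF Y(1)]
  note c = continuous_map_const_maps[OF Y(1,4), of X]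
  obtain F where F: "F \<in> loops A (aut1 ?M)" "x = loop_class A ?M (\<lambda>z. F z (snd ?M))"
    using x unfolding carrier_gottlieb_group[OF A M] by auto
  have "continuous_map (prod_topology (cyl (fst A)) (fst Y)) (fst ?M) (\<lambda>w. F (fst w) (?c (snd w)))"
    by (rule continuous_map_eval_along[OF loops_aut1D(1)[OF F(1)] c Y(2,3)])
  from continuous_map_null_component_uncurry[OF this X]
  have G0: "continuous_map (prod_topology (prod_topology (cyl (fst A)) (fst Y)) (fst X)) (fst Y)
      (\<lambda>z. F (fst (fst z)) (?c (snd (fst z))) (snd z))" .
  let ?G = "\<lambda>w. F (fst (fst w)) (?c (snd w)) (snd (fst w))"
  show ?thesis
  proof (rule that[where G = ?G])
    show "continuous_map (prod_topology (prod_topology (cyl (fst A)) (fst X)) (fst Y)) (fst Y) ?G"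
    proof -
      have "continuous_map (prod_topology (prod_topology (cyl (fst A)) (fst X)) (fst Y))
          (prod_topology (prod_topology (cyl (fst A)) (fst Y)) (fst X)) (\<lambda>w. ((fst (fst w), snd w), snd (fst w)))"
        by (rule cont)+
      from cont_compose[OF this G0] show ?thesis by simp
    qed
    show "?G ((z, x), y) = y" if "z \<in> cyl_ends (fst A) {snd A}" "x \<in> topspace (fst X)" "y \<in> topspace (fst Y)" for z x y
    proof -
      have "?c y \<in> topspace (fst ?M)" using c that(3) by (auto simp: continuous_map_def)
      then show ?thesis using loops_aut1D(2)[OF F(1) that(1)] that(2) by simp
    qed
    have "F z (snd ?M) = (\<lambda>x\<in>topspace (fst X). ?G ((z, x), snd Y))" if "z \<in> topspace (cyl (fst A))" for z
    proof -
      have "F z (snd ?M) \<in> topspace (fst ?M)"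
        using rel_mapsD(1)[OF eval_loop_aut1[OF M F(1)]] that by (auto simp: continuous_map_def)
      from null_component_element(2)[OF this, symmetric] show ?thesis
        by (simp add: null_component_simps cong: restrict_cong)
    qed
    then show "x = loop_class A ?M (\<lambda>z. \<lambda>x\<in>topspace (fst X). ?G ((z, x), snd Y))"
      unfolding F(2) by (rule loop_class_cong(1)[OF A eval_loop_aut1[OF M F(1)]])
  qed
qed

section \<open>Splitting the Gottlieb group of the null component\<close>

text \<open>The adjunction between maps from the suspension of the smash product to \<open>Y\<close> and maps from
  the suspension of \<open>A\<close> to the based maps from \<open>X\<close> to \<open>Y\<close>; here \<open>q\<close> presents \<open>B\<close> as the smash
  product of \<open>A\<close> and \<open>X\<close>.\<close>

definition adjoint_loop :: "'x based \<Rightarrow> ('a \<times> 'x \<Rightarrow> 'b) \<Rightarrow> ('b \<times> real \<Rightarrow> 'y) \<Rightarrow> 'a \<times> real \<Rightarrow> 'x \<Rightarrow> 'y" where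
  "adjoint_loop X q \<beta> = (\<lambda>z. \<lambda>x\<in>topspace (fst X). \<beta> (q (fst z, x), snd z))"

text \<open>The adjunction only makes sense for representatives that are constant on the collapsed
  points, so the induced map on classes chooses one.\<close>

definition adjoint_class ::
  "'a based \<Rightarrow> 'x based \<Rightarrow> 'b based \<Rightarrow> 'y based \<Rightarrow> ('a \<times> 'x \<Rightarrow> 'b) \<Rightarrow>
    ('b \<times> real \<Rightarrow> 'y) set \<Rightarrow> ('a \<times> real \<Rightarrow> 'x \<Rightarrow> 'y) set" where
  "adjoint_class A X B Y q D =
     loop_class A (null_component X Y) (adjoint_loop X q (SOME \<beta>. \<beta> \<in> loops B Y \<and> D = loop_class B Y \<beta>))"

definition const_class :: "'a based \<Rightarrow> 'x based \<Rightarrow> 'y based \<Rightarrow> ('a \<times> real \<Rightarrow> 'y) set \<Rightarrow> ('a \<times> real \<Rightarrow> 'x \<Rightarrow> 'y) set" where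
  "const_class A X Y = induced_map (suspension A) (null_component X Y) (\<lambda>y. \<lambda>x\<in>topspace (fst X). y)"

context
  fixes X :: "'x based" and Y :: "'y based" and A :: "'a based" and B :: "'b based" and q :: "'a \<times> 'x \<Rightarrow> 'b"
  assumes X: "based_space X" "locally_compact_space (fst X)" "Hausdorff_space (fst X)" "well_pointed X"
    and Y: "based_space Y" "locally_compact_space (fst Y)" "Hausdorff_space (fst Y)" "path_connected_space (fst Y)"
    and A: "based_space A" "locally_compact_space (fst A)" "Hausdorff_space (fst A)"
    and q: "collapses (prod_topology (fst A) (fst X))
      (topspace (fst A) \<times> {snd X} \<union> {snd A} \<times> topspace (fst X)) B q"
begin

private abbreviation (input) "M \<equiv> null_component X Y"
private abbreviation (input) "AX \<equiv> prod_topology (fst A) (fst X)"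
private abbreviation (input) "wedge \<equiv> topspace (fst A) \<times> {snd X} \<union> {snd A} \<times> topspace (fst X)"
private abbreviation (input) "adj \<equiv> adjoint_loop X q"

private lemma points: "snd X \<in> topspace (fst X)" "snd Y \<in> topspace (fst Y)" "snd A \<in> topspace (fst A)"
  using X(1) Y(1) A(1) by (simp_all add: based_space_def)

private lemma wedge_subset: "wedge \<subseteq> topspace AX"
  by (rule collapsesD(3)[OF q])

private lemma ends_subset: "cyl_ends (fst A) {snd A} \<subseteq> topspace (cyl (fst A))"
  using points(3) by (intro cyl_ends_subset) simp

private lemma B: "based_space B"
  by (rule collapsesD(6)[OF q])

private lemma M: "based_space M"
  by (rule based_space_null_component[OF Y(1)])

private lemma wedge_cyl_ends:
  "((a, x), u) \<in> cyl_ends AX wedge \<longleftrightarrow> a \<in> topspace (fst A) \<and> x \<in> topspace (fst X) \<and> u \<in> {0..1} \<and>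
    ((a, u) \<in> cyl_ends (fst A) {snd A} \<or> x = snd X)"
  using points by (auto simp: cyl_ends_def)

private lemma AX_LCH: "locally_compact_space AX" "Hausdorff_space AX"
  using X A by (simp_all add: locally_compact_space_prod_topology Hausdorff_space_prod_topology)

lemma adjoint_loop_continuous:
  assumes "\<beta> \<in> loops B Y"
  shows "continuous_map (prod_topology (cyl (fst A)) (fst X)) (fst Y) (\<lambda>w. \<beta> (q (fst (fst w), snd w), snd (fst w)))"
    and "\<And>z x. z \<in> cyl_ends (fst A) {snd A} \<Longrightarrow> x \<in> topspace (fst X) \<Longrightarrow> \<beta> (q (fst z, x), snd z) = snd Y"
    and "\<And>z. z \<in> topspace (cyl (fst A)) \<Longrightarrow> \<beta> (q (fst z, snd X), snd z) = snd Y"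
proof -
  note b = loop_collapsed[OF q assms]
  have "continuous_map (prod_topology (cyl (fst A)) (fst X)) (cyl AX) (\<lambda>w. ((fst (fst w), snd w), snd (fst w)))"
    by (rule cont)+
  from cont_compose[OF this rel_mapsD(1)[OF b]]
  show "continuous_map (prod_topology (cyl (fst A)) (fst X)) (fst Y) (\<lambda>w. \<beta> (q (fst (fst w), snd w), snd (fst w)))"
    by simp
  have ends: "\<beta> (q (a, x), u) = snd Y" if "((a, x), u) \<in> cyl_ends AX wedge" for a x u
    using rel_mapsD(2)[OF b that] by simp
  show "\<beta> (q (fst z, x), snd z) = snd Y" if "z \<in> cyl_ends (fst A) {snd A}" "x \<in> topspace (fst X)" for z x
    by (rule ends) (use that ends_subset in \<open>auto simp: wedge_cyl_ends\<close>)
  show "\<beta> (q (fst z, snd X), snd z) = snd Y" if "z \<in> topspace (cyl (fst A))" for z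
    by (rule ends) (use that points in \<open>auto simp: wedge_cyl_ends\<close>)
qed

lemma adjoint_loop_loop: "\<beta> \<in> loops B Y \<Longrightarrow> adj \<beta> \<in> loops A M"
  using null_component_relI[OF adjoint_loop_continuous(1), of \<beta> "{snd A}"] adjoint_loop_continuous(2)
  by (simp add: adjoint_loop_def)

lemma adjoint_loop_homotopic:
  assumes \<beta>: "\<beta> \<in> loops B Y" "\<beta>' \<in> loops B Y" and eq: "loop_class B Y \<beta> = loop_class B Y \<beta>'"
  shows "loop_class A M (adj \<beta>) = loop_class A M (adj \<beta>')"
proof (rule loop_class_eqI[OF A(1) adjoint_loop_loop[OF \<beta>(1)] adjoint_loop_loop[OF \<beta>(2)]])
  have "rel_homotopic (cyl AX) (cyl_ends AX wedge) Y (\<lambda>z. \<beta> (q (fst z), snd z)) (\<lambda>z. \<beta>' (q (fst z), snd z))"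
    using eq unfolding loop_class_collapsed_eq_iff[OF q \<beta>] .
  then obtain H where H: "continuous_map (prod_topology unit_interval (cyl AX)) (fst Y) H"
    "\<And>z. H (0, z) = \<beta> (q (fst z), snd z)" "\<And>z. H (1, z) = \<beta>' (q (fst z), snd z)"
    "\<And>t z. t \<in> {0..1} \<Longrightarrow> z \<in> cyl_ends AX wedge \<Longrightarrow> H (t, z) = snd Y"
    by (rule rel_homotopicE) (rule that)
  let ?h = "\<lambda>w. H (fst (fst w), (fst (snd (fst w)), snd w), snd (snd (fst w)))"
  show "loop_homotopic A M (adj \<beta>) (adj \<beta>')"
  proof (rule null_component_homotopicI[where h = ?h])
    show "continuous_map (prod_topology (prod_topology unit_interval (cyl (fst A))) (fst X)) (fst Y) ?h"
      by (rule cont_compose[OF _ H(1)]) (rule cont)+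
    show "?h ((t, z), x) = snd Y" if "t \<in> {0..1}" "z \<in> cyl_ends (fst A) {snd A}" "x \<in> topspace (fst X)" for t z x
      using that ends_subset by (auto intro!: H(4) simp: wedge_cyl_ends)
  qed (use points in \<open>auto simp: adjoint_loop_def H(2,3)\<close>)
qed

lemma adjoint_class_eq:
  assumes "\<beta> \<in> loops B Y"
  shows "adjoint_class A X B Y q (loop_class B Y \<beta>) = loop_class A M (adj \<beta>)"
proof -
  let ?b = "SOME \<beta>'. \<beta>' \<in> loops B Y \<and> loop_class B Y \<beta> = loop_class B Y \<beta>'"
  have b: "?b \<in> loops B Y \<and> loop_class B Y \<beta> = loop_class B Y ?b"
    by (rule someI[of _ \<beta>]) (use assms in simp)
  show ?thesis
    unfolding adjoint_class_def
    by (rule adjoint_loop_homotopic[OF assms conjunct1[OF b] conjunct2[OF b], symmetric])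
qed

lemma adjoint_class_hom: "adjoint_class A X B Y q \<in> hom (susp_group B Y) (susp_group A M)"
proof (rule homI)
  note car = carrier_susp_group[OF B] and carA = carrier_susp_group[OF A(1)]
  fix x assume "x \<in> carrier (susp_group B Y)"
  then obtain f where f: "f \<in> loops B Y" "x = loop_class B Y f" unfolding car by auto
  show "adjoint_class A X B Y q x \<in> carrier (susp_group A M)"
    unfolding f adjoint_class_eq[OF f(1)] carA by (rule imageI[OF adjoint_loop_loop[OF f(1)]])
  fix y assume "y \<in> carrier (susp_group B Y)"
  then obtain g where g: "g \<in> loops B Y" "y = loop_class B Y g" unfolding car by auto
  have "adj (concat_maps f g) = concat_maps (adj f) (adj g)"
    by (auto simp: concat_maps_def adjoint_loop_def fun_eq_iff)
  then show "adjoint_class A X B Y q (x \<otimes>\<^bsub>susp_group B Y\<^esub> y) =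
      adjoint_class A X B Y q x \<otimes>\<^bsub>susp_group A M\<^esub> adjoint_class A X B Y q y"
    unfolding f g susp_group_mult[OF B f(1) g(1)] adjoint_class_eq[OF f(1)] adjoint_class_eq[OF g(1)]
      adjoint_class_eq[OF concat_maps_rel[OF f(1) g(1)]]
      susp_group_mult[OF A(1) adjoint_loop_loop[OF f(1)] adjoint_loop_loop[OF g(1)]]
    by simp
qed

private lemma const_maps: "continuous_map (fst Y) (fst M) (\<lambda>y. \<lambda>x\<in>topspace (fst X). y)"
  "(\<lambda>x\<in>topspace (fst X). snd Y) = snd M"
  using continuous_map_const_maps[OF Y(1,4)] by (simp_all add: null_component_simps)

lemma const_class_eq:
  assumes "f \<in> loops A Y"
  shows "const_class A X Y (loop_class A Y f) = loop_class A M (\<lambda>z. \<lambda>x\<in>topspace (fst X). f z)"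
    and "(\<lambda>z. \<lambda>x\<in>topspace (fst X). f z) \<in> loops A M"
  unfolding const_class_def
  using induced_map_class[where \<phi> = "\<lambda>y. \<lambda>x\<in>topspace (fst X). y", OF A(1) const_maps assms]
    loop_compose[where \<phi> = "\<lambda>y. \<lambda>x\<in>topspace (fst X). y", OF const_maps assms] by simp_all

lemma const_class_hom: "const_class A X Y \<in> hom (susp_group A Y) (susp_group A M)"
  unfolding const_class_def
  by (rule induced_map_hom[where \<phi> = "\<lambda>y. \<lambda>x\<in>topspace (fst X). y", OF A(1) const_maps])

lemma const_class_gottlieb:
  assumes "x \<in> carrier (gottlieb_group A Y)"
  shows "const_class A X Y x \<in> carrier (gottlieb_group A M)"
proof -
  obtain G where G: "continuous_map (prod_topology (cyl (fst A)) (fst Y)) (fst Y) G"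
    "\<And>z y. z \<in> cyl_ends (fst A) {snd A} \<Longrightarrow> y \<in> topspace (fst Y) \<Longrightarrow> G (z, y) = y"
    "(\<lambda>z. G (z, snd Y)) \<in> loops A Y" "x = loop_class A Y (\<lambda>z. G (z, snd Y))"
    by (rule gottlieb_groupE[OF A(1) Y(1-3) assms]) (rule that)
  let ?G = "\<lambda>w. G (fst (fst w), snd w)"
  have "continuous_map (prod_topology (prod_topology (cyl (fst A)) (fst X)) (fst Y)) (fst Y) ?G"
    by (rule cont_compose[OF _ G(1)]) (rule cont)+
  from gottlieb_null_componentI[OF A(1) X(2,3) Y(1) this] show ?thesis
    unfolding G(4) const_class_eq(1)[OF G(3)] using G(2) by simp
qed

lemma adjoint_class_gottlieb:
  assumes "x \<in> carrier (gottlieb_group B Y)"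
  shows "adjoint_class A X B Y q x \<in> carrier (gottlieb_group A M)"
proof -
  obtain G where G: "continuous_map (prod_topology (cyl (fst B)) (fst Y)) (fst Y) G"
    "\<And>z y. z \<in> cyl_ends (fst B) {snd B} \<Longrightarrow> y \<in> topspace (fst Y) \<Longrightarrow> G (z, y) = y"
    "(\<lambda>z. G (z, snd Y)) \<in> loops B Y" "x = loop_class B Y (\<lambda>z. G (z, snd Y))"
    by (rule gottlieb_groupE[OF B Y(1-3) assms]) (rule that)
  let ?G = "\<lambda>w. G ((q (fst (fst (fst w)), snd (fst w)), snd (fst (fst w))), snd w)"
  have "continuous_map (prod_topology (prod_topology (cyl (fst A)) (fst X)) (fst Y)) (fst Y) ?G"
    by (rule cont_compose[OF _ G(1)], (rule cont)+, rule cont_compose[OF _ collapsesD(2)[OF q]], (rule cont)+)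
  moreover have "?G ((z, x), y) = y"
    if z: "z \<in> cyl_ends (fst A) {snd A}" and x: "x \<in> topspace (fst X)" and y: "y \<in> topspace (fst Y)" for z x y
  proof -
    obtain a u where e: "z = (a, u)" by (cases z)
    have a: "(a, x) \<in> topspace AX" using z x ends_subset by (auto simp: e)
    then have "q (a, x) \<in> topspace (fst B)" using collapsesD(5)[OF q] by (metis imageI)
    moreover have "q (a, x) = snd B" if "a = snd A"
      by (rule collapsesD(9)[OF q]) (use that x in simp)
    ultimately have "(q (a, x), u) \<in> cyl_ends (fst B) {snd B}" using z by (auto simp: e cyl_ends_def)
    then show ?thesis using G(2) y by (simp add: e)
  qed
  ultimately show ?thesis
    unfolding G(4) adjoint_class_eq[OF G(3)] adjoint_loop_def
    using gottlieb_null_componentI[OF A(1) X(2,3) Y(1), of ?G] by simp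
qed

text \<open>A null homotopy of the adjoint runs through unbased maps: the base point of \<open>X\<close> may move.
  Straightening with respect to the time \<open>t\<close> of the null homotopy makes it based. The family \<open>E\<close>
  then joins \<open>\<beta>\<close> to the constant map in two steps, along \<open>\<tau>\<close> at \<open>t = 0\<close> and along \<open>t\<close> at \<open>\<tau> = 1\<close>.\<close>

lemma adjoint_class_injective:
  assumes \<beta>: "\<beta> \<in> loops B Y" and h: "loop_homotopic A M (adj \<beta>) (\<lambda>_. snd M)"
  shows "loop_class B Y \<beta> = loop_class B Y (\<lambda>_. snd Y)"
proof -
  obtain H where H: "continuous_map (prod_topology unit_interval (cyl (fst A))) (fst M) H"
    "\<And>z. H (0, z) = adj \<beta> z" "\<And>z. H (1, z) = snd M"
    "\<And>t z. t \<in> {0..1} \<Longrightarrow> z \<in> cyl_ends (fst A) {snd A} \<Longrightarrow> H (t, z) = snd M"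
    using h by (rule rel_homotopicE) (rule that)
  let ?V = "cyl (fst A)"
  define L where "L = (\<lambda>w. H (snd (fst w), fst (fst w)) (snd w))"
  have "continuous_map (prod_topology (cyl ?V) (fst X)) (prod_topology (prod_topology unit_interval ?V) (fst X))
      (\<lambda>w. ((snd (fst w), fst (fst w)), snd w))"
    by (rule cont)+
  from cont_compose[OF this continuous_map_null_component_uncurry[OF H(1) X(2,3)]]
  have L: "continuous_map (prod_topology (cyl ?V) (fst X)) (fst Y) L"
    by (simp add: L_def)
  have M0: "snd M x = snd Y" if "x \<in> topspace (fst X)" for x
    using that by (simp add: null_component_simps)
  have L1: "L ((v, 1), x) = snd Y" if "x \<in> topspace (fst X)" for v x
    using that by (simp add: L_def H(3) M0)
  have L0: "L ((v, 0), x) = \<beta> (q (fst v, x), snd v)" if "x \<in> topspace (fst X)" for v x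
    using that by (simp add: L_def H(2) adjoint_loop_def)
  have L0': "L ((v, 0), snd X) = snd Y" if "v \<in> topspace ?V" for v
    using L0[OF points(1)] adjoint_loop_continuous(3)[OF \<beta> that] by simp
  have LS: "\<forall>s\<in>{0..1}. \<forall>x\<in>topspace (fst X). L ((v, s), x) = snd Y" if "v \<in> cyl_ends (fst A) {snd A}" for v
    using that by (simp add: L_def H(4) M0)
  obtain E where E: "continuous_map (cyl (prod_topology (cyl ?V) (fst X))) (fst Y) E"
    "\<And>v t x. v \<in> topspace ?V \<Longrightarrow> t \<in> {0..1} \<Longrightarrow> x \<in> topspace (fst X) \<Longrightarrow> E (((v, t), x), 0) =
      (if t \<le> 1/2 then L ((v, min 1 (2 * t)), x) else L ((v, 1 - max 0 (2 * t - 1)), snd X))"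
    "\<And>v t \<tau>. v \<in> topspace ?V \<Longrightarrow> t \<in> {0..1} \<Longrightarrow> \<tau> \<in> {0..1} \<Longrightarrow>
      E (((v, t), snd X), \<tau>) = L ((v, (1 - \<tau>) * tent t), snd X)"
    "\<And>v x \<tau>. v \<in> topspace ?V \<Longrightarrow> x \<in> topspace (fst X) \<Longrightarrow> \<tau> \<in> {0..1} \<Longrightarrow> E (((v, 1), x), \<tau>) = L ((v, 0), snd X)"
    "\<And>v x \<tau> c. v \<in> topspace ?V \<Longrightarrow> x \<in> topspace (fst X) \<Longrightarrow> \<tau> \<in> {0..1} \<Longrightarrow>
      \<forall>x'\<in>topspace (fst X). L ((v, 0), x') = c \<Longrightarrow> E (((v, 0), x), \<tau>) = c"
    "\<And>v t x \<tau> c. v \<in> topspace ?V \<Longrightarrow> t \<in> {0..1} \<Longrightarrow> x \<in> topspace (fst X) \<Longrightarrow> \<tau> \<in> {0..1} \<Longrightarrow>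
      \<forall>s\<in>{0..1}. \<forall>x'\<in>topspace (fst X). L ((v, s), x') = c \<Longrightarrow> E (((v, t), x), \<tau>) = c"
    by (rule straightening[OF X(4,1,3) LCH_cyl[OF A(2,3)] L]) (simp add: L1 points(1), rule that)
  define e :: "('a \<times> 'x) \<times> real \<Rightarrow> real \<Rightarrow> (('a \<times> real) \<times> real) \<times> 'x"
    where "e = (\<lambda>z t. (((fst (fst z), snd z), t), snd (fst z)))"
  have cov: "\<exists>v x. v \<in> topspace ?V \<and> x \<in> topspace (fst X) \<and> (\<forall>t. e z t = ((v, t), x)) \<and>
      z = ((fst v, x), snd v) \<and> (z \<in> cyl_ends AX wedge \<longrightarrow> v \<in> cyl_ends (fst A) {snd A} \<or> x = snd X)"
    if "z \<in> topspace (cyl AX)" for z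
    using that by (auto simp: e_def wedge_cyl_ends)
  have ends: "z \<in> topspace (cyl AX)" if "z \<in> cyl_ends AX wedge" for z
    using cyl_ends_subset[OF wedge_subset] that by auto
  have "rel_homotopic (cyl AX) (cyl_ends AX wedge) Y (\<lambda>z. \<beta> (q (fst z), snd z)) (\<lambda>z. E (e z 0, 1))"
  proof (rule rel_homotopicI[where H = "\<lambda>w. E (e (snd w) 0, fst w)"])
    show "continuous_map (prod_topology unit_interval (cyl AX)) (fst Y) (\<lambda>w. E (e (snd w) 0, fst w))"
      unfolding e_def by (rule cont_compose[OF _ E(1)]) ((rule cont | simp)+)
    show "E (e (snd (0, z)) 0, fst (0, z)) = \<beta> (q (fst z), snd z)" if z: "z \<in> topspace (cyl AX)" for z
    proof -
      obtain v x where v: "v \<in> topspace ?V" "x \<in> topspace (fst X)" "\<forall>t. e z t = ((v, t), x)" "z = ((fst v, x), snd v)"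
        using cov[OF z] by metis
      then show ?thesis using E(2)[OF v(1) _ v(2), of 0] L0[OF v(2)] by simp
    qed
    show "E (e (snd (t, z)) 0, fst (t, z)) = snd Y" if t: "t \<in> {0..1}" and z: "z \<in> cyl_ends AX wedge" for t z
    proof -
      obtain v x where v: "v \<in> topspace ?V" "x \<in> topspace (fst X)" "\<forall>t. e z t = ((v, t), x)"
        "v \<in> cyl_ends (fst A) {snd A} \<or> x = snd X"
        using cov[OF ends[OF z]] z by metis
      from v(4) show ?thesis
      proof
        assume "v \<in> cyl_ends (fst A) {snd A}"
        then show ?thesis using E(6)[OF v(1) _ v(2) t LS] v(3) by simp
      next
        assume "x = snd X"
        then show ?thesis using E(3)[OF v(1) _ t, of 0] v(3) L0'[OF v(1)] by (simp add: tent_def)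
      qed
    qed
  qed (rule cyl_ends_subset[OF wedge_subset] | simp)+
  moreover have "rel_homotopic (cyl AX) (cyl_ends AX wedge) Y (\<lambda>z. E (e z 0, 1)) (\<lambda>_. snd Y)"
  proof (rule rel_homotopicI[where H = "\<lambda>w. E (e (snd w) (fst w), 1)"])
    show "continuous_map (prod_topology unit_interval (cyl AX)) (fst Y) (\<lambda>w. E (e (snd w) (fst w), 1))"
      unfolding e_def by (rule cont_compose[OF _ E(1)]) ((rule cont | simp)+)
    show "E (e (snd (1, z)) (fst (1, z)), 1) = snd Y" if z: "z \<in> topspace (cyl AX)" for z
    proof -
      obtain v x where v: "v \<in> topspace ?V" "x \<in> topspace (fst X)" "\<forall>t. e z t = ((v, t), x)"
        using cov[OF z] by metis
      then show ?thesis using E(4)[OF v(1,2), of 1] L0'[OF v(1)] by simp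
    qed
    show "E (e (snd (t, z)) (fst (t, z)), 1) = snd Y" if t: "t \<in> {0..1}" and z: "z \<in> cyl_ends AX wedge" for t z
    proof -
      obtain v x where v: "v \<in> topspace ?V" "x \<in> topspace (fst X)" "\<forall>t. e z t = ((v, t), x)"
        "v \<in> cyl_ends (fst A) {snd A} \<or> x = snd X"
        using cov[OF ends[OF z]] z by metis
      from v(4) show ?thesis
      proof
        assume "v \<in> cyl_ends (fst A) {snd A}"
        then show ?thesis using E(6)[OF v(1) t v(2) _ LS] v(3) by simp
      next
        assume "x = snd X"
        then show ?thesis using E(3)[OF v(1) t, of 1] v(3) L0'[OF v(1)] by simp
      qed
    qed
  qed (rule cyl_ends_subset[OF wedge_subset] | simp)+
  ultimately have "rel_homotopic (cyl AX) (cyl_ends AX wedge) Y (\<lambda>z. \<beta> (q (fst z), snd z)) (\<lambda>_. snd Y)"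
    by (rule homotopic_with_trans)
  then show ?thesis
    unfolding loop_class_collapsed_eq_iff[OF q \<beta> const_loop[OF Y(1)]] .
qed

text \<open>Let \<open>x\<close> be the class of \<open>f\<close>, lifted to the family \<open>G\<close>. The restriction \<open>\<alpha>\<close> of \<open>f\<close> to the
  base point of \<open>X\<close> is acted on by \<open>G\<close> at that point. Straightening \<open>G\<close> with respect to the
  suspension coordinate, with the point of \<open>Y\<close> as a further parameter, divides \<open>f\<close> by \<open>\<alpha>\<close> on the
  level of the lifts: the result lifts the quotient and is the identity over the base point of
  \<open>X\<close>, so it descends to the smash product.\<close>

lemma gottlieb_null_component_decompose:
  assumes x: "x \<in> carrier (gottlieb_group A M)"
  obtains C D where "C \<in> carrier (gottlieb_group A Y)" "D \<in> carrier (gottlieb_group B Y)"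
    "x = adjoint_class A X B Y q D \<otimes>\<^bsub>susp_group A M\<^esub> const_class A X Y C"
proof -
  obtain G where G: "continuous_map (prod_topology (prod_topology (cyl (fst A)) (fst X)) (fst Y)) (fst Y) G"
    "\<And>z x y. z \<in> cyl_ends (fst A) {snd A} \<Longrightarrow> x \<in> topspace (fst X) \<Longrightarrow> y \<in> topspace (fst Y) \<Longrightarrow> G ((z, x), y) = y"
    "x = loop_class A M (\<lambda>z. \<lambda>x\<in>topspace (fst X). G ((z, x), snd Y))"
    by (rule gottlieb_null_componentE[OF A(1) X(2,3) Y x]) (rule that)
  define f where "f = (\<lambda>z. \<lambda>x\<in>topspace (fst X). G ((z, x), snd Y))"
  define \<alpha> where "\<alpha> = (\<lambda>z. G ((z, snd X), snd Y))"
  have "continuous_map (prod_topology (cyl (fst A)) (fst X)) (fst Y) (\<lambda>w. G (w, snd Y))"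
    by (rule cont_compose[OF _ G(1)]) ((rule cont)+, rule points)
  then have f: "f \<in> loops A M"
    unfolding f_def by (rule null_component_relI) (rule G(2); simp add: points)
  have G\<alpha>: "continuous_map (prod_topology (cyl (fst A)) (fst Y)) (fst Y) (\<lambda>w. G ((fst w, snd X), snd w))"
    by (rule cont_compose[OF _ G(1)]) ((rule cont)+, rule points, (rule cont)+)
  have \<alpha>: "\<alpha> \<in> loops A Y"
  proof (rule rel_mapsI)
    show "continuous_map (cyl (fst A)) (fst Y) \<alpha>"
      unfolding \<alpha>_def by (rule cont_compose[OF _ G(1)]) ((rule cont)+, rule points, (rule cont)+, rule points)
    show "\<alpha> z = snd Y" if "z \<in> cyl_ends (fst A) {snd A}" for z
      unfolding \<alpha>_def by (rule G(2)[OF that points(1,2)])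
  qed
  have C: "loop_class A Y \<alpha> \<in> carrier (gottlieb_group A Y)"
    by (rule gottlieb_groupI[OF collapses_id[OF A(1)] Y(1) G\<alpha> _ \<alpha>])
       (use G(2) points in \<open>auto simp: \<alpha>_def\<close>)
  let ?V = "prod_topology (fst A) (fst Y)"
  define L where "L = (\<lambda>w. G (((fst (fst (fst w)), snd (fst w)), snd w), snd (fst (fst w))))"
  have L: "continuous_map (prod_topology (cyl ?V) (fst X)) (fst Y) L"
    unfolding L_def by (rule cont_compose[OF _ G(1)]) (rule cont)+
  have Lends: "L (((a, y), u), x) = y"
    if "(a, u) \<in> cyl_ends (fst A) {snd A}" "y \<in> topspace (fst Y)" "x \<in> topspace (fst X)" for a y u x
    using G(2) that by (simp add: L_def)
  have end01: "(a, 0) \<in> cyl_ends (fst A) {snd A}" "(a, 1) \<in> cyl_ends (fst A) {snd A}" if "a \<in> topspace (fst A)" for a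
    using that by (auto simp: cyl_ends_def)
  have V: "locally_compact_space ?V" "Hausdorff_space ?V"
    using A Y by (simp_all add: locally_compact_space_prod_topology Hausdorff_space_prod_topology)
  have L1: "L ((v, 1), x) = L ((v, 1), snd X)" if "v \<in> topspace ?V" "x \<in> topspace (fst X)" for v x
    using that Lends end01 points by (cases v) simp
  obtain E where E: "continuous_map (cyl (prod_topology (cyl ?V) (fst X))) (fst Y) E"
    "\<And>v t x. v \<in> topspace ?V \<Longrightarrow> t \<in> {0..1} \<Longrightarrow> x \<in> topspace (fst X) \<Longrightarrow> E (((v, t), x), 0) =
      (if t \<le> 1/2 then L ((v, min 1 (2 * t)), x) else L ((v, 1 - max 0 (2 * t - 1)), snd X))"
    "\<And>v t \<tau>. v \<in> topspace ?V \<Longrightarrow> t \<in> {0..1} \<Longrightarrow> \<tau> \<in> {0..1} \<Longrightarrow>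
      E (((v, t), snd X), \<tau>) = L ((v, (1 - \<tau>) * tent t), snd X)"
    "\<And>v x \<tau>. v \<in> topspace ?V \<Longrightarrow> x \<in> topspace (fst X) \<Longrightarrow> \<tau> \<in> {0..1} \<Longrightarrow> E (((v, 1), x), \<tau>) = L ((v, 0), snd X)"
    "\<And>v x \<tau> c. v \<in> topspace ?V \<Longrightarrow> x \<in> topspace (fst X) \<Longrightarrow> \<tau> \<in> {0..1} \<Longrightarrow>
      \<forall>x'\<in>topspace (fst X). L ((v, 0), x') = c \<Longrightarrow> E (((v, 0), x), \<tau>) = c"
    "\<And>v t x \<tau> c. v \<in> topspace ?V \<Longrightarrow> t \<in> {0..1} \<Longrightarrow> x \<in> topspace (fst X) \<Longrightarrow> \<tau> \<in> {0..1} \<Longrightarrow>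
      \<forall>s\<in>{0..1}. \<forall>x'\<in>topspace (fst X). L ((v, s), x') = c \<Longrightarrow> E (((v, t), x), \<tau>) = c"
    by (rule straightening[OF X(4,1,3) V L L1]) (assumption, assumption, rule that)
  have Eends: "E ((((a, y), u), x), \<tau>) = y"
    if u: "(a, u) \<in> cyl_ends (fst A) {snd A}" and y: "y \<in> topspace (fst Y)" and x: "x \<in> topspace (fst X)" and \<tau>: "\<tau> \<in> {0..1}"
    for a y u x \<tau>
  proof -
    have a: "a \<in> topspace (fst A)" "u \<in> {0..1}" using u ends_subset by auto
    then have v: "(a, y) \<in> topspace ?V" using y by simp
    consider "u = 0" | "u = 1" | "a = snd A" using u by (auto simp: cyl_ends_def)
    then show ?thesis
    proof cases
      case 1
      show ?thesis unfolding 1 using E(5)[OF v x \<tau>, of y] Lends[OF end01(1)[OF a(1)] y] by simp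
    next
      case 2
      show ?thesis unfolding 2 using E(4)[OF v x \<tau>] Lends[OF end01(1)[OF a(1)] y points(1)] by simp
    next
      case 3
      have "(a, s) \<in> cyl_ends (fst A) {snd A}" if "s \<in> {0..1}" for s using that 3 by (auto simp: cyl_ends_def)
      then show ?thesis using E(6)[OF v a(2) x \<tau>, of y] Lends[OF _ y] by simp
    qed
  qed
  \<comment> \<open>The straightened family, with arguments reordered to \<open>((a, x), u)\<close> and the point of \<open>Y\<close>.\<close>
  define G' where "G' = (\<lambda>w. E ((((fst (fst (fst w)), snd w), snd (fst w)), snd (fst (fst w))), 1))"
  have G': "continuous_map (prod_topology (cyl AX) (fst Y)) (fst Y) G'"
    unfolding G'_def by (rule cont_compose[OF _ E(1)]) ((rule cont | simp)+)
  have G'_id: "G' (z, y) = y" if z: "z \<in> cyl_ends AX wedge" and y: "y \<in> topspace (fst Y)" for z y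
  proof -
    obtain a x u where e: "z = ((a, x), u)" by (cases z) auto
    then have m: "a \<in> topspace (fst A)" "x \<in> topspace (fst X)" "u \<in> {0..1}"
      "(a, u) \<in> cyl_ends (fst A) {snd A} \<or> x = snd X"
      using z by (simp_all add: wedge_cyl_ends)
    from m(4) show ?thesis
    proof
      assume "(a, u) \<in> cyl_ends (fst A) {snd A}"
      then show ?thesis using Eends[OF _ y m(2)] by (simp add: e G'_def)
    next
      assume "x = snd X"
      then show ?thesis
        using E(3)[of "(a, y)" u 1] m y Lends[OF end01(1)[OF m(1)] y points(1)] by (simp add: e G'_def)
    qed
  qed
  have "(\<lambda>z. G' (z, snd Y)) \<in> rel_maps (cyl AX) (cyl_ends AX wedge) Y"
  proof (rule rel_mapsI)
    show "continuous_map (cyl AX) (fst Y) (\<lambda>z. G' (z, snd Y))"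
      by (rule cont_compose[OF _ G']) ((rule cont)+, rule points)
  qed (rule G'_id[OF _ points(2)])
  then obtain \<beta> where \<beta>: "\<beta> \<in> loops B Y" "\<And>z. z \<in> topspace (cyl AX) \<Longrightarrow> \<beta> (q (fst z), snd z) = G' (z, snd Y)"
    by (rule lift_loop[OF q]) (rule that)
  have D: "loop_class B Y \<beta> \<in> carrier (gottlieb_group B Y)"
    by (rule gottlieb_groupI[OF q Y(1) G' G'_id \<beta>])
  let ?c = "\<lambda>z. \<lambda>x\<in>topspace (fst X). \<alpha> z"
  note c = const_class_eq(2)[OF \<alpha>]
  have rev: "(\<lambda>z. ?c (fst z, 1 - snd z)) \<in> loops A M"
    by (rule concat_maps_reverse(1)[OF _ c]) (use points in simp)
  \<comment> \<open>At the base point of \<open>Y\<close> the straightening is a homotopy from the quotient of \<open>f\<close> by \<open>\<alpha>\<close> to the adjoint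
    of \<open>\<beta>\<close>.\<close>
  let ?h = "\<lambda>w. E ((((fst (snd (fst w)), snd Y), snd (snd (fst w))), snd w), fst (fst w))"
  have "loop_homotopic A M (concat_maps f (\<lambda>z. ?c (fst z, 1 - snd z))) (adj \<beta>)"
  proof (rule null_component_homotopicI[where h = ?h])
    show "continuous_map (prod_topology (prod_topology unit_interval (cyl (fst A))) (fst X)) (fst Y) ?h"
      by (rule cont_compose[OF _ E(1)]) ((rule cont)+, rule points, (rule cont)+)
    show "?h ((t, z), x) = snd Y" if "t \<in> {0..1}" "z \<in> cyl_ends (fst A) {snd A}" "x \<in> topspace (fst X)" for t z x
      using Eends[of "fst z" "snd z"] that points by simp
    fix z assume z: "z \<in> topspace (cyl (fst A))"
    then obtain a u where e: "z = (a, u)" "a \<in> topspace (fst A)" "u \<in> {0..1}" by auto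
    show "concat_maps f (\<lambda>z. ?c (fst z, 1 - snd z)) z = (\<lambda>x\<in>topspace (fst X). ?h ((0, z), x))"
    proof
      fix x
      show "concat_maps f (\<lambda>z. ?c (fst z, 1 - snd z)) z x = (\<lambda>x\<in>topspace (fst X). ?h ((0, z), x)) x"
        using E(2)[of "(a, snd Y)" u x] e points
        by (cases "x \<in> topspace (fst X)") (simp_all add: concat_maps_def f_def \<alpha>_def L_def)
    qed
    show "adj \<beta> z = (\<lambda>x\<in>topspace (fst X). ?h ((1, z), x))"
      unfolding adjoint_loop_def
      by (rule restrict_ext) (use \<beta>(2) e in \<open>force simp: G'_def\<close>)
  qed (use points in simp)
  then have "loop_class A M (concat_maps f (\<lambda>z. ?c (fst z, 1 - snd z))) = loop_class A M (adj \<beta>)"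
    by (rule loop_class_eqI[OF A(1) concat_maps_rel[OF f rev] adjoint_loop_loop[OF \<beta>(1)]])
  then have J: "loop_class A M f \<otimes>\<^bsub>susp_group A M\<^esub> inv\<^bsub>susp_group A M\<^esub> loop_class A M ?c = loop_class A M (adj \<beta>)"
    unfolding susp_group_inv[OF A(1) M c] susp_group_mult[OF A(1) f rev] .
  interpret SM: group "susp_group A M" by (rule group_susp_group[OF A(1) M])
  have "loop_class A M f = loop_class A M (adj \<beta>) \<otimes>\<^bsub>susp_group A M\<^esub> loop_class A M ?c"
  proof -
    have "loop_class A M f \<in> carrier (susp_group A M)" "loop_class A M ?c \<in> carrier (susp_group A M)"
      unfolding carrier_susp_group[OF A(1)] by (simp_all add: imageI f c)
    then show ?thesis unfolding J[symmetric] by (simp add: SM.m_assoc)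
  qed
  then show ?thesis
    using that[OF C D] unfolding adjoint_class_eq[OF \<beta>(1)] const_class_eq(1)[OF \<alpha>] G(3) f_def by simp
qed

text \<open>The isomorphism sends \<open>(C, D)\<close> to the product of the class of constant maps given by \<open>C\<close> and
  the adjoint of \<open>D\<close>. It is multiplicative because the target is commutative. For injectivity,
  evaluation at the base point of \<open>X\<close> recovers \<open>C\<close>.\<close>

theorem gottlieb_null_component_iso:
  "comm_group (gottlieb_group A M)" "comm_group (gottlieb_group A Y)" "comm_group (gottlieb_group B Y)"
  "gottlieb_group A M \<cong> gottlieb_group A Y \<times>\<times> gottlieb_group B Y"
proof -
  let ?GM = "gottlieb_group A M" and ?GY = "gottlieb_group A Y" and ?GB = "gottlieb_group B Y"
  let ?SM = "susp_group A M"
  show GM: "comm_group ?GM" and GY: "comm_group ?GY"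
    by (rule comm_group_gottlieb_group[OF collapses_id[OF A(1)] A(2,3)] M Y(1))+
  show GB: "comm_group ?GB" by (rule comm_group_gottlieb_group[OF q AX_LCH Y(1)])
  interpret GM: comm_group ?GM by (rule GM)
  interpret GY: comm_group ?GY by (rule GY)
  interpret GB: comm_group ?GB by (rule GB)
  interpret SM: group ?SM by (rule group_susp_group[OF A(1) M])
  let ?c = "const_class A X Y" and ?j = "adjoint_class A X B Y q"
  have sub: "carrier ?GY \<subseteq> carrier (susp_group A Y)" "carrier ?GB \<subseteq> carrier (susp_group B Y)"
    "carrier ?GM \<subseteq> carrier ?SM"
    by (intro subgroup.subset subgroup_gottlieb A(1) B Y(1) M)+
  have c: "?c \<in> hom ?GY ?GM"
    by (rule homI) (use sub(1) in \<open>simp_all add: subset_iff gottlieb_group_simps const_class_gottlieb hom_mult[OF const_class_hom]\<close>)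
  have j: "?j \<in> hom ?GB ?GM"
    by (rule homI) (use sub(2) in \<open>simp_all add: subset_iff gottlieb_group_simps adjoint_class_gottlieb hom_mult[OF adjoint_class_hom]\<close>)
  let ?\<Psi> = "\<lambda>z. ?c (fst z) \<otimes>\<^bsub>?GM\<^esub> ?j (snd z)"
  have "?c \<circ> fst \<in> hom (?GY \<times>\<times> ?GB) ?GM" "?j \<circ> snd \<in> hom (?GY \<times>\<times> ?GB) ?GM"
    using c j by (simp_all add: hom_of_fst hom_of_snd)
  from GM.hom_group_mult[OF this] have \<Psi>: "?\<Psi> \<in> hom (?GY \<times>\<times> ?GB) ?GM" by simp
  have "?\<Psi> \<in> iso (?GY \<times>\<times> ?GB) ?GM"
    unfolding iso_iff
  proof (intro conjI \<Psi>)
    show "?\<Psi> ` carrier (?GY \<times>\<times> ?GB) = carrier ?GM"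
    proof
      show "?\<Psi> ` carrier (?GY \<times>\<times> ?GB) \<subseteq> carrier ?GM" by (rule hom_carrier[OF \<Psi>])
      show "carrier ?GM \<subseteq> ?\<Psi> ` carrier (?GY \<times>\<times> ?GB)"
      proof
        fix x assume "x \<in> carrier ?GM"
        then obtain C D where CD: "C \<in> carrier ?GY" "D \<in> carrier ?GB" "x = ?j D \<otimes>\<^bsub>?SM\<^esub> ?c C"
          by (rule gottlieb_null_component_decompose) (rule that)
        have "x = ?\<Psi> (C, D)"
          using CD GM.m_comm[OF adjoint_class_gottlieb[OF CD(2)] const_class_gottlieb[OF CD(1)]]
          by (simp add: gottlieb_group_simps)
        then show "x \<in> ?\<Psi> ` carrier (?GY \<times>\<times> ?GB)" using CD by (intro image_eqI[of _ _ "(C, D)"]) simp_all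
      qed
    qed
    have ker: "C = \<one>\<^bsub>?GY\<^esub> \<and> D = \<one>\<^bsub>?GB\<^esub>"
      if C: "C \<in> carrier ?GY" and D: "D \<in> carrier ?GB" and one: "?c C \<otimes>\<^bsub>?GM\<^esub> ?j D = \<one>\<^bsub>?GM\<^esub>" for C D
    proof -
      obtain f where f: "f \<in> loops A Y" "C = loop_class A Y f"
        using C sub(1) unfolding carrier_susp_group[OF A(1)] by auto
      obtain \<beta> where \<beta>: "\<beta> \<in> loops B Y" "D = loop_class B Y \<beta>"
        using D sub(2) unfolding carrier_susp_group[OF B] by auto
      let ?ev = "\<lambda>m. m (snd X)"
      have ev: "continuous_map (fst M) (fst Y) ?ev" "?ev (snd M) = snd Y"
        using continuous_map_eval_point[OF points(1), of "fst Y"] points(1)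
        by (auto simp: null_component_simps intro: continuous_map_from_subtopology)
      note ind = induced_map_class[where \<phi> = ?ev, OF A(1) ev]
      let ?e = "induced_map (suspension A) Y ?ev"
      interpret e: group_hom ?SM "susp_group A Y" ?e
        using induced_map_hom[where \<phi> = ?ev, OF A(1) ev] group_susp_group[OF A(1) Y(1)] SM.group_axioms
        by (simp add: group_hom_def group_hom_axioms_def)
      have eC: "?e (?c C) = C"
        unfolding f const_class_eq(1)[OF f(1)] ind[OF const_class_eq(2)[OF f(1)]] using points by simp
      have eD: "?e (?j D) = \<one>\<^bsub>susp_group A Y\<^esub>"
        unfolding \<beta> adjoint_class_eq[OF \<beta>(1)] ind[OF adjoint_loop_loop[OF \<beta>(1)]] susp_group_one
        by (rule loop_class_cong(1)[OF A(1) loop_compose[where \<phi> = ?ev, OF ev adjoint_loop_loop[OF \<beta>(1)]]])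
           (use adjoint_loop_continuous(3)[OF \<beta>(1)] points in \<open>auto simp: adjoint_loop_def\<close>)
      have cj: "?c C \<in> carrier ?SM" "?j D \<in> carrier ?SM"
        using sub(3) const_class_gottlieb[OF C] adjoint_class_gottlieb[OF D] by auto
      have "C \<in> carrier (susp_group A Y)" using C sub(1) by blast
      then have "?e (?c C \<otimes>\<^bsub>?SM\<^esub> ?j D) = C"
        unfolding e.hom_mult[OF cj] eC eD by (rule e.H.r_one)
      then have C1: "C = \<one>\<^bsub>susp_group A Y\<^esub>"
        using one e.hom_one by (simp add: gottlieb_group_simps)
      interpret c: group_hom "susp_group A Y" ?SM ?c
        using const_class_hom group_susp_group[OF A(1) Y(1)] SM.group_axioms
        by (simp add: group_hom_def group_hom_axioms_def)
      have "?c C = \<one>\<^bsub>?SM\<^esub>" unfolding C1 by (rule c.hom_one)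
      then have "?j D = \<one>\<^bsub>?SM\<^esub>" using one cj by (simp add: gottlieb_group_simps)
      then have "loop_class A M (adj \<beta>) = loop_class A M (\<lambda>_. snd M)"
        unfolding \<beta> adjoint_class_eq[OF \<beta>(1)] susp_group_one .
      then have "loop_homotopic A M (adj \<beta>) (\<lambda>_. snd M)"
        unfolding loop_class_loops_eq_iff[OF A(1) adjoint_loop_loop[OF \<beta>(1)] const_loop[OF M]] .
      from adjoint_class_injective[OF \<beta>(1) this] have "D = \<one>\<^bsub>susp_group B Y\<^esub>"
        unfolding \<beta> susp_group_one .
      then show ?thesis using C1 by (simp add: gottlieb_group_simps)
    qed
    have "inj_on ?\<Psi> (carrier (?GY \<times>\<times> ?GB))"
    proof -
      interpret \<Psi>: group_hom "?GY \<times>\<times> ?GB" ?GM ?\<Psi>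
        using \<Psi> DirProd_group[OF GY.group_axioms GB.group_axioms] GM.group_axioms
        by (simp add: group_hom_def group_hom_axioms_def)
      show ?thesis unfolding \<Psi>.inj_on_one_iff using ker by auto
    qed
    then show "inj_on ?\<Psi> (carrier (?GY \<times>\<times> ?GB))" .
  qed
  then have "?GY \<times>\<times> ?GB \<cong> ?GM" by (rule is_isoI)
  then show "?GM \<cong> ?GY \<times>\<times> ?GB"
    by (rule group.iso_sym[OF DirProd_group[OF GY.group_axioms GB.group_axioms]])
qed

end

section \<open>Spheres as iterated suspensions\<close>

text \<open>The reduced suspension of a sphere is the next sphere. With \<open>e\<close> the base point, the point
  \<open>(x, t)\<close> is placed on the circle that has the segment from \<open>e\<close> to \<open>x\<close> as diameter and is
  orthogonal to the equator: it lies over the point at the fraction \<open>w\<close> of this segment, at height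
  \<open>\<plusminus> sqrt (w (1 - w)) \<bar>x - e\<bar>\<close>, where \<open>\<bar>x - e\<bar>\<close> is the square root of \<open>2 - 2 * x 0\<close>. The choice
  \<open>w = 1 - c\<^sup>2\<close> makes \<open>c\<close> the sign and the square root of \<open>1 - w\<close> at once, which parametrises the
  circle without trigonometric functions.\<close>

definition sphere_suspension :: "nat \<Rightarrow> (nat \<Rightarrow> real) \<times> real \<Rightarrow> nat \<Rightarrow> real" where
  "sphere_suspension k = (\<lambda>(x, t) i. let c = 1 - 2 * t; w = 1 - c\<^sup>2 in
     if i = Suc k then c * sqrt (w * (2 - 2 * x 0)) else (if i = 0 then 1 - w else 0) + w * x i)"

lemma topspace_nsphere: "x \<in> topspace (nsphere k) \<longleftrightarrow> (\<Sum>i\<le>k. (x i)\<^sup>2) = 1 \<and> (\<forall>i>k. x i = 0)"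
  by (simp add: nsphere)

lemma sum_power2_shift:
  "(\<Sum>i\<le>k. ((if i = 0 then a else 0) + b * x i)\<^sup>2) = a\<^sup>2 + 2 * a * b * x 0 + b\<^sup>2 * (\<Sum>i\<le>k. (x i)\<^sup>2)"
  for a b :: real and x :: "nat \<Rightarrow> real"
  by (induction k) (simp_all add: power2_eq_square algebra_simps)

lemma nsphere_coordinate_le_1:
  assumes "x \<in> topspace (nsphere k)"
  shows "(x 0)\<^sup>2 \<le> 1" "x 0 \<le> 1"
proof -
  have "(x 0)\<^sup>2 \<le> (\<Sum>i\<le>k. (x i)\<^sup>2)" by (rule member_le_sum) auto
  then show "(x 0)\<^sup>2 \<le> 1" using assms by (simp add: topspace_nsphere)
  then show "x 0 \<le> 1" by (simp add: abs_square_le_1)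
qed

lemma nsphere_pole:
  assumes x: "x \<in> topspace (nsphere k)" and "x 0 = 1"
  shows "x = snd (based_sphere k)"
proof
  fix i
  have "(\<Sum>j\<in>{..k} - {0}. (x j)\<^sup>2) = 0"
    using x assms(2) by (simp add: topspace_nsphere sum.remove[of "{..k}" 0])
  then have "x i = 0" if "i \<noteq> 0" "i \<le> k"
    using that by (subst (asm) sum_nonneg_eq_0_iff) auto
  then show "x i = snd (based_sphere k) i"
    using x assms(2) by (cases "i \<le> k") (auto simp: based_sphere_def topspace_nsphere)
qed

lemma pole_in_nsphere: "snd (based_sphere k) \<in> topspace (nsphere k)"
  using in_topspace_nsphere[of k] by (simp add: based_sphere_def)

lemma sphere_suspension_in_nsphere:
  assumes x: "x \<in> topspace (nsphere k)" and t: "t \<in> {0..1}"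
  shows "sphere_suspension k (x, t) \<in> topspace (nsphere (Suc k))"
proof -
  define c w where "c = 1 - 2 * t" and "w = 1 - c\<^sup>2"
  have w: "0 \<le> w" using t by (auto simp: w_def c_def abs_square_le_1)
  then have "0 \<le> w * (2 - 2 * x 0)" using nsphere_coordinate_le_1[OF x] by simp
  then have "(c * sqrt (w * (2 - 2 * x 0)))\<^sup>2 = (1 - w) * (w * (2 - 2 * x 0))"
    by (simp add: power_mult_distrib w_def)
  moreover have "(\<Sum>i\<le>k. (sphere_suspension k (x, t) i)\<^sup>2) = (\<Sum>i\<le>k. ((if i = 0 then 1 - w else 0) + w * x i)\<^sup>2)"
    by (rule sum.cong) (auto simp: sphere_suspension_def c_def w_def Let_def)
  moreover have "(\<Sum>i\<le>k. (x i)\<^sup>2) = 1" using x by (simp add: topspace_nsphere)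
  moreover have "sphere_suspension k (x, t) (Suc k) = c * sqrt (w * (2 - 2 * x 0))"
    by (simp add: sphere_suspension_def c_def w_def Let_def)
  ultimately have "(\<Sum>i\<le>Suc k. (sphere_suspension k (x, t) i)\<^sup>2) = 1"
    by (simp add: sum_power2_shift) (simp add: power2_eq_square algebra_simps)
  moreover have "sphere_suspension k (x, t) i = 0" if "i > Suc k" for i
    using that x by (simp add: sphere_suspension_def Let_def topspace_nsphere)
  ultimately show ?thesis by (simp add: topspace_nsphere)
qed

lemma continuous_map_sphere_suspension:
  "continuous_map (cyl (nsphere k)) (nsphere (Suc k)) (sphere_suspension k)"
proof -
  have x: "continuous_map (cyl (nsphere k)) euclideanreal (\<lambda>z. fst z i)" for i
    by (rule cont_compose[OF continuous_map_fst continuous_map_nsphere_projection])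
  have t: "continuous_map (cyl (nsphere k)) euclideanreal (\<lambda>z. snd z)"
    using continuous_map_snd continuous_map_into_fulltopology by blast
  have "continuous_map (cyl (nsphere k)) euclideanreal (\<lambda>z. sphere_suspension k z i)" for i
    unfolding sphere_suspension_def case_prod_unfold Let_def
    by (cases "i = Suc k"; cases "i = 0") (auto intro!: continuous_intros x t)
  then have "continuous_map (cyl (nsphere k)) (powertop_real UNIV) (sphere_suspension k)"
    by (simp add: continuous_map_componentwise_UNIV)
  moreover have "sphere_suspension k z \<in> topspace (nsphere (Suc k))" if "z \<in> topspace (cyl (nsphere k))" for z
    using that sphere_suspension_in_nsphere by (cases z) auto
  ultimately show ?thesis
    unfolding nsphere[of "Suc k"] continuous_map_in_subtopology by (auto simp: nsphere)
qed

lemma sphere_suspension_eq_pole: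
  assumes x: "x \<in> topspace (nsphere k)" and t: "t \<in> {0..1}"
  shows "sphere_suspension k (x, t) = snd (based_sphere (Suc k)) \<longleftrightarrow>
    (x, t) \<in> cyl_ends (nsphere k) {snd (based_sphere k)}"
proof
  define c w where "c = 1 - 2 * t" and "w = 1 - c\<^sup>2"
  assume "sphere_suspension k (x, t) = snd (based_sphere (Suc k))"
  then have "sphere_suspension k (x, t) 0 = 1" by (simp add: based_sphere_def)
  then have "w * (1 - x 0) = 0" by (simp add: sphere_suspension_def Let_def c_def w_def algebra_simps)
  then consider "w = 0" | "x 0 = 1" by auto
  then show "(x, t) \<in> cyl_ends (nsphere k) {snd (based_sphere k)}"
  proof cases
    case 1
    then have "t = 0 \<or> t = 1" by (auto simp: w_def c_def power2_eq_1_iff)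
    then show ?thesis using x by (auto simp: cyl_ends_def)
  next
    case 2
    then show ?thesis using nsphere_pole[OF x] t by (auto simp: cyl_ends_def)
  qed
next
  assume "(x, t) \<in> cyl_ends (nsphere k) {snd (based_sphere k)}"
  then consider "t = 0" | "t = 1" | "x = snd (based_sphere k)" by (auto simp: cyl_ends_def)
  then show "sphere_suspension k (x, t) = snd (based_sphere (Suc k))"
    by cases (auto simp: sphere_suspension_def Let_def based_sphere_def fun_eq_iff)
qed

text \<open>The number \<open>m = w * (1 - x 0)\<close> can be read off coordinate \<open>0\<close> of the image, and the square
  root in the last coordinate is that of \<open>2 * m\<close>. Hence the last coordinate determines \<open>c\<close>, which
  determines \<open>w\<close> and \<open>x\<close>.\<close>

lemma sphere_suspension_inj:
  assumes x: "x \<in> topspace (nsphere k)" "y \<in> topspace (nsphere k)" and t: "t \<in> {0..1}" "u \<in> {0..1}"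
    and eq: "sphere_suspension k (x, t) = sphere_suspension k (y, u)"
    and ne: "sphere_suspension k (x, t) \<noteq> snd (based_sphere (Suc k))"
  shows "(x, t) = (y, u)"
proof -
  define c w where "c = 1 - 2 * t" and "w = 1 - c\<^sup>2"
  define d v where "d = 1 - 2 * u" and "v = 1 - d\<^sup>2"
  let ?z = "sphere_suspension k (x, t)"
  have z: "?z i = (if i = Suc k then c * sqrt (w * (2 - 2 * x 0)) else (if i = 0 then 1 - w else 0) + w * x i)" for i
    by (simp add: sphere_suspension_def Let_def c_def w_def)
  have z': "?z i = (if i = Suc k then d * sqrt (v * (2 - 2 * y 0)) else (if i = 0 then 1 - v else 0) + v * y i)" for i
    unfolding eq by (simp add: sphere_suspension_def Let_def d_def v_def)
  define m where "m = w * (1 - x 0)"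
  have m: "m = v * (1 - y 0)" "m = 1 - ?z 0"
    using z[of 0] z'[of 0] by (simp_all add: m_def algebra_simps)
  have "?z 0 \<noteq> 1" using ne nsphere_pole[OF sphere_suspension_in_nsphere[OF x(1) t(1)]] by blast
  moreover have "?z 0 \<le> 1" by (rule nsphere_coordinate_le_1(2)[OF sphere_suspension_in_nsphere[OF x(1) t(1)]])
  ultimately have m0: "0 < m" using m by simp
  have r: "w * (2 - 2 * x 0) = 2 * m" "v * (2 - 2 * y 0) = 2 * m"
    using m by (simp_all add: m_def algebra_simps)
  have "c * sqrt (w * (2 - 2 * x 0)) = ?z (Suc k)" using z[of "Suc k"] by simp
  also have "\<dots> = d * sqrt (v * (2 - 2 * y 0))" using z'[of "Suc k"] by simp
  finally have "c * sqrt (2 * m) = d * sqrt (2 * m)" unfolding r .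
  then have cd: "c = d" using m0 by simp
  then have tu: "t = u" and wv: "w = v" by (simp_all add: c_def d_def w_def v_def)
  have w0: "w \<noteq> 0" using m0 by (auto simp: m_def)
  have "x i = y i" for i
  proof (cases "i \<le> k")
    case True
    then have "w * x i = v * y i" using z[of i] z'[of i] wv by (auto split: if_splits)
    then show ?thesis using w0 wv by simp
  next
    case False
    then show ?thesis using x by (simp add: topspace_nsphere)
  qed
  then show ?thesis using tu by auto
qed

lemma sphere_suspension_surj:
  assumes z: "z \<in> topspace (nsphere (Suc k))"
  shows "z \<in> sphere_suspension k ` topspace (cyl (nsphere k))"
proof (cases "z 0 = 1")
  case True
  have "(snd (based_sphere k), 0) \<in> topspace (cyl (nsphere k))" using pole_in_nsphere by simp
  moreover have "sphere_suspension k (snd (based_sphere k), 0) = z"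
    using sphere_suspension_eq_pole[OF pole_in_nsphere, of 0 k] nsphere_pole[OF z True] pole_in_nsphere
    by (simp add: cyl_ends_def)
  ultimately show ?thesis by (metis imageI)
next
  case False
  define b where "b = z (Suc k)"
  define p where "p = 1 - z 0"
  have p: "0 < p" using False nsphere_coordinate_le_1(2)[OF z] by (simp add: p_def)
  have sum: "(\<Sum>i\<le>k. (z i)\<^sup>2) = 1 - b\<^sup>2" using z by (simp add: topspace_nsphere b_def)
  have "(z 0)\<^sup>2 \<le> (\<Sum>i\<le>k. (z i)\<^sup>2)" by (rule member_le_sum) auto
  then have "b\<^sup>2 \<le> 1 - (z 0)\<^sup>2" using sum by simp
  also have "\<dots> = 2 * p - p * p" by (simp add: p_def power2_eq_square algebra_simps)
  also have "\<dots> < 2 * p" using p by simp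
  finally have bp: "b\<^sup>2 < 2 * p" .
  \<comment> \<open>With \<open>p = 1 - z 0 = w * (1 - x 0)\<close>, the last coordinate \<open>b\<close> satisfies \<open>b = c * sqrt (2 * p)\<close>.\<close>
  define w where "w = 1 - b\<^sup>2 / (2 * p)"
  have w: "0 < w" using bp p by (simp add: w_def)
  have bw: "b\<^sup>2 = 2 * p * (1 - w)" using p by (simp add: w_def)
  define x where "x = (\<lambda>i. if i \<le> k then ((if i = 0 then - (1 - w) else 0) + z i) / w else 0)"
  define c where "c = b / sqrt (2 * p)"
  have c2: "c\<^sup>2 = 1 - w" using p bw by (simp add: c_def power_divide)
  then have "c\<^sup>2 \<le> 1" using w by simp
  then have "\<bar>c\<bar> \<le> 1" by (simp add: abs_square_le_1)
  then have t: "(1 - c) / 2 \<in> {0..1}" by auto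
  have "(\<Sum>i\<le>k. (x i)\<^sup>2) = (\<Sum>i\<le>k. ((if i = 0 then - (1 - w) else 0) + 1 * z i)\<^sup>2) / w\<^sup>2"
    unfolding sum_divide_distrib by (rule sum.cong) (auto simp: x_def power_divide)
  also have "\<dots> = w\<^sup>2 / w\<^sup>2"
    unfolding sum_power2_shift sum bw by (simp add: p_def power2_eq_square algebra_simps)
  finally have "(\<Sum>i\<le>k. (x i)\<^sup>2) = 1" using w by simp
  then have x: "x \<in> topspace (nsphere k)" by (simp add: topspace_nsphere x_def)
  have "w * (2 - 2 * x 0) = 2 * p" using w by (simp add: x_def p_def field_simps)
  then have h: "c * sqrt (w * (2 - 2 * x 0)) = b" using p by (simp add: c_def)
  have "sphere_suspension k (x, (1 - c) / 2) = z"
  proof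
    fix i
    have e: "1 - 2 * ((1 - c) / 2) = c" by (simp add: field_simps)
    show "sphere_suspension k (x, (1 - c) / 2) i = z i"
      unfolding sphere_suspension_def case_prod_conv Let_def e c2
      using h w z by (auto simp: b_def x_def topspace_nsphere)
  qed
  then show ?thesis using x t by (intro image_eqI[of _ _ "(x, (1 - c) / 2)"]) auto
qed

lemma nsphere_0_cases:
  assumes x: "x \<in> topspace (nsphere 0)"
  obtains "x = snd (based_sphere 0)" | "x = (\<lambda>i. if i = 0 then - 1 else 0)"
proof -
  have z: "x i = 0" if "i \<noteq> 0" for i using x that by (simp add: topspace_nsphere)
  have "(x 0)\<^sup>2 = 1" using x by (simp add: topspace_nsphere)
  then consider "x 0 = 1" | "x 0 = -1" by (auto simp: power2_eq_1_iff)
  then show thesis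
  proof cases
    case 1
    show thesis by (rule that(1), rule ext) (simp add: based_sphere_def 1 z)
  next
    case 2
    show thesis by (rule that(2), rule ext) (simp add: 2 z)
  qed
qed

lemma Hausdorff_nsphere: "Hausdorff_space (nsphere k)"
  unfolding nsphere by (intro Hausdorff_space_subtopology) (simp add: Hausdorff_space_product_topology)

text \<open>Each sphere after the first is the continuous image of the cylinder over the previous one.\<close>

lemma compact_nsphere: "compact_space (nsphere k)"
proof (induction k)
  case 0
  have "topspace (nsphere 0) \<subseteq> {snd (based_sphere 0), \<lambda>i. if i = 0 then - 1 else 0}"
    by (rule subsetI, erule nsphere_0_cases) simp_all
  then have "finite (topspace (nsphere 0))"
    by (rule finite_subset) simp
  then show ?case unfolding compact_space_def by (intro finite_imp_compactin) simp_all
next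
  case (Suc k)
  have "compact_space (cyl (nsphere k))"
    using Suc by (simp add: compact_space_prod_topology compact_space_subtopology)
  then have "compactin (cyl (nsphere k)) (topspace (cyl (nsphere k)))"
    by (simp only: compact_space_def)
  from image_compactin[OF this continuous_map_sphere_suspension]
  have "compactin (nsphere (Suc k)) (sphere_suspension k ` topspace (cyl (nsphere k)))" .
  moreover have "sphere_suspension k ` topspace (cyl (nsphere k)) = topspace (nsphere (Suc k))"
    using sphere_suspension_surj continuous_map_image_subset_topspace[OF continuous_map_sphere_suspension, of k]
    by (intro subset_antisym) auto
  ultimately show ?case by (simp add: compact_space_def)
qed

lemma collapses_sphere_suspension:
  "collapses (cyl (nsphere k)) (cyl_ends (nsphere k) {snd (based_sphere k)}) (based_sphere (Suc k)) (sphere_suspension k)"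
  unfolding collapses_def
proof (intro conjI ballI)
  have fst: "fst (based_sphere n) = nsphere n" for n by (simp add: based_sphere_def)
  show "quotient_map (cyl (nsphere k)) (fst (based_sphere (Suc k))) (sphere_suspension k)"
    unfolding fst
  proof (rule continuous_closed_imp_quotient_map)
    show "closed_map (cyl (nsphere k)) (nsphere (Suc k)) (sphere_suspension k)"
      by (rule continuous_imp_closed_map[OF continuous_map_sphere_suspension])
         (simp_all add: compact_space_prod_topology compact_nsphere compact_space_subtopology Hausdorff_nsphere)
    show "sphere_suspension k ` topspace (cyl (nsphere k)) = topspace (nsphere (Suc k))"
      using sphere_suspension_surj continuous_map_image_subset_topspace[OF continuous_map_sphere_suspension, of k]
      by (intro subset_antisym) auto
  qed (rule continuous_map_sphere_suspension)
  show "cyl_ends (nsphere k) {snd (based_sphere k)} \<subseteq> topspace (cyl (nsphere k))"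
    using pole_in_nsphere by (intro cyl_ends_subset) simp
  show "cyl_ends (nsphere k) {snd (based_sphere k)} \<noteq> {}" by (auto simp: cyl_ends_def)
  show "sphere_suspension k z = snd (based_sphere (Suc k)) \<longleftrightarrow> z \<in> cyl_ends (nsphere k) {snd (based_sphere k)}"
    if "z \<in> topspace (cyl (nsphere k))" for z
    using that sphere_suspension_eq_pole by (cases z) auto
  show "inj_on (sphere_suspension k) (topspace (cyl (nsphere k)) - cyl_ends (nsphere k) {snd (based_sphere k)})"
  proof (rule inj_onI)
    fix z w assume z: "z \<in> topspace (cyl (nsphere k)) - cyl_ends (nsphere k) {snd (based_sphere k)}"
      and w: "w \<in> topspace (cyl (nsphere k)) - cyl_ends (nsphere k) {snd (based_sphere k)}"
      and eq: "sphere_suspension k z = sphere_suspension k w"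
    obtain x t where zz: "z = (x, t)" by (cases z)
    obtain y u where ww: "w = (y, u)" by (cases w)
    show "z = w"
      unfolding zz ww
      by (rule sphere_suspension_inj) (use z w eq sphere_suspension_eq_pole[of x k t] in \<open>auto simp: zz ww\<close>)
  qed
qed

text \<open>If \<open>C\<close> identifies points of \<open>S\<close> only, then collapsing \<open>S\<close> factors through \<open>C\<close>.\<close>

lemma collapses_factor:
  assumes c: "collapses P S B r" and C: "quotient_map P P' C"
    and fib: "\<And>z w. z \<in> topspace P \<Longrightarrow> w \<in> topspace P \<Longrightarrow> C z = C w \<Longrightarrow> z = w \<or> z \<in> S \<and> w \<in> S"
  obtains Q where "collapses P' (C ` S) B Q"
proof -
  note D = collapsesD[OF c]
  have im: "C ` topspace P = topspace P'" by (rule quotient_imp_surjective_map[OF C])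
  obtain Q where Q: "continuous_map P' (fst B) Q" "\<And>z. z \<in> topspace P \<Longrightarrow> Q (C z) = r z"
  proof (rule quotient_map_lift_exists[OF C D(2)])
    show "r z = r w" if "z \<in> topspace P" "w \<in> topspace P" "C z = C w" for z w
      using fib[OF that] D(9) by auto
  qed (rule that)
  have "quotient_map P (fst B) (Q \<circ> C)"
    by (rule quotient_map_eq[OF D(1)]) (simp add: Q(2))
  then have q: "quotient_map P' (fst B) Q"
    by (rule quotient_map_from_composition[OF quotient_imp_continuous_map[OF C] Q(1)])
  have CS: "C z \<in> C ` S \<longleftrightarrow> z \<in> S" if z: "z \<in> topspace P" for z
  proof
    assume "C z \<in> C ` S"
    then obtain s where s: "s \<in> S" "C z = C s" by auto
    then show "z \<in> S" using fib[OF z _ s(2)] D(3) by auto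
  qed simp
  have "collapses P' (C ` S) B Q"
    unfolding collapses_def
  proof (intro conjI q ballI)
    show "C ` S \<subseteq> topspace P'" "C ` S \<noteq> {}" using im D(3,4) by auto
    show "Q y = snd B \<longleftrightarrow> y \<in> C ` S" if "y \<in> topspace P'" for y
    proof -
      have "y \<in> C ` topspace P" using that im by simp
      then obtain z where z: "z \<in> topspace P" "y = C z" by auto
      show ?thesis unfolding z(2) Q(2)[OF z(1)] CS[OF z(1)] by (rule D(7)[OF z(1)])
    qed
    show "inj_on Q (topspace P' - C ` S)"
    proof (rule inj_onI)
      fix y y' assume y: "y \<in> topspace P' - C ` S" and y': "y' \<in> topspace P' - C ` S" and eq: "Q y = Q y'"
      have "y \<in> C ` topspace P" "y' \<in> C ` topspace P" using y y' im by auto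
      then obtain z z' where z: "z \<in> topspace P" "y = C z" and z': "z' \<in> topspace P" "y' = C z'" by auto
      have "r z = r z'" using eq unfolding z(2) z'(2) Q(2)[OF z(1)] Q(2)[OF z'(1)] .
      then have "z = z' \<or> z \<in> S \<and> z' \<in> S" by (rule D(8)[OF z(1) z'(1)])
      moreover have "z \<notin> S" using y z(2) by auto
      ultimately show "y = y'" using z(2) z'(2) by simp
    qed
  qed
  then show ?thesis by (rule that)
qed

lemma collapses_rename:
  assumes c: "collapses P S B q" and r: "inj r"
  shows "collapses P S (rename_based r B) (\<lambda>x. r (q x))"
proof -
  note D = collapsesD[OF c]
  have "quotient_map P (fst (rename_based r B)) (r \<circ> q)"
    unfolding rename_based_def fst_conv by (rule quotient_map_compose[OF D(1) quotient_map_quotient_topology])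
  then have "quotient_map P (fst (rename_based r B)) (\<lambda>x. r (q x))" by (simp add: o_def)
  then show ?thesis
    using c r unfolding collapses_def by (auto simp: rename_based_def inj_on_def)
qed

text \<open>The smash product with the \<open>0\<close>-sphere is \<open>X\<close>: the points with negative coordinate form a
  copy of \<open>X\<close> and the others are collapsed.\<close>

lemma collapses_0_sphere:
  assumes X: "based_space X"
  shows "\<exists>Q. collapses (prod_topology (nsphere 0) (fst X))
    (topspace (nsphere 0) \<times> {snd X} \<union> {snd (based_sphere 0)} \<times> topspace (fst X)) X Q"
proof
  let ?P = "prod_topology (nsphere 0) (fst X)" and ?e = "snd (based_sphere 0)"
  define m :: "nat \<Rightarrow> real" where "m = (\<lambda>i. if i = 0 then -1 else 0)"
  have m: "m \<in> topspace (nsphere 0)" by (simp add: topspace_nsphere m_def)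
  have x0: "snd X \<in> topspace (fst X)" using X by (simp add: based_space_def)
  have cases: "s = ?e \<or> s = m" if "s \<in> topspace (nsphere 0)" for s
    using that by (rule nsphere_0_cases) (simp_all add: m_def)
  let ?Q = "\<lambda>z. if fst z 0 \<le> (0::real) then snd z else snd X"
  have "continuous_map ?P (fst X) ?Q"
  proof (rule continuous_map_cases_le)
    show "continuous_map ?P euclideanreal (\<lambda>z. fst z 0)"
      by (rule cont_compose[OF continuous_map_fst continuous_map_nsphere_projection])
    show "snd z = snd X" if "z \<in> topspace ?P" "fst z 0 = (0::real)" for z
      using that by (auto simp: topspace_nsphere)
  qed (auto intro!: continuous_map_from_subtopology continuous_map_snd simp: x0)
  moreover have "continuous_map (fst X) ?P (\<lambda>x. (m, x))"
    using m by (intro cont_pair) simp_all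
  ultimately have "retraction_map ?P (fst X) ?Q"
    unfolding retraction_map_def retraction_maps_def by (intro exI[of _ "\<lambda>x. (m, x)"]) (auto simp: m_def)
  then have q: "quotient_map ?P (fst X) ?Q" by (rule retraction_imp_quotient_map)
  have val: "\<not> ?e 0 \<le> 0" "m 0 \<le> 0" "?e \<noteq> m"
    by (auto simp: based_sphere_def m_def fun_eq_iff)
  show "collapses ?P (topspace (nsphere 0) \<times> {snd X} \<union> {?e} \<times> topspace (fst X)) X ?Q"
    unfolding collapses_def
  proof (intro conjI q ballI)
    show "topspace (nsphere 0) \<times> {snd X} \<union> {?e} \<times> topspace (fst X) \<subseteq> topspace ?P"
      using x0 pole_in_nsphere[of 0] by auto
    show "topspace (nsphere 0) \<times> {snd X} \<union> {?e} \<times> topspace (fst X) \<noteq> {}" using m by auto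
    show "?Q z = snd X \<longleftrightarrow> z \<in> topspace (nsphere 0) \<times> {snd X} \<union> {?e} \<times> topspace (fst X)"
      if "z \<in> topspace ?P" for z
      using that cases[of "fst z"] val m by (cases z) auto
    show "inj_on ?Q (topspace ?P - (topspace (nsphere 0) \<times> {snd X} \<union> {?e} \<times> topspace (fst X)))"
    proof (rule inj_onI)
      fix z w assume z: "z \<in> topspace ?P - (topspace (nsphere 0) \<times> {snd X} \<union> {?e} \<times> topspace (fst X))"
        and w: "w \<in> topspace ?P - (topspace (nsphere 0) \<times> {snd X} \<union> {?e} \<times> topspace (fst X))" and eq: "?Q z = ?Q w"
      have "fst z = m" "fst w = m" using z w cases[of "fst z"] cases[of "fst w"] by (auto simp: mem_Times_iff)
      then show "z = w" using eq val(2) by (simp add: prod_eq_iff)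
    qed
  qed
qed

text \<open>The iterated suspension of \<open>X\<close> is the smash product of a sphere with \<open>X\<close>. Both the smash
  product with the next sphere and the next suspension are collapses of the product of the sphere,
  \<open>X\<close> and the interval. Local compactness of \<open>X\<close> makes the product of \<open>sphere_suspension\<close> with \<open>X\<close>
  a quotient map, so the second collapse factors through it.\<close>

lemma collapses_iterated_suspension:
  fixes X :: "'x based"
  assumes X: "based_space X" "locally_compact_space (fst X)" "Hausdorff_space (fst X)"
  shows "\<exists>Q. collapses (prod_topology (nsphere k) (fst X))
    (topspace (nsphere k) \<times> {snd X} \<union> {snd (based_sphere k)} \<times> topspace (fst X)) (iterated_suspension k X) Q"
proof (induction k)
  case 0
  obtain Q where "collapses (prod_topology (nsphere 0) (fst X))
    (topspace (nsphere 0) \<times> {snd X} \<union> {snd (based_sphere 0)} \<times> topspace (fst X)) X Q"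
    using collapses_0_sphere[OF X(1)] by auto
  from collapses_rename[OF this, of "\<lambda>x. (x, [])"] show ?case by (auto simp: inj_on_def)
next
  case (Suc k)
  let ?P = "prod_topology (nsphere k) (fst X)" and ?P' = "prod_topology (nsphere (Suc k)) (fst X)"
  let ?S = "topspace (nsphere k) \<times> {snd X} \<union> {snd (based_sphere k)} \<times> topspace (fst X)"
  let ?E = "cyl_ends (nsphere k) {snd (based_sphere k)}"
  let ?r = "\<lambda>((x, ts), t). (x, t # ts)" and ?\<sigma> = "sphere_suspension k"
  note \<sigma> = collapses_sphere_suspension[of k]
  have x0: "snd X \<in> topspace (fst X)" using X by (simp add: based_space_def)
  obtain Q where Q: "collapses ?P ?S (iterated_suspension k X) Q" using Suc by auto
  have "inj ?r" by (auto simp: inj_on_def)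
  from collapses_rename[OF collapses_suspension[OF Q] this]
  obtain R where R: "collapses (cyl ?P) (cyl_ends ?P ?S) (iterated_suspension (Suc k) X) R" by auto
  define C :: "((nat \<Rightarrow> real) \<times> 'x) \<times> real \<Rightarrow> (nat \<Rightarrow> real) \<times> 'x"
    where "C = (\<lambda>z. (?\<sigma> (fst (fst z), snd z), snd (fst z)))"
  have "quotient_map (prod_topology (cyl (nsphere k)) (fst X)) ?P' (\<lambda>(z, x). (?\<sigma> z, x))"
    using quotient_map_prod_left[OF X(2) _ collapsesD(1)[OF \<sigma>]] X(3) by (simp add: based_sphere_def)
  moreover have "homeomorphic_map (cyl ?P) (prod_topology (cyl (nsphere k)) (fst X)) (\<lambda>z. ((fst (fst z), snd z), snd (fst z)))"
  proof -
    have "homeomorphic_maps (cyl ?P) (prod_topology (cyl (nsphere k)) (fst X))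
        (\<lambda>z. ((fst (fst z), snd z), snd (fst z))) (\<lambda>z. ((fst (fst z), snd z), snd (fst z)))"
      unfolding homeomorphic_maps_def by (intro conjI ballI; ((rule cont)+ | simp))
    then show ?thesis by (rule homeomorphic_maps_imp_map)
  qed
  ultimately have "quotient_map (cyl ?P) ?P' ((\<lambda>(z, x). (?\<sigma> z, x)) \<circ> (\<lambda>z. ((fst (fst z), snd z), snd (fst z))))"
    by (intro quotient_map_compose) (auto simp: homeomorphic_map_def)
  then have C: "quotient_map (cyl ?P) ?P' C" by (simp add: C_def o_def)
  have mem: "((s, x), t) \<in> cyl_ends ?P ?S \<longleftrightarrow>
      s \<in> topspace (nsphere k) \<and> x \<in> topspace (fst X) \<and> t \<in> {0..1} \<and> ((s, t) \<in> ?E \<or> x = snd X)" for s x t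
    using x0 pole_in_nsphere[of k] by (auto simp: cyl_ends_def)
  have fib: "z = w \<or> z \<in> cyl_ends ?P ?S \<and> w \<in> cyl_ends ?P ?S"
    if z: "z \<in> topspace (cyl ?P)" and w: "w \<in> topspace (cyl ?P)" and eq: "C z = C w" for z w
  proof -
    obtain s x t where e: "z = ((s, x), t)" "s \<in> topspace (nsphere k)" "x \<in> topspace (fst X)" "t \<in> {0..1}" using z by auto
    obtain s' x' t' where e': "w = ((s', x'), t')" "s' \<in> topspace (nsphere k)" "x' \<in> topspace (fst X)" "t' \<in> {0..1}"
      using w by auto
    have "?\<sigma> (s, t) = ?\<sigma> (s', t')" and x: "x = x'" using eq by (simp_all add: C_def e(1) e'(1))
    then have "(s, t) = (s', t') \<or> (s, t) \<in> ?E \<and> (s', t') \<in> ?E"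
      using collapsesD(8)[OF \<sigma>, of "(s, t)" "(s', t')"] e e' by simp
    then show ?thesis using e e' x by (auto simp: mem)
  qed
  obtain Q' where Q': "collapses ?P' (C ` cyl_ends ?P ?S) (iterated_suspension (Suc k) X) Q'"
    by (rule collapses_factor[OF R C fib]) (assumption, assumption, assumption, rule that)
  have "C ` cyl_ends ?P ?S = topspace (nsphere (Suc k)) \<times> {snd X} \<union> {snd (based_sphere (Suc k))} \<times> topspace (fst X)"
  proof (rule Set.set_eqI)
    fix y
    have im: "?\<sigma> ` topspace (cyl (nsphere k)) = topspace (nsphere (Suc k))"
      using collapsesD(5)[OF \<sigma>] by (simp add: based_sphere_def)
    have pole: "?\<sigma> (s, t) = snd (based_sphere (Suc k)) \<longleftrightarrow> (s, t) \<in> ?E" if "s \<in> topspace (nsphere k)" "t \<in> {0..1}" for s t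
      using collapsesD(7)[OF \<sigma>, of "(s, t)"] that by simp
    show "y \<in> C ` cyl_ends ?P ?S \<longleftrightarrow>
        y \<in> topspace (nsphere (Suc k)) \<times> {snd X} \<union> {snd (based_sphere (Suc k))} \<times> topspace (fst X)"
    proof
      assume "y \<in> C ` cyl_ends ?P ?S"
      then obtain s x t where e: "((s, x), t) \<in> cyl_ends ?P ?S" "y = C ((s, x), t)" by auto
      then have "?\<sigma> (s, t) \<in> topspace (nsphere (Suc k))"
        using sphere_suspension_in_nsphere by (simp add: mem)
      then show "y \<in> topspace (nsphere (Suc k)) \<times> {snd X} \<union> {snd (based_sphere (Suc k))} \<times> topspace (fst X)"
        using e(1) pole[of s t] unfolding e(2) mem by (auto simp: C_def)
    next
      assume y: "y \<in> topspace (nsphere (Suc k)) \<times> {snd X} \<union> {snd (based_sphere (Suc k))} \<times> topspace (fst X)"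
      then have "fst y \<in> ?\<sigma> ` topspace (cyl (nsphere k))" and x: "snd y \<in> topspace (fst X)"
        unfolding im using x0 pole_in_nsphere[of "Suc k"] by auto
      then obtain s t where st: "fst y = ?\<sigma> (s, t)" "s \<in> topspace (nsphere k)" "t \<in> {0..1}" by auto
      have "((s, snd y), t) \<in> cyl_ends ?P ?S"
        unfolding mem using st x y pole[OF st(2,3)] by auto
      moreover have "y = C ((s, snd y), t)" using st(1) by (simp add: C_def prod_eq_iff)
      ultimately show "y \<in> C ` cyl_ends ?P ?S" by (rule image_eqI[rotated])
    qed
  qed
  then show ?case using Q' by auto
qed

theorem theorem2:
  fixes X :: "'x based" and Y :: "'y based" and A :: "'a based"
  assumes "based_space X" and "based_space Y" and "based_space A"
    and "locally_compact_space (fst X)" and "locally_compact_space (fst Y)"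
    and "locally_compact_space (fst A)"
    and "Hausdorff_space (fst X)" and "Hausdorff_space (fst Y)" and "Hausdorff_space (fst A)"
    and "well_pointed X" and "well_pointed Y" and "well_pointed A"
    and "path_connected_space (fst X)" and "path_connected_space (fst Y)"
  shows "(comm_group (gottlieb_group A (null_component X Y)) \<and>
          comm_group (gottlieb_group A Y \<times>\<times> gottlieb_group (smash A X) Y) \<and>
          gottlieb_group A (null_component X Y)
            \<cong> gottlieb_group A Y \<times>\<times> gottlieb_group (smash A X) Y) \<and>
         (\<forall>n\<ge>1.
          comm_group (gottlieb_n n (null_component X Y)) \<and>
          comm_group (gottlieb_n n Y \<times>\<times> gottlieb_group (iterated_suspension (n - 1) X) Y) \<and>
          gottlieb_n n (null_component X Y)
            \<cong> gottlieb_n n Y \<times>\<times> gottlieb_group (iterated_suspension (n - 1) X) Y)"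
proof -
  note X = assms(1,4,7,10) and Y = assms(2,5,8,14) and A = assms(3,6,9)
  have comm_prod: "comm_group (G \<times>\<times> H)" if "comm_group G" "comm_group H" for G :: "'g monoid" and H :: "'h monoid"
  proof -
    interpret G: comm_group G by (rule that)
    interpret H: comm_group H by (rule that)
    show ?thesis
      by (rule group.group_comm_groupI[OF DirProd_group[OF G.group_axioms H.group_axioms]])
         (auto simp: mult_DirProd' G.m_comm H.m_comm)
  qed
  have smash: "collapses (prod_topology (fst A) (fst X))
      (topspace (fst A) \<times> {snd X} \<union> {snd A} \<times> topspace (fst X)) (smash A X)
      (collapse_map (topspace (fst A) \<times> {snd X} \<union> {snd A} \<times> topspace (fst X)) (snd A, snd X))"
    unfolding smash_def by (rule collapses_collapse) (use X(1) A(1) in \<open>auto simp: based_space_def\<close>)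
  note first = gottlieb_null_component_iso[OF X Y A smash]
  have "comm_group (gottlieb_n n (null_component X Y)) \<and>
      comm_group (gottlieb_n n Y \<times>\<times> gottlieb_group (iterated_suspension (n - 1) X) Y) \<and>
      gottlieb_n n (null_component X Y) \<cong> gottlieb_n n Y \<times>\<times> gottlieb_group (iterated_suspension (n - 1) X) Y" for n
  proof -
    let ?k = "n - 1"
    obtain Q where Q: "collapses (prod_topology (nsphere ?k) (fst X))
        (topspace (nsphere ?k) \<times> {snd X} \<union> {snd (based_sphere ?k)} \<times> topspace (fst X)) (iterated_suspension ?k X) Q"
      using collapses_iterated_suspension[OF X(1-3)] by blast
    have fst: "fst (based_sphere ?k) = nsphere ?k" by (simp add: based_sphere_def)
    have S: "based_space (based_sphere ?k)" "locally_compact_space (fst (based_sphere ?k))"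
      "Hausdorff_space (fst (based_sphere ?k))"
      unfolding based_space_def fst
      using pole_in_nsphere compact_imp_locally_compact_space[OF compact_nsphere] Hausdorff_nsphere by auto
    note iso = gottlieb_null_component_iso[OF X Y S Q[folded fst]]
    show ?thesis unfolding gottlieb_n_def using iso comm_prod by blast
  qed
  then show ?thesis using first comm_prod by blast
qed

end
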